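(* Let $A$ and $B$ be connected graded unital $\mathbb K$-algebras. A graded twisting map $\tau:B\otimes A\to A\otimes B$ has the unique extension property if and only if $A\otimes_\tau B$ is $\tau$-quadratic.
   Context: $\mathbb K$ is a field, $\otimes=\otimes_{\mathbb K}$. Graded means $\mathbb N$-graded; connected means $A_0=\mathbb K1_A$. $\mu_A$ is the multiplication of $A$; $1_A$ also denotes the identity map of $A$. Tensor products of graded spaces are graded by $(V\otimes W)_m=\bigoplus_{k+l=m}V_k\otimes W_l$. A linear map is graded if it preserves degree; $f_n$ is its degree $n$ component, $f_{\le n}=\bigoplus_{i\le n}f_i$. A graded twisting map is a graded linear map $\tau:B\otimes A\to A\otimes B$ with $\tau(1_B\otimes a)=a\otimes 1_B$, $\tau(b\otimes 1_A)=1_A\otimes b$ and $\tau(\mu_B\otimes\mu_A)=(\mu_A\otimes\mu_B)(1_A\otimes\tau\otimes 1_B)(\tau\otimes\tau)(1_B\otimes\tau\otimes 1_A)$ on $B\otimes B\otimes A\otimes A$. Then $A\otimes_\tau B$ is the graded associative algebra with underlying space $A\otimes B$ and multiplication $(\mu_A\otimes\mu_B)(1_A\otimes\tau\otimes 1_B)$. A graded linear map $t:(B\otimes A)_{\le n}\to(A\otimes B)_{\le n}$ is graded twisting to degree $n$ if for each $i\le n$: $t(1_B\otimes a)=a\otimes 1_B$, $t(b\otimes 1_A)=1_A\otimes b$ for $a\in A_i$, $b\in B_i$, and $t_i(\mu_B\otimes\mu_A)=(\mu_A\otimes\mu_B)(1_A\otimes t_{\le i}\otimes 1_B)(t_{\le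 i}\otimes t_{\le i})(1_B\otimes t_{\le i}\otimes 1_A)$ on $(B\otimes B\otimes A\otimes A)_i$. A graded linear map $B\otimes A\to A\otimes B$ is graded twisting to degree $n$ if its restriction to $(B\otimes A)_{\le n}$ is. $\tau$ has the unique extension property if for every $n\ge 3$ and every graded linear map $\tau':B\otimes A\to A\otimes B$ that is graded twisting to degree $n$ and satisfies $\tau'_i=\tau_i$ for all $i<n$, one has $\tau'_n=\tau_n$. Let $A\ast B$ be the free product (coproduct) of the algebras $A$ and $B$, graded in the natural way; $b\otimes a$ is identified with the product $ba\in A\ast B$ and $a\otimes b\in A\otimes B$ with $ab\in A\ast B$. $I_\tau$ is the two-sided ideal of $A\ast B$ generated by all elements $b\otimes a-\tau(b\otimes a)$, $a\in A$, $b\in B$. $A\otimes_\tau B$ is called $\tau$-quadratic if the ideal $I_\tau$ is generated by homogeneous elements of degree $2$. *)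

theory Defs
  imports
    Complex_Main
    "HOL-Algebra.QuotRing"
    "HOL-Library.Function_Algebras"
    "HOL-Library.Poly_Mapping"
begin

section \<open>Graded vector spaces\<close>

text \<open>
  A graded vector space over the field \<^typ>\<open>'k\<close>, with underlying set \<open>elems\<close> inside an ambient
  vector space given by \<open>scl\<close> and the additive group of the type \<^typ>\<open>'v\<close>.
\<close>

record ('k, 'v) gspace =
  elems :: "'v set"
  scl :: "'k \<Rightarrow> 'v \<Rightarrow> 'v"
  homog :: "nat \<Rightarrow> 'v set"

definition graded_space :: "('k::field, 'v::ab_group_add) gspace \<Rightarrow> bool" where
  "graded_space V \<longleftrightarrow>
     vector_space (scl V) \<and>
     module.subspace (scl V) (elems V) \<and>
     (\<forall>n. module.subspace (scl V) (homog V n) \<and> homog V n \<subseteq> elems V) \<and>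
     (\<forall>x\<in>elems V. \<exists>!f. (\<forall>n. f n \<in> homog V n) \<and> finite {n. f n \<noteq> 0} \<and>
        x = (\<Sum>n | f n \<noteq> 0. f n))"

definition graded_linear ::
    "('k::field, 'v::ab_group_add) gspace \<Rightarrow> ('k, 'w::ab_group_add) gspace \<Rightarrow> ('v \<Rightarrow> 'w) \<Rightarrow> bool" where
  "graded_linear V W f \<longleftrightarrow>
     f ` elems V \<subseteq> elems W \<and>
     (\<forall>x\<in>elems V. \<forall>y\<in>elems V. f (x + y) = f x + f y) \<and>
     (\<forall>c. \<forall>x\<in>elems V. f (scl V c x) = scl W c (f x)) \<and>
     (\<forall>n. f ` homog V n \<subseteq> homog W n)"

text \<open>
  The sort \<open>{ring, monoid_mult}\<close> is that of unital rings in which \<open>1 = 0\<close> is not excluded.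
\<close>

locale graded_algebra =
  fixes A :: "('k::field, 'a::{ring, monoid_mult}) gspace"
  assumes elems_UNIV: "elems A = UNIV"
    and graded: "graded_space A"
    and scl_mult_left: "scl A c (x * y) = scl A c x * y"
    and scl_mult_right: "scl A c (x * y) = x * scl A c y"
    and homog_one: "1 \<in> homog A 0"
    and homog_mult: "x \<in> homog A m \<Longrightarrow> y \<in> homog A n \<Longrightarrow> x * y \<in> homog A (m + n)"

locale connected_graded_algebra = graded_algebra +
  assumes connected: "homog A 0 = range (\<lambda>c. scl A c 1)"


section \<open>Tensor products\<close>

definition bilinear_map ::
    "('k::field, 'v::ab_group_add) gspace \<Rightarrow> ('k, 'w::ab_group_add) gspace \<Rightarrow> ('k \<Rightarrow> 'x \<Rightarrow> 'x) \<Rightarrow>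
     ('v \<Rightarrow> 'w \<Rightarrow> 'x::ab_group_add) \<Rightarrow> bool" where
  "bilinear_map V W s f \<longleftrightarrow>
     (\<forall>v\<in>elems V. \<forall>v'\<in>elems V. \<forall>w\<in>elems W. f (v + v') w = f v w + f v' w) \<and>
     (\<forall>v\<in>elems V. \<forall>w\<in>elems W. \<forall>w'\<in>elems W. f v (w + w') = f v w + f v w') \<and>
     (\<forall>c. \<forall>v\<in>elems V. \<forall>w\<in>elems W. f (scl V c v) w = s c (f v w)) \<and>
     (\<forall>c. \<forall>v\<in>elems V. \<forall>w\<in>elems W. f v (scl W c w) = s c (f v w))"

text \<open>
  The pure tensor \<open>v \<otimes> w\<close> is evaluation of bilinear forms at \<open>(v, w)\<close>, and \<open>V \<otimes> W\<close> is the span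
  of the pure tensors. Over a field this is the tensor product: bilinear maps out of
  \<open>V \<times> W\<close> factor uniquely through it, see \<open>tensor_universal\<close> below.
\<close>

type_synonym ('k, 'v, 'w) tensor = "('v \<Rightarrow> 'w \<Rightarrow> 'k) \<Rightarrow> 'k"

definition pure ::
    "('k::field, 'v::ab_group_add) gspace \<Rightarrow> ('k, 'w::ab_group_add) gspace \<Rightarrow> 'v \<Rightarrow> 'w \<Rightarrow>
     ('k, 'v, 'w) tensor" where
  "pure V W v w = (\<lambda>\<beta>. if bilinear_map V W (*) \<beta> then \<beta> v w else 0)"

definition tensor_scl :: "'k::field \<Rightarrow> ('k, 'v, 'w) tensor \<Rightarrow> ('k, 'v, 'w) tensor" where
  "tensor_scl c z = (\<lambda>\<beta>. c * z \<beta>)"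

definition tensor ::
    "('k::field, 'v::ab_group_add) gspace \<Rightarrow> ('k, 'w::ab_group_add) gspace \<Rightarrow>
     ('k, ('k, 'v, 'w) tensor) gspace" where
  "tensor V W =
     \<lparr>elems = module.span tensor_scl {pure V W v w | v w. v \<in> elems V \<and> w \<in> elems W},
      scl = tensor_scl,
      homog = (\<lambda>m. module.span tensor_scl
        {pure V W v w | v w. \<exists>k l. k + l = m \<and> v \<in> homog V k \<and> w \<in> homog W l})\<rparr>"

text \<open>
  For \<open>f\<close> bilinear, \<open>tensor_lift V W f\<close> is the induced linear map on \<open>V \<otimes> W\<close>,
  \<open>\<Sum> v\<^sub>i \<otimes> w\<^sub>i \<mapsto> \<Sum> f v\<^sub>i w\<^sub>i\<close>.
\<close>

definition tensor_lift ::
    "('k::field, 'v::ab_group_add) gspace \<Rightarrow> ('k, 'w::ab_group_add) gspace \<Rightarrow>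
     ('v \<Rightarrow> 'w \<Rightarrow> 'x::ab_group_add) \<Rightarrow> ('k, 'v, 'w) tensor \<Rightarrow> 'x" where
  "tensor_lift V W f z = (THE x. \<exists>ps. set ps \<subseteq> elems V \<times> elems W \<and>
     z = (\<Sum>(v, w)\<leftarrow>ps. pure V W v w) \<and> x = (\<Sum>(v, w)\<leftarrow>ps. f v w))"

definition tensor_map ::
    "('k::field, 'v::ab_group_add) gspace \<Rightarrow> ('k, 'w::ab_group_add) gspace \<Rightarrow>
     ('k, 'v'::ab_group_add) gspace \<Rightarrow> ('k, 'w'::ab_group_add) gspace \<Rightarrow>
     ('v \<Rightarrow> 'v') \<Rightarrow> ('w \<Rightarrow> 'w') \<Rightarrow> ('k, 'v, 'w) tensor \<Rightarrow> ('k, 'v', 'w') tensor" where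
  "tensor_map V W V' W' f g = tensor_lift V W (\<lambda>v w. pure V' W' (f v) (g w))"

text \<open>
  For \<open>f : V \<otimes> W \<rightarrow> V' \<otimes> W'\<close> this is \<open>1 \<otimes> f \<otimes> 1 : U \<otimes> V \<otimes> W \<otimes> X \<rightarrow> U \<otimes> V' \<otimes> W' \<otimes> X\<close>, with
  fourfold tensor products bracketed as \<open>(U \<otimes> V) \<otimes> (W \<otimes> X)\<close>: it maps
  \<open>(u \<otimes> v) \<otimes> (w \<otimes> x)\<close> to \<open>\<Sum> (u \<otimes> v'\<^sub>i) \<otimes> (w'\<^sub>i \<otimes> x)\<close>, where \<open>f (v \<otimes> w) = \<Sum> v'\<^sub>i \<otimes> w'\<^sub>i\<close>.
\<close>

definition tensor_mid ::
    "('k::field, 'u::ab_group_add) gspace \<Rightarrow> ('k, 'v::ab_group_add) gspace \<Rightarrow>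
     ('k, 'w::ab_group_add) gspace \<Rightarrow> ('k, 'x::ab_group_add) gspace \<Rightarrow>
     ('k, 'v'::ab_group_add) gspace \<Rightarrow> ('k, 'w'::ab_group_add) gspace \<Rightarrow>
     (('k, 'v, 'w) tensor \<Rightarrow> ('k, 'v', 'w') tensor) \<Rightarrow>
     ('k, ('k, 'u, 'v) tensor, ('k, 'w, 'x) tensor) tensor \<Rightarrow>
     ('k, ('k, 'u, 'v') tensor, ('k, 'w', 'x) tensor) tensor" where
  "tensor_mid U V W X V' W' f =
     tensor_lift (tensor U V) (tensor W X) (\<lambda>p q.
       tensor_lift U V (\<lambda>u v.
         tensor_lift W X (\<lambda>w x.
           tensor_lift V' W' (\<lambda>v' w'.
             pure (tensor U V') (tensor W' X) (pure U V' u v') (pure W' X w' x))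
           (f (pure V W v w))) q) p)"

definition mult_map ::
    "('k::field, 'a::{ring, monoid_mult}) gspace \<Rightarrow> ('k, 'a, 'a) tensor \<Rightarrow> 'a" where
  "mult_map A = tensor_lift A A (*)"


section \<open>Graded twisting maps\<close>

text \<open>
  \<open>t(\<mu>\<^sub>B \<otimes> \<mu>\<^sub>A) = (\<mu>\<^sub>A \<otimes> \<mu>\<^sub>B)(1\<^sub>A \<otimes> t \<otimes> 1\<^sub>B)(t \<otimes> t)(1\<^sub>B \<otimes> t \<otimes> 1\<^sub>A)\<close> at \<open>z \<in> (B \<otimes> B) \<otimes> (A \<otimes> A)\<close>.
\<close>

definition twisting_identity ::
    "('k::field, 'a::{ring, monoid_mult}) gspace \<Rightarrow> ('k, 'b::{ring, monoid_mult}) gspace \<Rightarrow>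
     (('k, 'b, 'a) tensor \<Rightarrow> ('k, 'a, 'b) tensor) \<Rightarrow>
     ('k, ('k, 'b, 'b) tensor, ('k, 'a, 'a) tensor) tensor \<Rightarrow> bool" where
  "twisting_identity A B t z \<longleftrightarrow>
     t (tensor_map (tensor B B) (tensor A A) B A (mult_map B) (mult_map A) z) =
     tensor_map (tensor A A) (tensor B B) A B (mult_map A) (mult_map B)
       (tensor_mid A B A B A B t
         (tensor_map (tensor B A) (tensor B A) (tensor A B) (tensor A B) t t
           (tensor_mid B B A A A B t z)))"

definition graded_twisting_map ::
    "('k::field, 'a::{ring, monoid_mult}) gspace \<Rightarrow> ('k, 'b::{ring, monoid_mult}) gspace \<Rightarrow>
     (('k, 'b, 'a) tensor \<Rightarrow> ('k, 'a, 'b) tensor) \<Rightarrow> bool" where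
  "graded_twisting_map A B \<tau> \<longleftrightarrow>
     graded_linear (tensor B A) (tensor A B) \<tau> \<and>
     (\<forall>a\<in>elems A. \<tau> (pure B A 1 a) = pure A B a 1) \<and>
     (\<forall>b\<in>elems B. \<tau> (pure B A b 1) = pure A B 1 b) \<and>
     (\<forall>z\<in>elems (tensor (tensor B B) (tensor A A)). twisting_identity A B \<tau> z)"

text \<open>
  On the component of degree \<open>i\<close> of \<open>B \<otimes> B \<otimes> A \<otimes> A\<close> the twisting identity involves \<open>t\<close> only in
  degrees up to \<open>i\<close>, so it is stated with \<open>t\<close> itself in place of \<open>t\<^bsub>\<le>i\<^esub>\<close>.
\<close>

definition twisting_to_degree ::
    "('k::field, 'a::{ring, monoid_mult}) gspace \<Rightarrow> ('k, 'b::{ring, monoid_mult}) gspace \<Rightarrow> nat \<Rightarrow>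
     (('k, 'b, 'a) tensor \<Rightarrow> ('k, 'a, 'b) tensor) \<Rightarrow> bool" where
  "twisting_to_degree A B n t \<longleftrightarrow>
     (\<forall>i\<le>n.
        (\<forall>a\<in>homog A i. t (pure B A 1 a) = pure A B a 1) \<and>
        (\<forall>b\<in>homog B i. t (pure B A b 1) = pure A B 1 b) \<and>
        (\<forall>z\<in>homog (tensor (tensor B B) (tensor A A)) i. twisting_identity A B t z))"

definition unique_extension_property ::
    "('k::field, 'a::{ring, monoid_mult}) gspace \<Rightarrow> ('k, 'b::{ring, monoid_mult}) gspace \<Rightarrow>
     (('k, 'b, 'a) tensor \<Rightarrow> ('k, 'a, 'b) tensor) \<Rightarrow> bool" where
  "unique_extension_property A B \<tau> \<longleftrightarrow>
     (\<forall>n\<ge>3. \<forall>\<tau>'.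
        graded_linear (tensor B A) (tensor A B) \<tau>' \<longrightarrow>
        twisting_to_degree A B n \<tau>' \<longrightarrow>
        (\<forall>i<n. \<forall>z\<in>homog (tensor B A) i. \<tau>' z = \<tau> z) \<longrightarrow>
        (\<forall>z\<in>homog (tensor B A) n. \<tau>' z = \<tau> z))"


section \<open>The free product of two algebras\<close>

instantiation list :: (type) monoid_add
begin

definition zero_list :: "'a list" where "0 = []"
definition plus_list :: "'a list \<Rightarrow> 'a list \<Rightarrow> 'a list" where "xs + ys = xs @ ys"

instance by standard (simp_all add: zero_list_def plus_list_def)

end

text \<open>
  Words under concatenation form a monoid, so \<^typ>\<open>('a + 'b) list \<Rightarrow>\<^sub>0 'k\<close>, with its convolution
  product, is the free unital associative algebra on the disjoint union of \<^typ>\<open>'a\<close> and \<^typ>\<open>'b\<close>.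
\<close>

type_synonym ('k, 'a, 'b) free_alg = "('a + 'b) list \<Rightarrow>\<^sub>0 'k"

definition free_scl :: "'k::field \<Rightarrow> ('k, 'a, 'b) free_alg \<Rightarrow> ('k, 'a, 'b) free_alg" where
  "free_scl c p = Poly_Mapping.single 0 c * p"

definition word :: "('a + 'b) list \<Rightarrow> ('k::field, 'a, 'b) free_alg" where
  "word xs = Poly_Mapping.single xs 1"

abbreviation genA :: "'a \<Rightarrow> ('k::field, 'a, 'b) free_alg" where "genA a \<equiv> word [Inl a]"
abbreviation genB :: "'b \<Rightarrow> ('k::field, 'a, 'b) free_alg" where "genB b \<equiv> word [Inr b]"

definition free_ring :: "('k::field, 'a, 'b) free_alg ring" where
  "free_ring = \<lparr>carrier = UNIV, monoid.mult = (*), one = 1, zero = 0, add = (+)\<rparr>"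

definition free_product_relations ::
    "('k::field, 'a::{ring, monoid_mult}) gspace \<Rightarrow> ('k, 'b::{ring, monoid_mult}) gspace \<Rightarrow>
     ('k, 'a, 'b) free_alg set" where
  "free_product_relations A B =
     {genA (a + a') - (genA a + genA a') | a a'. True} \<union>
     {genA (scl A c a) - free_scl c (genA a) | c a. True} \<union>
     {genA (a * a') - genA a * genA a' | a a'. True} \<union>
     {genA 1 - 1} \<union>
     {genB (b + b') - (genB b + genB b') | b b'. True} \<union>
     {genB (scl B c b) - free_scl c (genB b) | c b. True} \<union>
     {genB (b * b') - genB b * genB b' | b b'. True} \<union>
     {genB 1 - 1}"

definition free_product_ideal ::
    "('k::field, 'a::{ring, monoid_mult}) gspace \<Rightarrow> ('k, 'b::{ring, monoid_mult}) gspace \<Rightarrow>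
     ('k, 'a, 'b) free_alg set" where
  "free_product_ideal A B = Idl\<^bsub>free_ring\<^esub> (free_product_relations A B)"

definition free_product ::
    "('k::field, 'a::{ring, monoid_mult}) gspace \<Rightarrow> ('k, 'b::{ring, monoid_mult}) gspace \<Rightarrow>
     ('k, 'a, 'b) free_alg set ring" where
  "free_product A B = free_ring Quot (free_product_ideal A B)"

definition free_product_class ::
    "('k::field, 'a::{ring, monoid_mult}) gspace \<Rightarrow> ('k, 'b::{ring, monoid_mult}) gspace \<Rightarrow>
     ('k, 'a, 'b) free_alg \<Rightarrow> ('k, 'a, 'b) free_alg set" where
  "free_product_class A B p = free_product_ideal A B +>\<^bsub>free_ring\<^esub> p"

fun letter_homog ::
    "('k, 'a) gspace \<Rightarrow> ('k, 'b) gspace \<Rightarrow> 'a + 'b \<Rightarrow> nat \<Rightarrow> bool" where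
  "letter_homog A B (Inl a) d \<longleftrightarrow> a \<in> homog A d"
| "letter_homog A B (Inr b) d \<longleftrightarrow> b \<in> homog B d"

text \<open>
  The component of degree \<open>m\<close> of \<open>A * B\<close> is spanned by the products of homogeneous elements of
  \<open>A\<close> and \<open>B\<close> whose degrees add up to \<open>m\<close>.
\<close>

definition free_product_homog ::
    "('k::field, 'a::{ring, monoid_mult}) gspace \<Rightarrow> ('k, 'b::{ring, monoid_mult}) gspace \<Rightarrow> nat \<Rightarrow>
     ('k, 'a, 'b) free_alg set set" where
  "free_product_homog A B m = free_product_class A B `
     module.span free_scl {word xs | xs. \<exists>ds. list_all2 (letter_homog A B) xs ds \<and> sum_list ds = m}"

text \<open>
  The linear map \<open>A \<otimes> B \<rightarrow> A * B\<close> with \<open>a \<otimes> b \<mapsto> ab\<close>.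
\<close>

definition tensor_to_free_product ::
    "('k::field, 'a::{ring, monoid_mult}) gspace \<Rightarrow> ('k, 'b::{ring, monoid_mult}) gspace \<Rightarrow>
     ('k, 'a, 'b) tensor \<Rightarrow> ('k, 'a, 'b) free_alg set" where
  "tensor_to_free_product A B z = (THE X. \<exists>ps. set ps \<subseteq> elems A \<times> elems B \<and>
     z = (\<Sum>(a, b)\<leftarrow>ps. pure A B a b) \<and>
     X = free_product_class A B (\<Sum>(a, b)\<leftarrow>ps. genA a * genB b))"

definition twisting_ideal ::
    "('k::field, 'a::{ring, monoid_mult}) gspace \<Rightarrow> ('k, 'b::{ring, monoid_mult}) gspace \<Rightarrow>
     (('k, 'b, 'a) tensor \<Rightarrow> ('k, 'a, 'b) tensor) \<Rightarrow> ('k, 'a, 'b) free_alg set set" where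
  "twisting_ideal A B \<tau> = Idl\<^bsub>free_product A B\<^esub>
     {free_product_class A B (genB b) \<otimes>\<^bsub>free_product A B\<^esub> free_product_class A B (genA a)
        \<ominus>\<^bsub>free_product A B\<^esub> tensor_to_free_product A B (\<tau> (pure B A b a)) | a b.
      a \<in> elems A \<and> b \<in> elems B}"

definition tau_quadratic ::
    "('k::field, 'a::{ring, monoid_mult}) gspace \<Rightarrow> ('k, 'b::{ring, monoid_mult}) gspace \<Rightarrow>
     (('k, 'b, 'a) tensor \<Rightarrow> ('k, 'a, 'b) tensor) \<Rightarrow> bool" where
  "tau_quadratic A B \<tau> \<longleftrightarrow>
     (\<exists>S \<subseteq> free_product_homog A B 2. twisting_ideal A B \<tau> = Idl\<^bsub>free_product A B\<^esub> S)"

section \<open>Well-definedness\<close>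

lemma vector_space_tensor_scl: "vector_space tensor_scl"
  by unfold_locales (auto simp: tensor_scl_def algebra_simps fun_eq_iff)

lemma vector_space_times: "vector_space ((*) :: 'k::field \<Rightarrow> 'k \<Rightarrow> 'k)"
  by unfold_locales (auto simp: algebra_simps)

interpretation tensor_vs: vector_space tensor_scl
  by (rule vector_space_tensor_scl)

lemma sum_list_apply: "(\<Sum>p\<leftarrow>ps. g p) \<beta> = (\<Sum>p\<leftarrow>ps. g p \<beta>)"
  for g :: "'p \<Rightarrow> 'q \<Rightarrow> 'r::comm_monoid_add"
  by (induction ps) auto

text \<open>A relation between pure tensors holds for the values of every bilinear map.\<close>

lemma tensor_relation:
  fixes f :: "'v::ab_group_add \<Rightarrow> 'w::ab_group_add \<Rightarrow> 'x::ab_group_add"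
    and V :: "('k::field, 'v) gspace"
  assumes X: "vector_space s" and f: "bilinear_map V W s f"
    and ps: "set ps \<subseteq> elems V \<times> elems W" and 0: "(\<Sum>(v, w)\<leftarrow>ps. pure V W v w) = 0"
  shows "(\<Sum>(v, w)\<leftarrow>ps. f v w) = 0"
proof (rule ccontr)
  let ?y = "\<Sum>(v, w)\<leftarrow>ps. f v w"
  assume y: "?y \<noteq> 0"
  interpret vector_space_pair s "(*) :: 'k \<Rightarrow> 'k \<Rightarrow> 'k"
    using X vector_space_times by (rule vector_space_pair.intro)
  have "vs1.independent {?y}"
    using y by (simp add: vs1.dependent_single)
  from linear_independent_extend[OF this, of "\<lambda>_. 1"]
  obtain \<phi> where \<phi>: "Vector_Spaces.linear s (*) \<phi>" and y1: "\<phi> ?y = 1"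
    by auto
  have bil: "bilinear_map V W (*) (\<lambda>v w. \<phi> (f v w))"
    using f \<phi> unfolding bilinear_map_def by (simp add: linear_add linear_scale)
  have "\<phi> (\<Sum>(v, w)\<leftarrow>qs. f v w) = (\<Sum>(v, w)\<leftarrow>qs. \<phi> (f v w))" for qs
    using \<phi> by (induction qs) (auto simp: linear_add linear_0)
  also have "(\<Sum>(v, w)\<leftarrow>ps. \<phi> (f v w)) = (\<Sum>(v, w)\<leftarrow>ps. pure V W v w) (\<lambda>v w. \<phi> (f v w))"
    using bil by (simp add: sum_list_apply pure_def case_prod_unfold)
  finally show False
    using y1 0 by simp
qed

definition subspace_of_vector_space :: "('k::field, 'v::ab_group_add) gspace \<Rightarrow> bool" where
  "subspace_of_vector_space V \<longleftrightarrow> vector_space (scl V) \<and> module.subspace (scl V) (elems V)"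

lemma subspace_of_vector_spaceD:
  assumes "subspace_of_vector_space V"
  shows "0 \<in> elems V" "x \<in> elems V \<Longrightarrow> y \<in> elems V \<Longrightarrow> x + y \<in> elems V"
    "x \<in> elems V \<Longrightarrow> scl V c x \<in> elems V" "scl V (- 1) x = - x"
proof -
  interpret vector_space "scl V"
    using assms by (simp add: subspace_of_vector_space_def)
  show "0 \<in> elems V" "x \<in> elems V \<Longrightarrow> y \<in> elems V \<Longrightarrow> x + y \<in> elems V"
    "x \<in> elems V \<Longrightarrow> scl V c x \<in> elems V" "scl V (- 1) x = - x"
    using assms by (auto simp: subspace_of_vector_space_def subspace_def)
qed

lemma graded_space_subspace: "graded_space V \<Longrightarrow> subspace_of_vector_space V"
  by (simp add: graded_space_def subspace_of_vector_space_def)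

lemma subspace_of_vector_space_tensor: "subspace_of_vector_space (tensor V W)"
  using tensor_vs.vector_space_axioms
  by (simp add: subspace_of_vector_space_def tensor_def tensor_vs.subspace_span)

lemma bilinear_map_scl_sum_list:
  assumes X: "vector_space s" and f: "bilinear_map V W s f" and ps: "set ps \<subseteq> elems V \<times> elems W"
  shows "(\<Sum>(v, w)\<leftarrow>map (\<lambda>(v, w). (scl V c v, w)) ps. f v w) = s c (\<Sum>(v, w)\<leftarrow>ps. f v w)"
proof -
  interpret vector_space s by (rule X)
  show ?thesis
    using ps
  proof (induction ps)
    case (Cons p ps)
    then show ?case
      using f by (cases p) (auto simp: bilinear_map_def scale_right_distrib)
  qed simp
qed

lemma bilinear_map_pure:
  assumes "subspace_of_vector_space V" "subspace_of_vector_space W"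
  shows "bilinear_map V W tensor_scl (pure V W)"
  by (auto simp: bilinear_map_def pure_def tensor_scl_def fun_eq_iff)

lemma tensor_relation_eq:
  assumes V: "subspace_of_vector_space V" and W: "subspace_of_vector_space W"
    and X: "vector_space s" and f: "bilinear_map V W s f"
    and ps: "set ps \<subseteq> elems V \<times> elems W" and qs: "set qs \<subseteq> elems V \<times> elems W"
    and eq: "(\<Sum>(v, w)\<leftarrow>ps. pure V W v w) = (\<Sum>(v, w)\<leftarrow>qs. pure V W v w)"
  shows "(\<Sum>(v, w)\<leftarrow>ps. f v w) = (\<Sum>(v, w)\<leftarrow>qs. f v w)"
proof -
  let ?n = "map (\<lambda>(v, w). (scl V (- 1) v, w)) qs"
  have n: "set ?n \<subseteq> elems V \<times> elems W"
    using qs by (auto simp: subspace_of_vector_spaceD(3)[OF V])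
  have "(\<Sum>(v, w)\<leftarrow>ps @ ?n. pure V W v w) = 0"
    using eq bilinear_map_scl_sum_list[OF vector_space_tensor_scl bilinear_map_pure[OF V W] qs, of "- 1"]
    by simp
  from tensor_relation[OF X f _ this]
  have "(\<Sum>(v, w)\<leftarrow>ps @ ?n. f v w) = 0"
    using ps n by simp
  interpret vector_space s by (rule X)
  show ?thesis
    using \<open>(\<Sum>(v, w)\<leftarrow>ps @ ?n. f v w) = 0\<close> bilinear_map_scl_sum_list[OF X f qs, of "- 1"]
    by simp
qed

lemma tensor_elems_iff:
  assumes V: "subspace_of_vector_space V" and W: "subspace_of_vector_space W"
  shows "z \<in> elems (tensor V W) \<longleftrightarrow>
    (\<exists>ps. set ps \<subseteq> elems V \<times> elems W \<and> z = (\<Sum>(v, w)\<leftarrow>ps. pure V W v w))"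
proof
  assume "z \<in> elems (tensor V W)"
  then have "z \<in> tensor_vs.span {pure V W v w | v w. v \<in> elems V \<and> w \<in> elems W}"
    by (simp add: tensor_def)
  then show "\<exists>ps. set ps \<subseteq> elems V \<times> elems W \<and> z = (\<Sum>(v, w)\<leftarrow>ps. pure V W v w)"
  proof (induction rule: tensor_vs.span_induct_alt)
    case base
    show ?case by (rule exI[of _ "[]"]) simp
  next
    case (step c x y)
    then obtain v w ps where "x = pure V W v w" "v \<in> elems V" "w \<in> elems W"
      and "set ps \<subseteq> elems V \<times> elems W" "y = (\<Sum>(v, w)\<leftarrow>ps. pure V W v w)"
      by blast
    moreover from this have "tensor_scl c x = pure V W (scl V c v) w"
      using bilinear_map_pure[OF V W] by (simp add: bilinear_map_def)
    ultimately show ?case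
      by (intro exI[of _ "(scl V c v, w) # ps"]) (simp add: subspace_of_vector_spaceD[OF V])
  qed
next
  assume "\<exists>ps. set ps \<subseteq> elems V \<times> elems W \<and> z = (\<Sum>(v, w)\<leftarrow>ps. pure V W v w)"
  then obtain ps where "set ps \<subseteq> elems V \<times> elems W" "z = (\<Sum>(v, w)\<leftarrow>ps. pure V W v w)"
    by blast
  then show "z \<in> elems (tensor V W)"
  proof (induction ps arbitrary: z)
    case Nil
    then show ?case
      using subspace_of_vector_spaceD(1)[OF subspace_of_vector_space_tensor, of V W]
      by (simp add: zero_fun_def)
  next
    case (Cons p ps)
    then have "(\<Sum>(v, w)\<leftarrow>ps. pure V W v w) \<in> elems (tensor V W)" 
      by simp
    moreover have "(case p of (v, w) \<Rightarrow> pure V W v w) \<in> elems (tensor V W)"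
      using Cons.prems by (auto simp: tensor_def intro!: tensor_vs.span_base)
    ultimately have "(case p of (v, w) \<Rightarrow> pure V W v w) + (\<Sum>(v, w)\<leftarrow>ps. pure V W v w)
        \<in> elems (tensor V W)"
      by (rule subspace_of_vector_spaceD(2)[OF subspace_of_vector_space_tensor, rotated])
    then show ?case
      using Cons.prems by (simp add: plus_fun_def)
  qed
qed

lemma tensor_lift_sum_list:
  assumes V: "subspace_of_vector_space V" and W: "subspace_of_vector_space W"
    and X: "vector_space s" and f: "bilinear_map V W s f" and ps: "set ps \<subseteq> elems V \<times> elems W"
  shows "tensor_lift V W f (\<Sum>(v, w)\<leftarrow>ps. pure V W v w) = (\<Sum>(v, w)\<leftarrow>ps. f v w)"
  unfolding tensor_lift_def
proof (rule the_equality)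
  show "\<exists>qs. set qs \<subseteq> elems V \<times> elems W \<and>
      (\<Sum>(v, w)\<leftarrow>ps. pure V W v w) = (\<Sum>(v, w)\<leftarrow>qs. pure V W v w) \<and>
      (\<Sum>(v, w)\<leftarrow>ps. f v w) = (\<Sum>(v, w)\<leftarrow>qs. f v w)"
    using ps by blast
next
  fix x
  assume "\<exists>qs. set qs \<subseteq> elems V \<times> elems W \<and>
      (\<Sum>(v, w)\<leftarrow>ps. pure V W v w) = (\<Sum>(v, w)\<leftarrow>qs. pure V W v w) \<and> x = (\<Sum>(v, w)\<leftarrow>qs. f v w)"
  then show "x = (\<Sum>(v, w)\<leftarrow>ps. f v w)"
    using tensor_relation_eq[OF V W X f ps] by metis
qed

theorem tensor_universal:
  assumes V: "subspace_of_vector_space V" and W: "subspace_of_vector_space W"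
    and X: "vector_space s" and f: "bilinear_map V W s f"
  shows "v \<in> elems V \<Longrightarrow> w \<in> elems W \<Longrightarrow> tensor_lift V W f (pure V W v w) = f v w"
    and "y \<in> elems (tensor V W) \<Longrightarrow> z \<in> elems (tensor V W) \<Longrightarrow>
      tensor_lift V W f (y + z) = tensor_lift V W f y + tensor_lift V W f z"
    and "z \<in> elems (tensor V W) \<Longrightarrow>
      tensor_lift V W f (tensor_scl c z) = s c (tensor_lift V W f z)"
    and "\<lbrakk>\<And>v w. v \<in> elems V \<Longrightarrow> w \<in> elems W \<Longrightarrow> g (pure V W v w) = f v w;
      \<And>y z. y \<in> elems (tensor V W) \<Longrightarrow> z \<in> elems (tensor V W) \<Longrightarrow> g (y + z) = g y + g z;
      z \<in> elems (tensor V W)\<rbrakk> \<Longrightarrow> g z = tensor_lift V W f z"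
proof -
  note lift = tensor_lift_sum_list[OF V W X f]
  show "tensor_lift V W f (pure V W v w) = f v w" if "v \<in> elems V" "w \<in> elems W"
    using lift[of "[(v, w)]"] that by simp
  show "tensor_lift V W f (y + z) = tensor_lift V W f y + tensor_lift V W f z"
    if yz: "y \<in> elems (tensor V W)" "z \<in> elems (tensor V W)"
  proof -
    from yz obtain ps qs where ps: "set ps \<subseteq> elems V \<times> elems W" "set qs \<subseteq> elems V \<times> elems W"
      and [simp]: "y = (\<Sum>(v, w)\<leftarrow>ps. pure V W v w)" "z = (\<Sum>(v, w)\<leftarrow>qs. pure V W v w)"
      unfolding tensor_elems_iff[OF V W] by blast
    show ?thesis
      using lift[of "ps @ qs"] lift[of ps] lift[of qs] ps by simp
  qed
  show "tensor_lift V W f (tensor_scl c z) = s c (tensor_lift V W f z)"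
    if z: "z \<in> elems (tensor V W)"
  proof -
    from z obtain ps where ps: "set ps \<subseteq> elems V \<times> elems W"
      and [simp]: "z = (\<Sum>(v, w)\<leftarrow>ps. pure V W v w)"
      unfolding tensor_elems_iff[OF V W] by blast
    let ?n = "map (\<lambda>(v, w). (scl V c v, w)) ps"
    have "set ?n \<subseteq> elems V \<times> elems W"
      using ps by (auto simp: subspace_of_vector_spaceD(3)[OF V])
    from lift[OF this] show ?thesis
      unfolding bilinear_map_scl_sum_list[OF X f ps]
        bilinear_map_scl_sum_list[OF vector_space_tensor_scl bilinear_map_pure[OF V W] ps]
      by (simp add: lift[OF ps])
  qed
  show "g z = tensor_lift V W f z"
    if gp: "\<And>v w. v \<in> elems V \<Longrightarrow> w \<in> elems W \<Longrightarrow> g (pure V W v w) = f v w"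
      and ga: "\<And>y z. y \<in> elems (tensor V W) \<Longrightarrow> z \<in> elems (tensor V W) \<Longrightarrow> g (y + z) = g y + g z"
      and z: "z \<in> elems (tensor V W)"
  proof -
    have 0: "g 0 = 0"
      using ga[of 0 0] subspace_of_vector_spaceD(1)[OF subspace_of_vector_space_tensor, of V W]
      by (metis add_cancel_left_right add_0)
    have "set ps \<subseteq> elems V \<times> elems W \<Longrightarrow>
        g (\<Sum>(v, w)\<leftarrow>ps. pure V W v w) = (\<Sum>(v, w)\<leftarrow>ps. f v w)" for ps
    proof (induction ps)
      case (Cons p ps)
      obtain v w where p: "p = (v, w)" by fastforce
      have "pure V W v w \<in> elems (tensor V W)"
        using Cons.prems by (auto simp: p tensor_def intro: tensor_vs.span_base)
      moreover have "(\<Sum>(v, w)\<leftarrow>ps. pure V W v w) \<in> elems (tensor V W)"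
        using Cons.prems tensor_elems_iff[OF V W] by auto
      ultimately show ?case
        using Cons ga gp by (auto simp: p plus_fun_def)
    qed (simp add: 0)
    with z show ?thesis
      unfolding tensor_elems_iff[OF V W] using lift by force
  qed
qed

lemma ring_free_ring: "ring (free_ring :: ('k::field, 'a, 'b) free_alg ring)"
proof (rule ringI)
  show "abelian_group (free_ring :: ('k, 'a, 'b) free_alg ring)"
  proof (rule abelian_groupI)
    fix x :: "('k, 'a, 'b) free_alg"
    show "\<exists>y\<in>carrier free_ring. y \<oplus>\<^bsub>free_ring\<^esub> x = \<zero>\<^bsub>free_ring\<^esub>"
      by (rule bexI[of _ "- x"]) (simp_all add: free_ring_def)
  qed (simp_all add: free_ring_def algebra_simps)
  show "monoid (free_ring :: ('k, 'a, 'b) free_alg ring)"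
    by (rule monoidI) (simp_all add: free_ring_def algebra_simps)
qed (simp_all add: free_ring_def algebra_simps)

lemma ideal_free_product_ideal: "ideal (free_product_ideal A B) free_ring"
  unfolding free_product_ideal_def
  by (rule ring.genideal_ideal[OF ring_free_ring]) (simp add: free_ring_def)

lemma ring_free_product: "ring (free_product A B)"
  unfolding free_product_def by (rule ideal.quotient_is_ring[OF ideal_free_product_ideal])

lemma free_product_ideal_closed:
  fixes A :: "('k::field, 'a::{ring, monoid_mult}) gspace" and B :: "('k, 'b::{ring, monoid_mult}) gspace"
  shows "0 \<in> free_product_ideal A B"
    "p \<in> free_product_ideal A B \<Longrightarrow> q \<in> free_product_ideal A B \<Longrightarrow> p + q \<in> free_product_ideal A B"
    "p \<in> free_product_ideal A B \<Longrightarrow> q * p \<in> free_product_ideal A B"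
    "p \<in> free_product_ideal A B \<Longrightarrow> p * q \<in> free_product_ideal A B"
    "free_product_relations A B \<subseteq> free_product_ideal A B"
proof -
  interpret ideal "free_product_ideal A B" free_ring
    by (rule ideal_free_product_ideal)
  show "0 \<in> free_product_ideal A B"
    using additive_subgroup.zero_closed[OF is_additive_subgroup] by (simp add: free_ring_def)
  show "p \<in> free_product_ideal A B \<Longrightarrow> q \<in> free_product_ideal A B \<Longrightarrow> p + q \<in> free_product_ideal A B"
    using additive_subgroup.a_closed[OF is_additive_subgroup, of p q] by (simp add: free_ring_def)
  show "p \<in> free_product_ideal A B \<Longrightarrow> q * p \<in> free_product_ideal A B"
    using I_l_closed[of p q] by (simp add: free_ring_def)
  show "p \<in> free_product_ideal A B \<Longrightarrow> p * q \<in> free_product_ideal A B"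
    using I_r_closed[of p q] by (simp add: free_ring_def)
  show "free_product_relations A B \<subseteq> free_product_ideal A B"
    unfolding free_product_ideal_def
    by (rule ring.genideal_self[OF ring_free_ring]) (simp add: free_ring_def)
qed

lemma free_product_class_eq_iff:
  "free_product_class A B p = free_product_class A B q \<longleftrightarrow> p - q \<in> free_product_ideal A B"
proof -
  have cls: "free_product_class A B p = {r + p | r. r \<in> free_product_ideal A B}" for p
    by (auto simp: free_product_class_def free_ring_def a_r_coset_def r_coset_def)
  have minus: "- r \<in> free_product_ideal A B" if "r \<in> free_product_ideal A B" for r
    using free_product_ideal_closed(3)[OF that, of "- 1"] by simp
  show ?thesis
  proof
    assume "free_product_class A B p = free_product_class A B q"
    moreover have "p \<in> free_product_class A B p"
      unfolding cls using free_product_ideal_closed(1) by (intro CollectI exI[of _ 0]) simp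
    ultimately show "p - q \<in> free_product_ideal A B"
      unfolding cls by auto
  next
    assume pq: "p - q \<in> free_product_ideal A B"
    have "{r + p | r. r \<in> free_product_ideal A B} \<subseteq> {r + q | r. r \<in> free_product_ideal A B}"
      if "p - q \<in> free_product_ideal A B" for p q
    proof clarify
      fix r assume "r \<in> free_product_ideal A B"
      then show "\<exists>r'. r + p = r' + q \<and> r' \<in> free_product_ideal A B"
        using free_product_ideal_closed(2)[OF _ that, of r] by (intro exI[of _ "r + (p - q)"]) simp
    qed
    from this[OF pq] this[of q p] show "free_product_class A B p = free_product_class A B q"
      unfolding cls using minus[OF pq] by auto
  qed
qed

lemma vector_space_free_scl: "vector_space free_scl"
  by unfold_locales
    (simp_all add: free_scl_def algebra_simps single_add mult_single
      flip: mult.assoc)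

lemma free_scl_mult: "free_scl c p * q = free_scl c (p * q)"
  by (simp add: free_scl_def mult.assoc)

lemma mult_free_scl: "p * free_scl c q = free_scl c (p * q)"
proof -
  have "p * Poly_Mapping.single 0 c = Poly_Mapping.single 0 c * p"
  proof (induction p rule: update_induct)
    case (update f a b)
    have "Poly_Mapping.update a b f = Poly_Mapping.single a b + f"
      using update(1)
      by (intro poly_mapping_eqI) (auto simp: lookup_update lookup_add lookup_single in_keys_iff)
    then show ?case
      using update(3) by (simp add: mult_single algebra_simps)
  qed simp
  then show ?thesis
    by (simp add: free_scl_def flip: mult.assoc)
qed

lemma tensor_to_free_product_sum_list:
  fixes A :: "('k::field, 'a::{ring, monoid_mult}) gspace" and B :: "('k, 'b::{ring, monoid_mult}) gspace"
  assumes A: "subspace_of_vector_space A" and B: "subspace_of_vector_space B"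
    and ps: "set ps \<subseteq> elems A \<times> elems B"
  shows "tensor_to_free_product A B (\<Sum>(a, b)\<leftarrow>ps. pure A B a b) =
    free_product_class A B (\<Sum>(a, b)\<leftarrow>ps. genA a * genB b)"
proof -
  let ?R = "free_product_ideal A B"
  note R = free_product_ideal_closed[where A = A and B = B]
  let ?f = "\<lambda>ps. \<Sum>(a, b)\<leftarrow>ps. genA a * genB b :: ('k, 'a, 'b) free_alg"
  interpret vector_space_pair "free_scl :: 'k \<Rightarrow> ('k, 'a, 'b) free_alg \<Rightarrow> _" "(*) :: 'k \<Rightarrow> 'k \<Rightarrow> 'k"
    using vector_space_free_scl vector_space_times by (rule vector_space_pair.intro)
  have sub: "vs1.subspace ?R"
    using R by (auto simp: vs1.subspace_def free_scl_def)
  have rel: "?f ps - ?f qs \<in> ?R"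
    if qs: "set qs \<subseteq> elems A \<times> elems B"
      and eq: "(\<Sum>(a, b)\<leftarrow>ps. pure A B a b) = (\<Sum>(a, b)\<leftarrow>qs. pure A B a b)" for qs
  proof (rule ccontr)
    let ?x = "?f ps - ?f qs"
    assume x: "?x \<notin> ?R"
    obtain C where C: "C \<subseteq> ?R" "vs1.independent C" "?R \<subseteq> vs1.span C"
      by (rule vs1.basis_exists[of ?R])
    then have span: "vs1.span C = ?R"
      using vs1.span_minimal[OF C(1) sub] by (intro subset_antisym)
    with x have "vs1.independent (insert ?x C)"
      using C(2) by (intro vs1.independent_insertI) simp_all
    from linear_independent_extend[OF this, of "\<lambda>y. if y = ?x then 1 else 0"]
    obtain \<phi> where \<phi>: "Vector_Spaces.linear free_scl (*) \<phi>"
      and \<phi>_eq: "\<And>y. y \<in> insert ?x C \<Longrightarrow> \<phi> y = (if y = ?x then 1 else 0)"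
      by blast
    have \<phi>x: "\<phi> ?x = 1"
      using \<phi>_eq[of ?x] by simp
    have \<phi>C: "\<phi> y = 0" if "y \<in> C" for y
    proof -
      have "y \<noteq> ?x"
        using that x C(1) by blast
      then show ?thesis
        using \<phi>_eq[of y] that by simp
    qed
    have \<phi>R: "\<phi> r = 0" if "r \<in> ?R" for r
      by (rule linear_eq_0_on_span[OF \<phi>, of C]) (use \<phi>C span that in simp_all)
    have eqR: "\<phi> p = \<phi> q" if "p - q \<in> ?R" for p q
      using \<phi>R[OF that] linear_diff[OF \<phi>] by simp
    have bil: "bilinear_map A B (*) (\<lambda>a b. \<phi> (genA a * genB b))"
      unfolding bilinear_map_def
    proof (intro conjI ballI allI)
      fix a a' :: 'a and b b' :: 'b and c :: 'k
      have "genA (a + a') - (genA a + genA a') \<in> ?R" "genB (b + b') - (genB b + genB b') \<in> ?R"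
        "genA (scl A c a) - free_scl c (genA a) \<in> ?R" "genB (scl B c b) - free_scl c (genB b) \<in> ?R"
        by (rule subsetD[OF R(5)]; unfold free_product_relations_def; blast)+
      then have "(genA (a + a') - (genA a + genA a')) * genB b \<in> ?R"
        "genA a * (genB (b + b') - (genB b + genB b')) \<in> ?R"
        "(genA (scl A c a) - free_scl c (genA a)) * genB b \<in> ?R"
        "genA a * (genB (scl B c b) - free_scl c (genB b)) \<in> ?R"
        using R(3,4) by blast+
      then have "\<phi> (genA (a + a') * genB b) = \<phi> (genA a * genB b + genA a' * genB b)"
        "\<phi> (genA a * genB (b + b')) = \<phi> (genA a * genB b + genA a * genB b')"
        "\<phi> (genA (scl A c a) * genB b) = \<phi> (free_scl c (genA a * genB b))"
        "\<phi> (genA a * genB (scl B c b)) = \<phi> (free_scl c (genA a * genB b))"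
        by (intro eqR; simp add: left_diff_distrib right_diff_distrib distrib_left distrib_right
            free_scl_mult mult_free_scl)+
      then show "\<phi> (genA (a + a') * genB b) = \<phi> (genA a * genB b) + \<phi> (genA a' * genB b)"
        "\<phi> (genA a * genB (b + b')) = \<phi> (genA a * genB b) + \<phi> (genA a * genB b')"
        "\<phi> (genA (scl A c a) * genB b) = c * \<phi> (genA a * genB b)"
        "\<phi> (genA a * genB (scl B c b)) = c * \<phi> (genA a * genB b)"
        using linear_add[OF \<phi>] linear_scale[OF \<phi>] by simp_all
    qed
    have sum: "\<phi> (?f rs) = (\<Sum>(a, b)\<leftarrow>rs. \<phi> (genA a * genB b))" for rs
      using \<phi> by (induction rs) (auto simp: linear_add linear_0)
    have "\<phi> (?f ps) = \<phi> (?f qs)"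
      unfolding sum by (rule tensor_relation_eq[OF A B vector_space_times bil ps qs eq])
    then show False
      using \<phi>x linear_diff[OF \<phi>] by simp
  qed
  show ?thesis
    unfolding tensor_to_free_product_def
  proof (rule the_equality)
    show "\<exists>qs. set qs \<subseteq> elems A \<times> elems B \<and>
        (\<Sum>(a, b)\<leftarrow>ps. pure A B a b) = (\<Sum>(a, b)\<leftarrow>qs. pure A B a b) \<and>
        free_product_class A B (?f ps) = free_product_class A B (?f qs)"
      using ps by blast
  next
    fix X
    assume "\<exists>qs. set qs \<subseteq> elems A \<times> elems B \<and>
        (\<Sum>(a, b)\<leftarrow>ps. pure A B a b) = (\<Sum>(a, b)\<leftarrow>qs. pure A B a b) \<and>
        X = free_product_class A B (?f qs)"
    then obtain qs where qs: "set qs \<subseteq> elems A \<times> elems B"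
      and eq: "(\<Sum>(a, b)\<leftarrow>ps. pure A B a b) = (\<Sum>(a, b)\<leftarrow>qs. pure A B a b)"
      and X: "X = free_product_class A B (?f qs)"
      by blast
    show "X = free_product_class A B (?f ps)"
      using rel[OF qs eq] unfolding X free_product_class_eq_iff[symmetric] by simp
  qed
qed

end

theory Submission
  imports Defs "HOL-Library.Product_Plus"
begin

text \<open>
  Let \<open>\<epsilon>\<close> denote the augmentations, and write \<open>\<tau>(b \<otimes> a) = \<Sum> x\<^sub>i \<otimes> y\<^sub>i\<close>. If \<open>\<tau>\<close> is changed in degree \<open>n\<close> only, by
  \<open>\<beta>(b, a) v\<close> with a bilinear form \<open>\<beta>\<close> and a fixed \<open>v\<close> of degree \<open>n\<close>, then for degree reasons the twisting
  identity up to degree \<open>n\<close> is linear in \<open>\<beta>\<close>, and the factors next to \<open>\<beta>\<close> enter through \<open>\<epsilon>\<close> only: it says that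
  \<open>\<beta>(bb', a) = \<epsilon>(b) \<beta>(b', a) + \<beta>(b, \<Sum> \<epsilon>(y'\<^sub>i) x'\<^sub>i)\<close> for \<open>\<tau>(b' \<otimes> a) = \<Sum> x'\<^sub>i \<otimes> y'\<^sub>i\<close>, and symmetrically in \<open>A\<close>.
  Thus \<open>\<tau>\<close> has the unique extension property iff no such cocycle \<open>\<beta> \<noteq> 0\<close> exists in a degree \<open>n \<ge> 3\<close>.

  A cocycle makes \<open>A \<times> K\<close> a module over \<open>A * B\<close> on which \<open>ba - \<tau>(b \<otimes> a)\<close> acts by \<open>(m, v) \<mapsto> (0, \<beta>(b, a) \<epsilon>(m))\<close>, while
  elements of degree 2 of \<open>I\<^sub>\<tau>\<close> act by zero; so \<open>\<beta> = 0\<close> if these generate \<open>I\<^sub>\<tau>\<close>. Conversely, let \<open>J\<close> be the ideal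
  generated by the relations of degree 2. If \<open>n\<close> is the least degree in which some \<open>ba - \<tau>(b \<otimes> a)\<close> is not in \<open>J\<close>,
  then a linear form that vanishes on \<open>J\<close> but not on this element takes the relations of degree \<open>n\<close> to a nonzero
  cocycle.
\<close>

section \<open>Linear maps on tensor products\<close>

text \<open>Linear forms let one notion of cocycle serve both directions. The deviation of an
  extension from \<open>\<tau>\<close> is a tensor, and failure of membership in \<open>J\<close> is
  a statement about a quotient; composed with a form that detects it, either becomes a bilinear form
  on \<open>B \<times> A\<close>. No term with two factors \<open>\<beta>\<close> arises: the first
  one leaves \<open>v\<close>, of full degree \<open>n\<close>, so the remaining arguments are
  scalars, and a cocycle vanishes when one argument is 1. The bound 3 has two sources. If one of
  \<open>b\<close>, \<open>a\<close> has degree 0, connectedness turns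
  \<open>ba - \<tau>(b \<otimes> a)\<close> into a consequence of the unit relations, so in degree
  at most 2 only pairs of degree (1, 1) matter, and their relations generate \<open>J\<close>.
  Conversely a cocycle of degree at least 3 is invisible to words of degree 2. The least-degree
  argument uses relations of lower degree inside longer products. Since
  \<open>p \<mapsto> h (u p w)\<close> vanishes on \<open>J\<close> whenever \<open>h\<close> does,
  the induction on the degree treats all such forms at once. Augmentations need
  \<open>1 \<noteq> 0\<close>; for a zero algebra both properties hold for trivial reasons.\<close>

definition linear_on ::
    "('k::field, 'v::ab_group_add) gspace \<Rightarrow> ('k \<Rightarrow> 'x \<Rightarrow> 'x::ab_group_add) \<Rightarrow> ('v \<Rightarrow> 'x) \<Rightarrow> bool" where
  "linear_on V s g \<longleftrightarrow>
     (\<forall>x\<in>elems V. \<forall>y\<in>elems V. g (x + y) = g x + g y) \<and>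
     (\<forall>c. \<forall>x\<in>elems V. g (scl V c x) = s c (g x))"

lemma linear_on_zero:
  assumes "subspace_of_vector_space V" "linear_on V s g"
  shows "g 0 = 0"
  using assms(2) subspace_of_vector_spaceD(1)[OF assms(1)]
  unfolding linear_on_def by (metis add_cancel_left_right add_0)

text \<open>Additivity is available on the carrier only, so the induction has to carry along that
  the partial sums stay in it.\<close>

lemma linear_on_sum_list:
  assumes "subspace_of_vector_space V" "linear_on V s g" "\<And>p. p \<in> set ps \<Longrightarrow> h p \<in> elems V"
  shows "(\<Sum>p\<leftarrow>ps. h p) \<in> elems V \<and> g (\<Sum>p\<leftarrow>ps. h p) = (\<Sum>p\<leftarrow>ps. g (h p))"
  using assms(3)
proof (induction ps)
  case Nil
  then show ?case
    using linear_on_zero[OF assms(1,2)] subspace_of_vector_spaceD(1)[OF assms(1)] by simp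
next
  case (Cons p ps)
  then show ?case
    using assms(2) subspace_of_vector_spaceD(2)[OF assms(1)] by (simp add: linear_on_def)
qed

lemma sum_list_in_elems:
  assumes "subspace_of_vector_space V" "\<And>p. p \<in> set ps \<Longrightarrow> h p \<in> elems V"
  shows "(\<Sum>p\<leftarrow>ps. h p) \<in> elems V"
  using assms(2)
  by (induction ps) (auto intro: subspace_of_vector_spaceD[OF assms(1)])

lemma scl_tensor: "scl (tensor V W) = tensor_scl"
  by (simp add: tensor_def)

lemma pure_in_tensor: "v \<in> elems V \<Longrightarrow> w \<in> elems W \<Longrightarrow> pure V W v w \<in> elems (tensor V W)"
  by (auto simp: tensor_def intro: tensor_vs.span_base)

lemma pure_in_homog:
  "v \<in> homog V k \<Longrightarrow> w \<in> homog W l \<Longrightarrow> k + l = m \<Longrightarrow> pure V W v w \<in> homog (tensor V W) m"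
  by (auto simp: tensor_def intro!: tensor_vs.span_base)

lemma tensor_list:
  assumes "subspace_of_vector_space V" "subspace_of_vector_space W" "z \<in> elems (tensor V W)"
  obtains ps where "set ps \<subseteq> elems V \<times> elems W" "z = (\<Sum>(v, w)\<leftarrow>ps. pure V W v w)"
  using tensor_elems_iff[OF assms(1,2)] assms(3) by blast

lemma graded_spaceD:
  assumes "graded_space V"
  shows "homog V n \<subseteq> elems V" "x \<in> homog V n \<Longrightarrow> scl V c x \<in> homog V n"
    "x \<in> homog V n \<Longrightarrow> y \<in> homog V n \<Longrightarrow> x + y \<in> homog V n" "0 \<in> homog V n"
proof -
  interpret vector_space "scl V"
    using assms by (simp add: graded_space_def)
  show "homog V n \<subseteq> elems V" "x \<in> homog V n \<Longrightarrow> scl V c x \<in> homog V n"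
    "x \<in> homog V n \<Longrightarrow> y \<in> homog V n \<Longrightarrow> x + y \<in> homog V n" "0 \<in> homog V n"
    using assms by (auto simp: graded_space_def subspace_def)
qed

text \<open>The tensor product of two graded spaces has this weaker property by its definition alone, which is
  what fourfold tensor products need.\<close>

definition homog_scalable :: "('k::field, 'v::ab_group_add) gspace \<Rightarrow> bool" where
  "homog_scalable V \<longleftrightarrow> subspace_of_vector_space V \<and>
     (\<forall>n. homog V n \<subseteq> elems V \<and> (\<forall>c. \<forall>x\<in>homog V n. scl V c x \<in> homog V n))"

lemma homog_scalableD:
  assumes "homog_scalable V"
  shows "subspace_of_vector_space V" "homog V n \<subseteq> elems V" "x \<in> homog V n \<Longrightarrow> scl V c x \<in> homog V n"
  using assms by (auto simp: homog_scalable_def)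

lemma homog_scalable_graded: "graded_space V \<Longrightarrow> homog_scalable V"
  unfolding homog_scalable_def using graded_spaceD[of V] graded_space_subspace[of V] by blast

lemma homog_tensor_subspace: "tensor_vs.subspace (homog (tensor V W) m)"
  by (simp add: tensor_def)

text \<open>Since homogeneous parts are closed under scalars, the coefficients of a linear
  combination of pure tensors can be absorbed into the left factors.\<close>

lemma homog_tensor_list:
  assumes V: "homog_scalable V" and W: "homog_scalable W" and z: "z \<in> homog (tensor V W) m"
  obtains ps where "z = (\<Sum>(v, w)\<leftarrow>ps. pure V W v w)"
    "\<And>v w. (v, w) \<in> set ps \<Longrightarrow> \<exists>k l. k + l = m \<and> v \<in> homog V k \<and> w \<in> homog W l"
proof -
  note VW = homog_scalableD(1)[OF V] homog_scalableD(1)[OF W]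
  have "\<exists>ps. z = (\<Sum>(v, w)\<leftarrow>ps. pure V W v w) \<and>
    (\<forall>(v, w) \<in> set ps. \<exists>k l. k + l = m \<and> v \<in> homog V k \<and> w \<in> homog W l)"
    using z unfolding tensor_def gspace.select_convs
  proof (induction rule: tensor_vs.span_induct_alt)
    case base
    show ?case by (rule exI[of _ "[]"]) simp
  next
    case (step c x y)
    from step(1) obtain v w k l where x: "x = pure V W v w" and kl: "k + l = m"
      and vw: "v \<in> homog V k" "w \<in> homog W l" by blast
    from step(2) obtain ps where ps: "y = (\<Sum>(v, w)\<leftarrow>ps. pure V W v w)"
      "\<forall>(v, w) \<in> set ps. \<exists>k l. k + l = m \<and> v \<in> homog V k \<and> w \<in> homog W l" by blast
    have "tensor_scl c x = pure V W (scl V c v) w"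
      using bilinear_map_pure[OF VW] vw subsetD[OF homog_scalableD(2)[OF V]] subsetD[OF homog_scalableD(2)[OF W]]
      unfolding bilinear_map_def x by metis
    moreover have "scl V c v \<in> homog V k"
      using homog_scalableD(3)[OF V] vw by blast
    ultimately show ?case
      using ps kl vw by (intro exI[of _ "(scl V c v, w) # ps"]) auto
  qed
  then show ?thesis using that by blast
qed

lemma homog_tensor_sub:
  assumes "homog_scalable V" "homog_scalable W"
  shows "homog (tensor V W) m \<subseteq> elems (tensor V W)"
proof
  fix z assume "z \<in> homog (tensor V W) m"
  then obtain ps where "z = (\<Sum>(v, w)\<leftarrow>ps. pure V W v w)"
    "\<And>v w. (v, w) \<in> set ps \<Longrightarrow> \<exists>k l. k + l = m \<and> v \<in> homog V k \<and> w \<in> homog W l"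
    by (rule homog_tensor_list[OF assms]) blast
  then show "z \<in> elems (tensor V W)"
    using subsetD[OF homog_scalableD(2)[OF assms(1)]] subsetD[OF homog_scalableD(2)[OF assms(2)]]
    by (fastforce intro!: sum_list_in_elems subspace_of_vector_space_tensor pure_in_tensor)
qed

lemma homog_scalable_tensor:
  assumes "homog_scalable V" "homog_scalable W"
  shows "homog_scalable (tensor V W)"
  unfolding homog_scalable_def
  using homog_tensor_sub[OF assms] homog_tensor_subspace[of V W]
  by (auto simp: subspace_of_vector_space_tensor scl_tensor tensor_vs.subspace_def)

lemma linear_on_tensor_lift:
  assumes "subspace_of_vector_space V" "subspace_of_vector_space W" "vector_space s" "bilinear_map V W s f"
  shows "linear_on (tensor V W) s (tensor_lift V W f)"
  using tensor_universal(2,3)[OF assms] by (simp add: linear_on_def scl_tensor)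

lemma linear_on_comp:
  assumes "linear_on V (scl W) f" "\<And>x. x \<in> elems V \<Longrightarrow> f x \<in> elems W" "linear_on W s g"
  shows "linear_on V s (\<lambda>x. g (f x))"
  using assms by (simp add: linear_on_def)

lemma linear_on_tensor_eq:
  assumes V: "subspace_of_vector_space V" and W: "subspace_of_vector_space W"
    and gh: "linear_on (tensor V W) s g" "linear_on (tensor V W) s h"
    and eq: "\<And>v w. v \<in> elems V \<Longrightarrow> w \<in> elems W \<Longrightarrow> g (pure V W v w) = h (pure V W v w)"
    and z: "z \<in> elems (tensor V W)"
  shows "g z = h z"
proof -
  obtain ps where ps: "set ps \<subseteq> elems V \<times> elems W" and z': "z = (\<Sum>p\<leftarrow>ps. pure V W (fst p) (snd p))"
    by (rule tensor_list[OF V W z]) (simp add: case_prod_unfold)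
  note l = linear_on_sum_list[OF subspace_of_vector_space_tensor _ pure_in_tensor, of V W _ _ ps fst snd, THEN conjunct2]
  have "g z = (\<Sum>p\<leftarrow>ps. g (pure V W (fst p) (snd p)))" unfolding z'
    using l[OF gh(1)] ps by fastforce
  also have "\<dots> = (\<Sum>p\<leftarrow>ps. h (pure V W (fst p) (snd p)))"
    using ps by (intro arg_cong[of _ _ sum_list] map_cong refl eq) auto
  also have "\<dots> = h z" unfolding z' using l[OF gh(2)] ps by fastforce
  finally show ?thesis .
qed

lemma linear_on_homog_tensor_eq:
  assumes V: "homog_scalable V" and W: "homog_scalable W"
    and gh: "linear_on (tensor V W) s g" "linear_on (tensor V W) s h"
    and eq: "\<And>v w k l. v \<in> homog V k \<Longrightarrow> w \<in> homog W l \<Longrightarrow> k + l = m \<Longrightarrow> g (pure V W v w) = h (pure V W v w)"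
    and z: "z \<in> homog (tensor V W) m"
  shows "g z = h z"
proof -
  obtain ps where z': "z = (\<Sum>p\<leftarrow>ps. pure V W (fst p) (snd p))"
    and ps: "\<And>p. p \<in> set ps \<Longrightarrow> \<exists>k l. k + l = m \<and> fst p \<in> homog V k \<and> snd p \<in> homog W l"
    by (rule homog_tensor_list[OF V W z]) (force simp: case_prod_unfold)
  note sub = homog_scalableD(2)[OF V] homog_scalableD(2)[OF W]
  have ps': "p \<in> set ps \<Longrightarrow> fst p \<in> elems V" "p \<in> set ps \<Longrightarrow> snd p \<in> elems W" for p
    using ps sub by blast+
  note l = linear_on_sum_list[OF subspace_of_vector_space_tensor _ pure_in_tensor, of V W _ _ ps fst snd, THEN conjunct2]
  have "g z = (\<Sum>p\<leftarrow>ps. g (pure V W (fst p) (snd p)))" unfolding z'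
    using l[OF gh(1)] ps' by fastforce
  also have "\<dots> = (\<Sum>p\<leftarrow>ps. h (pure V W (fst p) (snd p)))"
    using ps eq by (intro arg_cong[of _ _ sum_list] map_cong refl) blast
  also have "\<dots> = h z" unfolding z' using l[OF gh(2)] ps' by fastforce
  finally show ?thesis .
qed

lemma tensor_lift_in_elems:
  assumes "subspace_of_vector_space V" "subspace_of_vector_space W" "subspace_of_vector_space Y"
    "bilinear_map V W (scl Y) f" "\<And>v w. v \<in> elems V \<Longrightarrow> w \<in> elems W \<Longrightarrow> f v w \<in> elems Y"
    "z \<in> elems (tensor V W)"
  shows "tensor_lift V W f z \<in> elems Y"
proof -
  obtain ps where ps: "set ps \<subseteq> elems V \<times> elems W" "z = (\<Sum>(v, w)\<leftarrow>ps. pure V W v w)"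
    using tensor_list[OF assms(1,2,6)] .
  have "vector_space (scl Y)" using assms(3) by (simp add: subspace_of_vector_space_def)
  from tensor_lift_sum_list[OF assms(1,2) this assms(4) ps(1)] show ?thesis
    unfolding ps(2) using ps(1) assms(5) by (auto intro!: sum_list_in_elems[OF assms(3)])
qed

text \<open>Both sides are linear in \<open>z\<close> and agree on pure tensors. Nested lifts are
  evaluated below by moving outer maps inside with this rule.\<close>

lemma linear_on_tensor_lift_comm:
  assumes V: "subspace_of_vector_space V" and W: "subspace_of_vector_space W" and Y: "subspace_of_vector_space Y"
    and f: "bilinear_map V W (scl Y) f" "\<And>v w. v \<in> elems V \<Longrightarrow> w \<in> elems W \<Longrightarrow> f v w \<in> elems Y"
    and s: "vector_space s" and g: "linear_on Y s g"
    and z: "z \<in> elems (tensor V W)"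
  shows "g (tensor_lift V W f z) = tensor_lift V W (\<lambda>v w. g (f v w)) z"
proof -
  have sY: "vector_space (scl Y)" using Y by (simp add: subspace_of_vector_space_def)
  have gf: "bilinear_map V W s (\<lambda>v w. g (f v w))"
    using f g by (simp add: bilinear_map_def linear_on_def)
  show ?thesis
  proof (rule linear_on_tensor_eq[OF V W _ _ _ z])
    show "linear_on (tensor V W) s (\<lambda>z. g (tensor_lift V W f z))"
      by (rule linear_on_comp[OF linear_on_tensor_lift[OF V W sY f(1)] tensor_lift_in_elems[OF V W Y f] g])
    show "linear_on (tensor V W) s (tensor_lift V W (\<lambda>v w. g (f v w)))"
      by (rule linear_on_tensor_lift[OF V W s gf])
  qed (simp add: tensor_universal(1)[OF V W sY f(1)] tensor_universal(1)[OF V W s gf])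
qed

lemma bilinear_map_add:
  assumes "vector_space s" "bilinear_map V W s f" "bilinear_map V W s g"
  shows "bilinear_map V W s (\<lambda>v w. f v w + g v w)"
proof -
  interpret vector_space s by fact
  show ?thesis using assms(2,3) by (simp add: bilinear_map_def scale_right_distrib)
qed

lemma bilinear_map_scl:
  assumes "vector_space s" "bilinear_map V W s f"
  shows "bilinear_map V W s (\<lambda>v w. s c (f v w))"
proof -
  interpret vector_space s by fact
  show ?thesis using assms(2) by (simp add: bilinear_map_def scale_right_distrib mult.commute)
qed

lemma tensor_lift_add:
  assumes V: "subspace_of_vector_space V" and W: "subspace_of_vector_space W" and s: "vector_space s"
    and f: "bilinear_map V W s f" and g: "bilinear_map V W s g"
    and z: "z \<in> elems (tensor V W)"
  shows "tensor_lift V W (\<lambda>v w. f v w + g v w) z = tensor_lift V W f z + tensor_lift V W g z"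
proof -
  obtain ps where ps: "set ps \<subseteq> elems V \<times> elems W" "z = (\<Sum>(v, w)\<leftarrow>ps. pure V W v w)"
    using tensor_list[OF V W z] .
  show ?thesis
    unfolding ps(2) tensor_lift_sum_list[OF V W s f ps(1)] tensor_lift_sum_list[OF V W s g ps(1)]
      tensor_lift_sum_list[OF V W s bilinear_map_add[OF s f g] ps(1)]
    by (simp add: case_prod_unfold sum_list_addf)
qed

lemma tensor_lift_scl:
  assumes V: "subspace_of_vector_space V" and W: "subspace_of_vector_space W" and s: "vector_space s"
    and f: "bilinear_map V W s f"
    and z: "z \<in> elems (tensor V W)"
  shows "tensor_lift V W (\<lambda>v w. s c (f v w)) z = s c (tensor_lift V W f z)"
proof -
  interpret vector_space s by fact
  obtain ps where ps: "set ps \<subseteq> elems V \<times> elems W" "z = (\<Sum>(v, w)\<leftarrow>ps. pure V W v w)"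
    using tensor_list[OF V W z] .
  show ?thesis
    unfolding ps(2) tensor_lift_sum_list[OF V W s f ps(1)]
      tensor_lift_sum_list[OF V W s bilinear_map_scl[OF s f] ps(1)]
    by (induction ps) (auto simp: scale_right_distrib)
qed

lemma tensor_lift_cong:
  assumes "subspace_of_vector_space V" "subspace_of_vector_space W" "vector_space s"
    "bilinear_map V W s f" "bilinear_map V W s g"
    "\<And>v w. v \<in> elems V \<Longrightarrow> w \<in> elems W \<Longrightarrow> f v w = g v w"
    "z \<in> elems (tensor V W)"
  shows "tensor_lift V W f z = tensor_lift V W g z"
  by (rule linear_on_tensor_eq[OF assms(1,2) linear_on_tensor_lift[OF assms(1-4)]
    linear_on_tensor_lift[OF assms(1-3,5)] _ assms(7)])
    (simp add: tensor_universal(1)[OF assms(1-4)] tensor_universal(1)[OF assms(1-3,5)] assms(6))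

lemma tensor_lift_homog_cong:
  assumes "homog_scalable V" "homog_scalable W" "vector_space s"
    "bilinear_map V W s f" "bilinear_map V W s g"
    "\<And>v w k l. v \<in> homog V k \<Longrightarrow> w \<in> homog W l \<Longrightarrow> k + l = m \<Longrightarrow> f v w = g v w"
    "z \<in> homog (tensor V W) m"
  shows "tensor_lift V W f z = tensor_lift V W g z"
proof -
  note VW = homog_scalableD(1)[OF assms(1)] homog_scalableD(1)[OF assms(2)]
  show ?thesis
  proof (rule linear_on_homog_tensor_eq[OF assms(1,2) linear_on_tensor_lift[OF VW assms(3,4)]
    linear_on_tensor_lift[OF VW assms(3,5)] _ assms(7)])
    fix v w k l assume *: "v \<in> homog V k" "w \<in> homog W l" "k + l = m"
    then have "v \<in> elems V" "w \<in> elems W" using homog_scalableD(2) assms(1,2) by blast+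
    then show "tensor_lift V W f (pure V W v w) = tensor_lift V W g (pure V W v w)"
      using assms(6)[OF *] tensor_universal(1)[OF VW assms(3,4)] tensor_universal(1)[OF VW assms(3,5)] by simp
  qed
qed

lemma bilinear_map_sum_list:
  assumes "vector_space s" "\<And>p. p \<in> set ps \<Longrightarrow> bilinear_map V W s (h p)"
  shows "bilinear_map V W s (\<lambda>v w. \<Sum>p\<leftarrow>ps. h p v w)"
  using assms(2)
proof (induction ps)
  case Nil
  interpret vector_space s by fact
  show ?case by (simp add: bilinear_map_def)
next
  case (Cons p ps)
  then show ?case using bilinear_map_add[OF assms(1), of V W "h p"] by simp
qed

lemma bilinear_map_cong:
  assumes "subspace_of_vector_space V" "subspace_of_vector_space W" "bilinear_map V W s g"
    "\<And>v w. v \<in> elems V \<Longrightarrow> w \<in> elems W \<Longrightarrow> f v w = g v w"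
  shows "bilinear_map V W s f"
  using assms(3,4) subspace_of_vector_spaceD[OF assms(1)] subspace_of_vector_spaceD[OF assms(2)]
  by (simp add: bilinear_map_def)

text \<open>One presentation of \<open>q\<close> as a sum of pure tensors serves all
  \<open>u\<close> and \<open>v\<close> simultaneously, so the lift is a finite sum of maps that are
  bilinear in \<open>u\<close> and \<open>v\<close>.\<close>

lemma bilinear_map_tensor_lift_param:
  assumes U: "subspace_of_vector_space U" and V: "subspace_of_vector_space V"
    and W: "subspace_of_vector_space W" and X: "subspace_of_vector_space X" and s: "vector_space s"
    and h1: "\<And>u v. u \<in> elems U \<Longrightarrow> v \<in> elems V \<Longrightarrow> bilinear_map W X s (h u v)"
    and h2: "\<And>w x. w \<in> elems W \<Longrightarrow> x \<in> elems X \<Longrightarrow> bilinear_map U V s (\<lambda>u v. h u v w x)"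
    and q: "q \<in> elems (tensor W X)"
  shows "bilinear_map U V s (\<lambda>u v. tensor_lift W X (h u v) q)"
proof -
  obtain ps where ps: "set ps \<subseteq> elems W \<times> elems X" "q = (\<Sum>(v, w)\<leftarrow>ps. pure W X v w)"
    using tensor_list[OF W X q] .
  have eq: "tensor_lift W X (h u v) q = (\<Sum>p\<leftarrow>ps. h u v (fst p) (snd p))"
    if "u \<in> elems U" "v \<in> elems V" for u v
    unfolding ps(2) using tensor_lift_sum_list[OF W X s h1[OF that] ps(1)] by (simp add: case_prod_unfold)
  have "bilinear_map U V s (\<lambda>u v. \<Sum>p\<leftarrow>ps. h u v (fst p) (snd p))"
    using ps(1) by (intro bilinear_map_sum_list[OF s] h2) auto
  then show ?thesis
    by (rule bilinear_map_cong[OF U V]) (rule eq)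
qed

text \<open>Multilinearity in four arguments, grouped as the bracketing
  \<open>(U \<otimes> V) \<otimes> (W \<otimes> X)\<close> requires: one lift per bracket.\<close>

definition quadrilinear ::
    "('k::field, 'u::ab_group_add) gspace \<Rightarrow> ('k, 'v::ab_group_add) gspace \<Rightarrow>
     ('k, 'w::ab_group_add) gspace \<Rightarrow> ('k, 'x::ab_group_add) gspace \<Rightarrow> ('k \<Rightarrow> 'y \<Rightarrow> 'y) \<Rightarrow>
     ('u \<Rightarrow> 'v \<Rightarrow> 'w \<Rightarrow> 'x \<Rightarrow> 'y::ab_group_add) \<Rightarrow> bool" where
  "quadrilinear U V W X s h \<longleftrightarrow>
     (\<forall>u\<in>elems U. \<forall>v\<in>elems V. bilinear_map W X s (h u v)) \<and>
     (\<forall>w\<in>elems W. \<forall>x\<in>elems X. bilinear_map U V s (\<lambda>u v. h u v w x))"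

lemma quadrilinear_lift:
  assumes U: "subspace_of_vector_space U" and V: "subspace_of_vector_space V"
    and W: "subspace_of_vector_space W" and X: "subspace_of_vector_space X" and s: "vector_space s"
    and h: "quadrilinear U V W X s h"
  shows "bilinear_map (tensor U V) (tensor W X) s (\<lambda>p q. tensor_lift U V (\<lambda>u v. tensor_lift W X (h u v) q) p)"
    and "u \<in> elems U \<Longrightarrow> v \<in> elems V \<Longrightarrow> w \<in> elems W \<Longrightarrow> x \<in> elems X \<Longrightarrow>
      tensor_lift U V (\<lambda>u v. tensor_lift W X (h u v) (pure W X w x)) (pure U V u v) = h u v w x"
proof -
  have h1: "bilinear_map W X s (h u v)" if "u \<in> elems U" "v \<in> elems V" for u v
    using h that by (simp add: quadrilinear_def)
  have h2: "bilinear_map U V s (\<lambda>u v. h u v w x)" if "w \<in> elems W" "x \<in> elems X" for w x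
    using h that by (simp add: quadrilinear_def)
  interpret vector_space s by fact
  have lin: "linear_on (tensor W X) s (tensor_lift W X (h u v))" if "u \<in> elems U" "v \<in> elems V" for u v
    by (rule linear_on_tensor_lift[OF W X s h1[OF that]])
  have bil: "bilinear_map U V s (\<lambda>u v. tensor_lift W X (h u v) q)" if "q \<in> elems (tensor W X)" for q
    by (rule bilinear_map_tensor_lift_param[OF U V W X s h1 h2 that])
  show "bilinear_map (tensor U V) (tensor W X) s (\<lambda>p q. tensor_lift U V (\<lambda>u v. tensor_lift W X (h u v) q) p)"
    unfolding bilinear_map_def
  proof (intro conjI ballI allI)
    fix p p' q q' and c :: 'a
    assume p: "p \<in> elems (tensor U V)" and q: "q \<in> elems (tensor W X)"
    show "tensor_lift U V (\<lambda>u v. tensor_lift W X (h u v) q) (scl (tensor U V) c p) =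
      s c (tensor_lift U V (\<lambda>u v. tensor_lift W X (h u v) q) p)"
      using linear_on_tensor_lift[OF U V s bil[OF q]] p by (simp add: linear_on_def)
    have "tensor_lift U V (\<lambda>u v. tensor_lift W X (h u v) (scl (tensor W X) c q)) p =
      tensor_lift U V (\<lambda>u v. s c (tensor_lift W X (h u v) q)) p"
      using lin q subspace_of_vector_spaceD[OF subspace_of_vector_space_tensor[of W X]]
      by (intro tensor_lift_cong[OF U V s bil bilinear_map_scl[OF s bil] _ p])
         (auto simp: linear_on_def)
    also have "\<dots> = s c (tensor_lift U V (\<lambda>u v. tensor_lift W X (h u v) q) p)"
      by (rule tensor_lift_scl[OF U V s bil[OF q] p])
    finally show "tensor_lift U V (\<lambda>u v. tensor_lift W X (h u v) (scl (tensor W X) c q)) p =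
       s c (tensor_lift U V (\<lambda>u v. tensor_lift W X (h u v) q) p)" .
    {
      assume p': "p' \<in> elems (tensor U V)"
      show "tensor_lift U V (\<lambda>u v. tensor_lift W X (h u v) q) (p + p') =
        tensor_lift U V (\<lambda>u v. tensor_lift W X (h u v) q) p + tensor_lift U V (\<lambda>u v. tensor_lift W X (h u v) q) p'"
      using linear_on_tensor_lift[OF U V s bil[OF q]] p p' by (simp add: linear_on_def)
    }
    {
      assume q': "q' \<in> elems (tensor W X)"
      have "tensor_lift U V (\<lambda>u v. tensor_lift W X (h u v) (q + q')) p =
        tensor_lift U V (\<lambda>u v. tensor_lift W X (h u v) q + tensor_lift W X (h u v) q') p"
        using lin q q' subspace_of_vector_spaceD[OF subspace_of_vector_space_tensor[of W X]]
        by (intro tensor_lift_cong[OF U V s bil bilinear_map_add[OF s bil bil] _ p])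
          (auto simp: linear_on_def)
      also have "\<dots> = tensor_lift U V (\<lambda>u v. tensor_lift W X (h u v) q) p + tensor_lift U V (\<lambda>u v. tensor_lift W X (h u v) q') p"
        by (rule tensor_lift_add[OF U V s bil[OF q] bil[OF q'] p])
      finally show "tensor_lift U V (\<lambda>u v. tensor_lift W X (h u v) (q + q')) p =
        tensor_lift U V (\<lambda>u v. tensor_lift W X (h u v) q) p + tensor_lift U V (\<lambda>u v. tensor_lift W X (h u v) q') p" .
    }
  qed
  assume *: "u \<in> elems U" "v \<in> elems V" "w \<in> elems W" "x \<in> elems X"
  show "tensor_lift U V (\<lambda>u v. tensor_lift W X (h u v) (pure W X w x)) (pure U V u v) = h u v w x"
    using tensor_universal(1)[OF U V s bil[OF pure_in_tensor]] tensor_universal(1)[OF W X s h1] * by simp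
qed

lemma bilinear_map_of_linear:
  assumes "subspace_of_vector_space V" "subspace_of_vector_space W" "linear_on (tensor V W) s g"
  shows "bilinear_map V W s (\<lambda>v w. g (pure V W v w))"
  using assms(3) bilinear_map_pure[OF assms(1,2)] pure_in_tensor[of _ V _ W]
  by (simp add: bilinear_map_def linear_on_def scl_tensor plus_fun_def)

lemma linear_on_eq_tensor_lift:
  assumes "subspace_of_vector_space V" "subspace_of_vector_space W" "vector_space s"
    "linear_on (tensor V W) s g" "z \<in> elems (tensor V W)"
  shows "g z = tensor_lift V W (\<lambda>v w. g (pure V W v w)) z"
  using tensor_universal(4)[OF assms(1-3) bilinear_map_of_linear[OF assms(1,2,4)], where g = g and z = z] assms(4,5)
  by (simp add: linear_on_def)

lemma bilinear_pure_linear: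
  assumes "subspace_of_vector_space V'" "subspace_of_vector_space W'"
    "linear_on V (scl V') f" "\<And>v. v \<in> elems V \<Longrightarrow> f v \<in> elems V'"
    "linear_on W (scl W') g" "\<And>w. w \<in> elems W \<Longrightarrow> g w \<in> elems W'"
  shows "bilinear_map V W tensor_scl (\<lambda>v w. pure V' W' (f v) (g w))"
  using bilinear_map_pure[OF assms(1,2)] assms(3-6)
  by (simp add: bilinear_map_def linear_on_def)

lemma tensor_map_linear:
  assumes "subspace_of_vector_space V" "subspace_of_vector_space W"
    "subspace_of_vector_space V'" "subspace_of_vector_space W'"
    "linear_on V (scl V') f" "\<And>v. v \<in> elems V \<Longrightarrow> f v \<in> elems V'"
    "linear_on W (scl W') g" "\<And>w. w \<in> elems W \<Longrightarrow> g w \<in> elems W'"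
  shows "linear_on (tensor V W) tensor_scl (tensor_map V W V' W' f g)"
    "z \<in> elems (tensor V W) \<Longrightarrow> tensor_map V W V' W' f g z \<in> elems (tensor V' W')"
    "v \<in> elems V \<Longrightarrow> w \<in> elems W \<Longrightarrow> tensor_map V W V' W' f g (pure V W v w) = pure V' W' (f v) (g w)"
proof -
  note b = bilinear_pure_linear[OF assms(3-8)]
  show "linear_on (tensor V W) tensor_scl (tensor_map V W V' W' f g)"
    unfolding tensor_map_def by (rule linear_on_tensor_lift[OF assms(1,2) vector_space_tensor_scl b])
  show "tensor_map V W V' W' f g z \<in> elems (tensor V' W')" if "z \<in> elems (tensor V W)"
    unfolding tensor_map_def
    by (rule tensor_lift_in_elems[OF assms(1,2) subspace_of_vector_space_tensor _ _ that])
      (simp_all add: scl_tensor b pure_in_tensor assms(6,8))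
  show "tensor_map V W V' W' f g (pure V W v w) = pure V' W' (f v) (g w)" if "v \<in> elems V" "w \<in> elems W"
    unfolding tensor_map_def by (rule tensor_universal(1)[OF assms(1,2) vector_space_tensor_scl b that])
qed

lemma tensor_mid_linear:
  assumes U: "subspace_of_vector_space U" and V: "subspace_of_vector_space V"
    and W: "subspace_of_vector_space W" and X: "subspace_of_vector_space X"
    and V': "subspace_of_vector_space V'" and W': "subspace_of_vector_space W'"
    and f: "linear_on (tensor V W) tensor_scl f" "\<And>z. z \<in> elems (tensor V W) \<Longrightarrow> f z \<in> elems (tensor V' W')"
  shows "linear_on (tensor (tensor U V) (tensor W X)) tensor_scl (tensor_mid U V W X V' W' f)"
    "z \<in> elems (tensor (tensor U V) (tensor W X)) \<Longrightarrow>
      tensor_mid U V W X V' W' f z \<in> elems (tensor (tensor U V') (tensor W' X))"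
    "u \<in> elems U \<Longrightarrow> v \<in> elems V \<Longrightarrow> w \<in> elems W \<Longrightarrow> x \<in> elems X \<Longrightarrow>
      tensor_mid U V W X V' W' f (pure (tensor U V) (tensor W X) (pure U V u v) (pure W X w x)) =
      tensor_lift V' W' (\<lambda>v' w'.
             pure (tensor U V') (tensor W' X) (pure U V' u v') (pure W' X w' x))
           (f (pure V W v w))"
proof -
  note T = subspace_of_vector_space_tensor
  note vs = vector_space_tensor_scl
  define k where "k u x v' w' = pure (tensor U V') (tensor W' X) (pure U V' u v') (pure W' X w' x)" for u x v' w'
  define h where "h u v w x = tensor_lift V' W' (k u x) (f (pure V W v w))" for u v w x
  note pp = bilinear_map_pure[OF T T, of U V' W' X] bilinear_map_pure[OF U V'] bilinear_map_pure[OF W' X]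
  have k1: "bilinear_map V' W' tensor_scl (k u x)" if "u \<in> elems U" "x \<in> elems X" for u x
    using that pp unfolding bilinear_map_def k_def by (simp add: scl_tensor pure_in_tensor)
  have k2: "bilinear_map U X tensor_scl (\<lambda>u x. k u x v' w')" if "v' \<in> elems V'" "w' \<in> elems W'" for v' w'
    using that pp unfolding bilinear_map_def k_def by (simp add: scl_tensor pure_in_tensor)
  have k3: "k u x v' w' \<in> elems (tensor (tensor U V') (tensor W' X))"
    if "u \<in> elems U" "x \<in> elems X" "v' \<in> elems V'" "w' \<in> elems W'" for u x v' w'
    using that by (simp add: k_def pure_in_tensor)
  have hin: "h u v w x \<in> elems (tensor (tensor U V') (tensor W' X))"
    if "u \<in> elems U" "v \<in> elems V" "w \<in> elems W" "x \<in> elems X" for u v w x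
    unfolding h_def using that
    by (intro tensor_lift_in_elems[OF V' W' T]) (auto simp: scl_tensor k1 k3 f(2) pure_in_tensor)
  have hvw: "bilinear_map V W tensor_scl (\<lambda>v w. h u v w x)" if "u \<in> elems U" "x \<in> elems X" for u x
    unfolding h_def
    by (rule bilinear_map_of_linear[OF V W linear_on_comp[where f = f and W = "tensor V' W'"]])
      (simp_all add: scl_tensor f linear_on_tensor_lift[OF V' W' vs k1] that)
  have hux: "bilinear_map U X tensor_scl (\<lambda>u x. h u v w x)" if "v \<in> elems V" "w \<in> elems W" for v w
    unfolding h_def
    by (rule bilinear_map_tensor_lift_param[OF U X V' W' vs k1 k2 f(2)[OF pure_in_tensor[OF that]]])
  \<comment> \<open>\<open>h\<close> is known to be bilinear in the inner pair \<open>v\<close>,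
    \<open>w\<close> and in the outer pair \<open>u\<close>, \<open>x\<close>. These are the same
    four linearity conditions as for the pairs \<open>u\<close>, \<open>v\<close> and
    \<open>w\<close>, \<open>x\<close>.\<close>
  have quad: "quadrilinear U V W X tensor_scl h"
    using hvw hux unfolding quadrilinear_def bilinear_map_def by simp
  have mid: "tensor_mid U V W X V' W' f = tensor_lift (tensor U V) (tensor W X)
    (\<lambda>p q. tensor_lift U V (\<lambda>u v. tensor_lift W X (h u v) q) p)"
    by (simp add: tensor_mid_def h_def[abs_def] k_def[abs_def])
  note ql = quadrilinear_lift[OF U V W X vs quad]
  show "linear_on (tensor (tensor U V) (tensor W X)) tensor_scl (tensor_mid U V W X V' W' f)"
    unfolding mid by (rule linear_on_tensor_lift[OF T T vs ql(1)])
  show "tensor_mid U V W X V' W' f (pure (tensor U V) (tensor W X) (pure U V u v) (pure W X w x)) =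
      tensor_lift V' W' (\<lambda>v' w'.
             pure (tensor U V') (tensor W' X) (pure U V' u v') (pure W' X w' x))
           (f (pure V W v w))" if "u \<in> elems U" "v \<in> elems V" "w \<in> elems W" "x \<in> elems X"
    unfolding mid using that
    by (subst tensor_universal(1)[OF T T vs ql(1)])
      (simp_all add: pure_in_tensor ql(2) flip: k_def h_def)
  have lin: "bilinear_map W X tensor_scl (h u v)" if "u \<in> elems U" "v \<in> elems V" for u v
    using quad that by (simp add: quadrilinear_def)
  have bil: "bilinear_map U V tensor_scl (\<lambda>u v. tensor_lift W X (h u v) q)" if "q \<in> elems (tensor W X)" for q
    using quad by (intro bilinear_map_tensor_lift_param[OF U V W X vs _ _ that]) (simp_all add: quadrilinear_def)
  show "tensor_mid U V W X V' W' f z \<in> elems (tensor (tensor U V') (tensor W' X))"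
    if "z \<in> elems (tensor (tensor U V) (tensor W X))"
    unfolding mid
    by (rule tensor_lift_in_elems[OF T T T _ _ that])
     (auto simp: scl_tensor ql(1) bil lin hin intro!: tensor_lift_in_elems[OF U V T] tensor_lift_in_elems[OF W X T])
qed

lemma linear_pure_right:
  assumes "linear_on (tensor V W) s g" "w \<in> elems W" "subspace_of_vector_space V" "subspace_of_vector_space W"
  shows "linear_on V s (\<lambda>v. g (pure V W v w))"
  using bilinear_map_of_linear[OF assms(3,4,1)] assms(2) by (simp add: bilinear_map_def linear_on_def)

lemma linear_pure_left:
  assumes "linear_on (tensor V W) s g" "v \<in> elems V" "subspace_of_vector_space V" "subspace_of_vector_space W"
  shows "linear_on W s (\<lambda>w. g (pure V W v w))"
  using bilinear_map_of_linear[OF assms(3,4,1)] assms(2) by (simp add: bilinear_map_def linear_on_def)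

lemma sum_list_in_homog:
  assumes "graded_space V" "\<And>p. p \<in> set ps \<Longrightarrow> h p \<in> homog V m"
  shows "(\<Sum>p\<leftarrow>ps. h p) \<in> homog V m"
  using assms(2) by (induction ps) (auto intro: graded_spaceD[OF assms(1)])

lemma bilinear_map_diff:
  fixes V :: "('k::field, 'v::ab_group_add) gspace"
  assumes "bilinear_map V W (*) f" "bilinear_map V W (*) g"
  shows "bilinear_map V W (*) (\<lambda>v w. f v w - g v w)"
  using assms by (simp add: bilinear_map_def algebra_simps)

lemma (in graded_algebra) is_subspace: "subspace_of_vector_space A"
  by (rule graded_space_subspace[OF graded])

lemma (in graded_algebra) is_vector_space: "vector_space (scl A)"
  using graded by (simp add: graded_space_def)

lemma (in graded_algebra) elems [simp]: "x \<in> elems A"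
  by (simp add: elems_UNIV)

lemma (in graded_algebra) bilinear_mult: "bilinear_map A A (scl A) (*)"
  by (simp add: bilinear_map_def algebra_simps flip: scl_mult_left scl_mult_right)

lemma (in graded_algebra) mult_map_linear:
  "linear_on (tensor A A) (scl A) (mult_map A)" "mult_map A (pure A A x y) = x * y"
  unfolding mult_map_def
  using linear_on_tensor_lift[OF is_subspace is_subspace is_vector_space bilinear_mult]
    tensor_universal(1)[OF is_subspace is_subspace is_vector_space bilinear_mult]
  by auto

section \<open>Actions on \<open>A \<otimes> B\<close> and the twisting identity on pure
  tensors\<close>

locale algebra_pair = A: graded_algebra A + B: graded_algebra B
  for A :: "('k::field, 'a::{ring, monoid_mult}) gspace"
    and B :: "('k, 'b::{ring, monoid_mult}) gspace"
begin

abbreviation L :: "('a \<Rightarrow> 'b \<Rightarrow> 'x::ab_group_add) \<Rightarrow> ('k, 'a, 'b) tensor \<Rightarrow> 'x" where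
  "L \<equiv> tensor_lift A B"

text \<open>For a twisting map \<open>\<tau>\<close>, this is left multiplication by
  \<open>a \<otimes> 1\<close> in \<open>A \<otimes>\<^sub>\<tau> B\<close>, and \<open>ract\<close>
  is right multiplication by \<open>1 \<otimes> b\<close>. By the unit laws neither depends on
  \<open>\<tau>\<close>.\<close>

definition lact :: "'a \<Rightarrow> ('k, 'a, 'b) tensor \<Rightarrow> ('k, 'a, 'b) tensor" where
  "lact a = L (\<lambda>p q. pure A B (a * p) q)"

definition ract :: "('k, 'a, 'b) tensor \<Rightarrow> 'b \<Rightarrow> ('k, 'a, 'b) tensor" where
  "ract z b = L (\<lambda>p q. pure A B p (q * b)) z"

lemmas T = subspace_of_vector_space_tensor
lemmas pureAB = bilinear_map_pure[OF A.is_subspace B.is_subspace]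
lemmas pureBA = bilinear_map_pure[OF B.is_subspace A.is_subspace]

lemma pure_simps:
  "pure A B (a + a') b = pure A B a b + pure A B a' b"
  "pure A B a (b + b') = pure A B a b + pure A B a b'"
  "pure A B (scl A c a) b = tensor_scl c (pure A B a b)"
  "pure A B a (scl B c b) = tensor_scl c (pure A B a b)"
  "pure B A (b + b') a = pure B A b a + pure B A b' a"
  "pure B A b (a + a') = pure B A b a + pure B A b a'"
  "pure B A (scl B c b) a = tensor_scl c (pure B A b a)"
  "pure B A b (scl A c a) = tensor_scl c (pure B A b a)"
  using pureAB pureBA by (simp_all add: bilinear_map_def)

lemma bilinear_lact_pure: "bilinear_map A B tensor_scl (\<lambda>p q. pure A B (a * p) q)"
  by (simp add: bilinear_map_def distrib_left pure_simps flip: A.scl_mult_right)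

lemma bilinear_ract_pure: "bilinear_map A B tensor_scl (\<lambda>p q. pure A B p (q * b))"
  by (simp add: bilinear_map_def distrib_right pure_simps flip: B.scl_mult_left)

lemma pure_mem [simp]: "pure A B a b \<in> elems (tensor A B)" "pure B A b a \<in> elems (tensor B A)"
  by (simp_all add: pure_in_tensor)

lemmas L_linear = linear_on_tensor_lift[OF A.is_subspace B.is_subspace]
lemmas L_pure = tensor_universal(1)[OF A.is_subspace B.is_subspace _ _ A.elems B.elems]

lemma lact_linear: "linear_on (tensor A B) tensor_scl (lact a)"
  unfolding lact_def by (rule L_linear[OF vector_space_tensor_scl bilinear_lact_pure])

lemma ract_linear: "linear_on (tensor A B) tensor_scl (\<lambda>z. ract z b)"
  unfolding ract_def by (rule L_linear[OF vector_space_tensor_scl bilinear_ract_pure])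

lemma lact_mem [simp]: "z \<in> elems (tensor A B) \<Longrightarrow> lact a z \<in> elems (tensor A B)"
  unfolding lact_def by (rule tensor_lift_in_elems[OF A.is_subspace B.is_subspace T]) (simp_all add: scl_tensor bilinear_lact_pure)

lemma ract_mem [simp]: "z \<in> elems (tensor A B) \<Longrightarrow> ract z b \<in> elems (tensor A B)"
  unfolding ract_def by (rule tensor_lift_in_elems[OF A.is_subspace B.is_subspace T]) (simp_all add: scl_tensor bilinear_ract_pure)

lemma lact_pure [simp]: "lact a (pure A B p q) = pure A B (a * p) q"
  unfolding lact_def by (rule L_pure[OF vector_space_tensor_scl bilinear_lact_pure])

lemma ract_pure [simp]: "ract (pure A B p q) b = pure A B p (q * b)"
  unfolding ract_def by (rule L_pure[OF vector_space_tensor_scl bilinear_ract_pure])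

lemma L_comm:
  assumes "bilinear_map A B (scl Y) f" "\<And>a b. f a b \<in> elems Y" "subspace_of_vector_space Y" "vector_space s" "linear_on Y s g"
    "z \<in> elems (tensor A B)"
  shows "g (L f z) = L (\<lambda>a b. g (f a b)) z"
  by (rule linear_on_tensor_lift_comm[OF A.is_subspace B.is_subspace assms(3,1,2,4-6)])

text \<open>The value of the right-hand side of the twisting identity at \<open>(b \<otimes> b') \<otimes> (a \<otimes> a')\<close>.\<close>

definition twisting_rhs ::
    "(('k, 'b, 'a) tensor \<Rightarrow> ('k, 'a, 'b) tensor) \<Rightarrow> 'b \<Rightarrow> 'b \<Rightarrow> 'a \<Rightarrow> 'a \<Rightarrow> ('k, 'a, 'b) tensor" where
  "twisting_rhs t b b' a a' =
     L (\<lambda>x y. L (\<lambda>u v. L (\<lambda>w z. lact u (ract (t (pure B A v w)) z))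
       (t (pure B A y a'))) (t (pure B A b x))) (t (pure B A b' a))"

context
  fixes t :: "('k, 'b, 'a) tensor \<Rightarrow> ('k, 'a, 'b) tensor"
  assumes t_lin: "linear_on (tensor B A) tensor_scl t"
    and t_mem: "\<And>z. z \<in> elems (tensor B A) \<Longrightarrow> t z \<in> elems (tensor A B)"
begin

abbreviation (input) "M1 \<equiv> tensor_mid B B A A A B t"
abbreviation (input) "M2 \<equiv> tensor_map (tensor B A) (tensor B A) (tensor A B) (tensor A B) t t"
abbreviation (input) "M3 \<equiv> tensor_mid A B A B A B t"
abbreviation (input) "M4 \<equiv> tensor_map (tensor A A) (tensor B B) A B (mult_map A) (mult_map B)"
abbreviation (input) "M0 \<equiv> tensor_map (tensor B B) (tensor A A) B A (mult_map B) (mult_map A)"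

lemmas M1 = tensor_mid_linear[OF B.is_subspace B.is_subspace A.is_subspace A.is_subspace A.is_subspace B.is_subspace t_lin t_mem]
lemmas M2 = tensor_map_linear[OF T[of B A] T[of B A] T[of A B] T[of A B], unfolded scl_tensor, OF t_lin t_mem t_lin t_mem]
lemmas M3 = tensor_mid_linear[OF A.is_subspace B.is_subspace A.is_subspace B.is_subspace A.is_subspace B.is_subspace t_lin t_mem]
lemmas M4 = tensor_map_linear[OF T T A.is_subspace B.is_subspace A.mult_map_linear(1) A.elems B.mult_map_linear(1) B.elems]
lemmas M0 = tensor_map_linear[OF T T B.is_subspace A.is_subspace B.mult_map_linear(1) B.elems A.mult_map_linear(1) A.elems]

lemma M43_linear: "linear_on (tensor (tensor A B) (tensor A B)) tensor_scl (\<lambda>z. M4 (M3 z))"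
  by (rule linear_on_comp[OF _ M3(2) M4(1)]) (simp_all add: scl_tensor M3(1))

lemma M432_linear: "linear_on (tensor (tensor B A) (tensor B A)) tensor_scl (\<lambda>z. M4 (M3 (M2 z)))"
  by (rule linear_on_comp[OF _ M2(2) M43_linear]) (simp_all add: scl_tensor M2(1))

lemma M4321_linear: "linear_on (tensor (tensor B B) (tensor A A)) tensor_scl (\<lambda>z. M4 (M3 (M2 (M1 z))))"
  by (rule linear_on_comp[OF _ M1(2) M432_linear]) (simp_all add: scl_tensor M1(1))

lemma tM0_linear: "linear_on (tensor (tensor B B) (tensor A A)) tensor_scl (\<lambda>z. t (M0 z))"
  by (rule linear_on_comp[OF _ M0(2) t_lin]) (simp_all add: scl_tensor M0(1))

text \<open>Each factor is moved inside the lift that the preceding one produces, until it only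
  meets pure tensors. In \<open>e3\<close> the two multiplications turn the outer legs
  \<open>u\<close> and \<open>z\<close> into actions on the twisted inner legs.\<close>

lemma M4321_pure:
  "M4 (M3 (M2 (M1 (pure (tensor B B) (tensor A A) (pure B B b b') (pure A A a a'))))) =
    twisting_rhs t b b' a a'"
proof -
  note vs = vector_space_tensor_scl
  have bil1: "bilinear_map A B tensor_scl (\<lambda>x y. pure (tensor B A) (tensor B A) (pure B A b x) (pure B A y a'))"
    for b a'
    by (rule bilinear_pure_linear[OF T T])
      (simp_all add: linear_on_def scl_tensor pure_simps)
  have bil2: "bilinear_map A B tensor_scl (\<lambda>p q. pure (tensor A A) (tensor B B) (pure A A u p) (pure B B q z))"
    for u z
    using bilinear_map_pure[OF A.is_subspace A.is_subspace] bilinear_map_pure[OF B.is_subspace B.is_subspace]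
    by (intro bilinear_pure_linear[OF T T])
      (simp_all add: linear_on_def scl_tensor bilinear_map_def pure_in_tensor)
  have e1: "M4 (M3 (pure (tensor A B) (tensor A B) P Q)) =
      L (\<lambda>u v. M4 (M3 (pure (tensor A B) (tensor A B) (pure A B u v) Q))) P"
    if "P \<in> elems (tensor A B)" "Q \<in> elems (tensor A B)" for P Q
    by (rule linear_on_eq_tensor_lift[OF A.is_subspace B.is_subspace vs linear_pure_right[OF M43_linear that(2) T T] that(1)])
  have e2: "M4 (M3 (pure (tensor A B) (tensor A B) (pure A B u v) Q)) =
      L (\<lambda>w z. M4 (M3 (pure (tensor A B) (tensor A B) (pure A B u v) (pure A B w z)))) Q"
    if "Q \<in> elems (tensor A B)" for u v Q
    by (rule linear_on_eq_tensor_lift[OF A.is_subspace B.is_subspace vs linear_pure_left[OF M43_linear pure_mem(1) T T] that])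
  have e3: "M4 (M3 (pure (tensor A B) (tensor A B) (pure A B u v) (pure A B w z))) =
    lact u (ract (t (pure B A v w)) z)" for u v w z
  proof -
    have "M4 (M3 (pure (tensor A B) (tensor A B) (pure A B u v) (pure A B w z))) =
      M4 (L (\<lambda>p q. pure (tensor A A) (tensor B B) (pure A A u p) (pure B B q z)) (t (pure B A v w)))"
      by (simp add: M3(3))
    also have "\<dots> = L (\<lambda>p q. M4 (pure (tensor A A) (tensor B B) (pure A A u p) (pure B B q z))) (t (pure B A v w))"
      by (rule L_comm[OF _ _ T vs M4(1)]) (simp_all add: scl_tensor bil2 pure_in_tensor t_mem)
    also have "\<dots> = L (\<lambda>p q. lact u (pure A B p (q * z))) (t (pure B A v w))"
      by (simp add: M4(3) pure_in_tensor A.mult_map_linear(2) B.mult_map_linear(2))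
    also have "\<dots> = lact u (ract (t (pure B A v w)) z)"
      unfolding ract_def
      by (rule L_comm[OF _ _ T vs lact_linear, symmetric]) (simp_all add: scl_tensor bilinear_ract_pure t_mem)
    finally show ?thesis .
  qed
  have "M4 (M3 (M2 (M1 (pure (tensor B B) (tensor A A) (pure B B b b') (pure A A a a'))))) =
    M4 (M3 (M2 (L (\<lambda>x y. pure (tensor B A) (tensor B A) (pure B A b x) (pure B A y a')) (t (pure B A b' a)))))"
    by (simp add: M1(3))
  also have "\<dots> = L (\<lambda>x y. M4 (M3 (M2 (pure (tensor B A) (tensor B A) (pure B A b x) (pure B A y a'))))) (t (pure B A b' a))"
    by (rule L_comm[OF _ _ T vs M432_linear]) (simp_all add: scl_tensor bil1 pure_in_tensor t_mem)
  also have "\<dots> = L (\<lambda>x y. M4 (M3 (pure (tensor A B) (tensor A B) (t (pure B A b x)) (t (pure B A y a'))))) (t (pure B A b' a))"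
    by (simp add: M2(3))
  also have "\<dots> = twisting_rhs t b b' a a'"
    by (simp add: e1[of "t (pure B A b _)" "t (pure B A _ a')"] e2[of "t (pure B A _ a')"] e3 t_mem twisting_rhs_def)
  finally show ?thesis .
qed

lemma twisting_identity_pure:
  "twisting_identity A B t (pure (tensor B B) (tensor A A) (pure B B b b') (pure A A a a')) \<longleftrightarrow>
    t (pure B A (b * b') (a * a')) = twisting_rhs t b b' a a'"
  unfolding twisting_identity_def M4321_pure
  by (simp add: M0(3) pure_in_tensor A.mult_map_linear(2) B.mult_map_linear(2))

text \<open>Both sides are linear. The homogeneous part of the fourfold product is spanned by pure
  tensors of homogeneous elements of \<open>B \<otimes> B\<close> and \<open>A \<otimes> A\<close>,
  which are themselves sums of pure tensors; hence three nested applications of the same extension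
  principle.\<close>

lemma twisting_identity_homog:
  assumes "\<And>b b' a a' k k' l l'. b \<in> homog B k \<Longrightarrow> b' \<in> homog B k' \<Longrightarrow> a \<in> homog A l \<Longrightarrow> a' \<in> homog A l' \<Longrightarrow>
      k + k' + (l + l') = i \<Longrightarrow> t (pure B A (b * b') (a * a')) = twisting_rhs t b b' a a'"
    and z: "z \<in> homog (tensor (tensor B B) (tensor A A)) i"
  shows "twisting_identity A B t z"
proof -
  note hs = homog_scalable_graded[OF B.graded] homog_scalable_graded[OF A.graded]
  note hs = hs homog_scalable_tensor[OF hs(1,1)] homog_scalable_tensor[OF hs(2,2)]
  note gB = homog_tensor_sub[OF hs(1,1)]
  note gA = homog_tensor_sub[OF hs(2,2)]
  let ?g = "\<lambda>z. t (M0 z)" and ?h = "\<lambda>z. M4 (M3 (M2 (M1 z)))"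
  note ghT = tM0_linear M4321_linear
  have pp: "?g (pure (tensor B B) (tensor A A) p q) = ?h (pure (tensor B B) (tensor A A) p q)"
    if p: "p \<in> homog (tensor B B) m" and q: "q \<in> homog (tensor A A) l" and ml: "m + l = i" for p q m l
  proof (rule linear_on_homog_tensor_eq[OF hs(1,1),
    where z = p and g = "\<lambda>p. ?g (pure (tensor B B) (tensor A A) p q)"
    and h = "\<lambda>p. ?h (pure (tensor B B) (tensor A A) p q)", OF _ _ _ p])
    have q': "q \<in> elems (tensor A A)" using q gA by blast
    show "linear_on (tensor B B) tensor_scl (\<lambda>p. ?g (pure (tensor B B) (tensor A A) p q))"
      "linear_on (tensor B B) tensor_scl (\<lambda>p. ?h (pure (tensor B B) (tensor A A) p q))"
      by (rule linear_pure_right[OF ghT(1) q' T T], rule linear_pure_right[OF ghT(2) q' T T])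
    fix b b' k k' assume b: "b \<in> homog B k" "b' \<in> homog B k'" "k + k' = m"
    have b': "pure B B b b' \<in> elems (tensor B B)" by (simp add: pure_in_tensor)
    show "?g (pure (tensor B B) (tensor A A) (pure B B b b') q) = ?h (pure (tensor B B) (tensor A A) (pure B B b b') q)"
    proof (rule linear_on_homog_tensor_eq[OF hs(2,2),
    where z = q and g = "\<lambda>q. ?g (pure (tensor B B) (tensor A A) (pure B B b b') q)"
    and h = "\<lambda>q. ?h (pure (tensor B B) (tensor A A) (pure B B b b') q)", OF _ _ _ q])
      show "linear_on (tensor A A) tensor_scl (\<lambda>q. ?g (pure (tensor B B) (tensor A A) (pure B B b b') q))"
        "linear_on (tensor A A) tensor_scl (\<lambda>q. ?h (pure (tensor B B) (tensor A A) (pure B B b b') q))"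
        by (rule linear_pure_left[OF ghT(1) b' T T], rule linear_pure_left[OF ghT(2) b' T T])
      fix a a' k1 k1' assume a: "a \<in> homog A k1" "a' \<in> homog A k1'" "k1 + k1' = l"
      show "?g (pure (tensor B B) (tensor A A) (pure B B b b') (pure A A a a')) = ?h (pure (tensor B B) (tensor A A) (pure B B b b') (pure A A a a'))"
        using assms(1)[OF b(1,2) a(1,2)] b(3) a(3) ml
        unfolding twisting_identity_pure[symmetric] twisting_identity_def by simp
    qed
  qed
  show ?thesis
    unfolding twisting_identity_def
    by (rule linear_on_homog_tensor_eq[OF hs(3,4) ghT _ z]) (rule pp)
qed

end
end

section \<open>Homogeneous components and augmentations\<close>

context graded_algebra
begin

lemmas homog_closed = graded_spaceD[OF graded]

definition hcomp :: "'a \<Rightarrow> nat \<Rightarrow> 'a" where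
  "hcomp x = (THE f. (\<forall>n. f n \<in> homog A n) \<and> finite {n. f n \<noteq> 0} \<and> x = (\<Sum>n | f n \<noteq> 0. f n))"

lemma hcomp_ex1: "\<exists>!f. (\<forall>n. f n \<in> homog A n) \<and> finite {n. f n \<noteq> 0} \<and> x = (\<Sum>n | f n \<noteq> 0. f n)"
  using graded elems[of x] unfolding graded_space_def by blast

lemma hcomp_props:
  "hcomp x n \<in> homog A n" "finite {n. hcomp x n \<noteq> 0}" "x = (\<Sum>n | hcomp x n \<noteq> 0. hcomp x n)"
  using theI'[OF hcomp_ex1[of x]] unfolding hcomp_def[symmetric] by blast+

text \<open>Allowing any finite set \<open>S\<close> that contains the support lets components of a
  sum be compared over the union of the supports.\<close>

lemma hcomp_eqI:
  assumes "\<And>n. f n \<in> homog A n" "finite S" "\<And>n. n \<notin> S \<Longrightarrow> f n = 0" "x = (\<Sum>n\<in>S. f n)"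
  shows "hcomp x = f"
  unfolding hcomp_def
proof (rule the1_equality[OF hcomp_ex1], intro conjI allI assms(1))
  have sub: "{n. f n \<noteq> 0} \<subseteq> S" using assms(3) by blast
  show "finite {n. f n \<noteq> 0}" using sub assms(2) by (rule finite_subset)
  show "x = (\<Sum>n | f n \<noteq> 0. f n)"
    unfolding assms(4) by (rule sum.mono_neutral_right[OF assms(2) sub]) simp
qed

lemma hcomp_sum: "finite S \<Longrightarrow> {n. hcomp x n \<noteq> 0} \<subseteq> S \<Longrightarrow> (\<Sum>n\<in>S. hcomp x n) = x"
  using sum.mono_neutral_right[of S "{n. hcomp x n \<noteq> 0}" "hcomp x"] hcomp_props(3)[of x] by fastforce

lemma hcomp_add: "hcomp (x + y) n = hcomp x n + hcomp y n"
proof -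
  let ?S = "{n. hcomp x n \<noteq> 0} \<union> {n. hcomp y n \<noteq> 0}"
  have fin: "finite ?S" by (simp add: hcomp_props)
  have "hcomp (x + y) = (\<lambda>n. hcomp x n + hcomp y n)"
    by (rule hcomp_eqI[OF _ fin])
      (auto simp: homog_closed hcomp_props(1) sum.distrib hcomp_sum[OF fin])
  then show ?thesis by simp
qed

lemma hcomp_scl: "hcomp (scl A c x) n = scl A c (hcomp x n)"
proof -
  interpret vector_space "scl A" by (rule is_vector_space)
  have "hcomp (scl A c x) = (\<lambda>n. scl A c (hcomp x n))"
    by (rule hcomp_eqI[OF _ hcomp_props(2)[of x]])
      (auto simp: homog_closed hcomp_props(1) hcomp_sum[OF hcomp_props(2)] simp flip: scale_sum_right)
  then show ?thesis by simp
qed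

lemma hcomp_homog: "x \<in> homog A m \<Longrightarrow> hcomp x n = (if n = m then x else 0)"
  using hcomp_eqI[of "\<lambda>n. if n = m then x else 0" "{m}" x] by (auto simp: homog_closed)

text \<open>Every element is a finite sum of its components. Zero is homogeneous, so the empty sum
  falls under the first case.\<close>

lemma homog_induct [case_names homog add]:
  assumes "\<And>n x. x \<in> homog A n \<Longrightarrow> P x" "\<And>x y. P x \<Longrightarrow> P y \<Longrightarrow> P (x + y)"
  shows "P x"
proof -
  have "P (\<Sum>n\<in>S. hcomp x n)" if "finite S" for S
    using that
    by (induction S) (auto intro: assms hcomp_props assms(1)[OF homog_closed(4)])
  from this[OF hcomp_props(2)[of x]] show ?thesis by (simp flip: hcomp_props(3))
qed

end

text \<open>If \<open>1 = 0\<close>, the coefficient of \<open>1\<close> is not determined by the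
  element and there is no augmentation.\<close>

locale augmented_algebra = connected_graded_algebra +
  assumes one_neq_zero: "(1 :: 'b) \<noteq> 0"
begin

lemma scl_one_inj: "scl A c 1 = scl A d 1 \<Longrightarrow> c = d"
proof -
  interpret vector_space "scl A" by (rule is_vector_space)
  show "scl A c 1 = scl A d 1 \<Longrightarrow> c = d" using one_neq_zero scale_right_imp_eq by blast
qed

definition eps :: "'b \<Rightarrow> 'a" where
  "eps x = (THE c. hcomp x 0 = scl A c 1)"

lemma eps_eqI: "hcomp x 0 = scl A c 1 \<Longrightarrow> eps x = c"
  unfolding eps_def using scl_one_inj by (intro the_equality) auto

lemma hcomp_zero_eq: "hcomp x 0 = scl A (eps x) 1"
proof -
  obtain c where "hcomp x 0 = scl A c 1" using hcomp_props(1)[of x 0] connected by auto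
  with eps_eqI show ?thesis by metis
qed

lemma eps_add [simp]: "eps (x + y) = eps x + eps y"
proof -
  interpret vector_space "scl A" by (rule is_vector_space)
  show ?thesis by (rule eps_eqI) (simp only: hcomp_add hcomp_zero_eq[of x] hcomp_zero_eq[of y] scale_left_distrib)
qed

lemma eps_scl [simp]: "eps (scl A c x) = c * eps x"
proof -
  interpret vector_space "scl A" by (rule is_vector_space)
  show ?thesis by (rule eps_eqI) (simp only: hcomp_scl hcomp_zero_eq[of x] scale_scale)
qed

lemma eps_pos: "x \<in> homog A n \<Longrightarrow> n > 0 \<Longrightarrow> eps x = 0"
proof -
  interpret vector_space "scl A" by (rule is_vector_space)
  show "x \<in> homog A n \<Longrightarrow> n > 0 \<Longrightarrow> eps x = 0" by (rule eps_eqI) (simp add: hcomp_homog)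
qed

lemma homog_zero_eq: "x \<in> homog A 0 \<Longrightarrow> x = scl A (eps x) 1"
  using hcomp_zero_eq[of x] hcomp_homog[of x 0 0] by simp

lemma eps_one [simp]: "eps 1 = 1"
proof -
  interpret vector_space "scl A" by (rule is_vector_space)
  show ?thesis by (rule eps_eqI) (simp add: hcomp_homog[OF homog_one])
qed

lemma eps_mult [simp]: "eps (x * y) = eps x * eps y"
proof (induction x rule: homog_induct)
  case (homog m x)
  show ?case
  proof (induction y rule: homog_induct)
    case (homog n y)
    show ?case
    proof (cases "m = 0 \<and> n = 0")
      case True
      then have x: "x = scl A (eps x) 1" and y: "y = scl A (eps y) 1"
        using \<open>x \<in> homog A m\<close> homog homog_zero_eq by auto
      have "eps (x * y) = eps (scl A (eps x) (scl A (eps y) 1))"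
        by (subst x, subst y) (simp flip: scl_mult_left scl_mult_right)
      then show ?thesis by simp
    next
      case False
      then have "eps x = 0 \<or> eps y = 0" using eps_pos \<open>x \<in> homog A m\<close> homog by blast
      moreover have "eps (x * y) = 0"
        using eps_pos[OF homog_mult[OF \<open>x \<in> homog A m\<close> homog]] False by simp
      ultimately show ?thesis by auto
    qed
  qed (simp add: algebra_simps)
qed (simp add: algebra_simps)

end

context algebra_pair
begin

lemma bilinear_lact: "bilinear_map A (tensor A B) tensor_scl lact"
  unfolding bilinear_map_def
proof (intro conjI ballI allI)
  note vs = vector_space_tensor_scl
  fix a a' z z' and c :: 'k
  assume z: "z \<in> elems (tensor A B)"
  show "lact a (scl (tensor A B) c z) = tensor_scl c (lact a z)"
    using lact_linear[of a] z by (simp add: linear_on_def)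
  show "lact (a + a') z = lact a z + lact a' z"
  proof -
    have "(\<lambda>p. pure A B ((a + a') * p)) = (\<lambda>p q. pure A B (a * p) q + pure A B (a' * p) q)"
      by (rule ext, rule ext) (simp only: distrib_right pure_simps)
    then show ?thesis
      unfolding lact_def using tensor_lift_add[OF A.is_subspace B.is_subspace vs bilinear_lact_pure[of a] bilinear_lact_pure[of a'] z] by simp
  qed
  show "lact (scl A c a) z = tensor_scl c (lact a z)"
  proof -
    have "(\<lambda>p. pure A B (scl A c a * p)) = (\<lambda>p q. tensor_scl c (pure A B (a * p) q))"
      by (rule ext, rule ext) (simp only: pure_simps A.scl_mult_left[symmetric])
    then show ?thesis
      unfolding lact_def using tensor_lift_scl[OF A.is_subspace B.is_subspace vs bilinear_lact_pure[of a] z] by simp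
  qed
  show "lact a (z + z') = lact a z + lact a z'" if "z' \<in> elems (tensor A B)"
    using lact_linear[of a] z that by (simp add: linear_on_def)
qed

lemma bilinear_ract: "bilinear_map (tensor A B) B tensor_scl ract"
  unfolding bilinear_map_def
proof (intro conjI ballI allI)
  note vs = vector_space_tensor_scl
  fix b b' z z' and c :: 'k
  assume z: "z \<in> elems (tensor A B)"
  show "ract (scl (tensor A B) c z) b = tensor_scl c (ract z b)"
    using ract_linear[of b] z by (simp add: linear_on_def)
  show "ract z (b + b') = ract z b + ract z b'"
    unfolding ract_def using tensor_lift_add[OF A.is_subspace B.is_subspace vs bilinear_ract_pure[of b] bilinear_ract_pure[of b'] z]
    by (simp only: distrib_left pure_simps)
  show "ract z (scl B c b) = tensor_scl c (ract z b)"
    unfolding ract_def using tensor_lift_scl[OF A.is_subspace B.is_subspace vs bilinear_ract_pure[of b] z]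
    by (simp add: pure_simps flip: B.scl_mult_right)
  show "ract (z + z') b = ract z b + ract z' b" if "z' \<in> elems (tensor A B)"
    using ract_linear[of b] z that by (simp add: linear_on_def)
qed

lemmas lact_simps =
  bilinear_lact[unfolded bilinear_map_def scl_tensor, THEN conjunct1, rule_format]
  bilinear_lact[unfolded bilinear_map_def scl_tensor, THEN conjunct2, THEN conjunct1, rule_format]
  bilinear_lact[unfolded bilinear_map_def scl_tensor, THEN conjunct2, THEN conjunct2, THEN conjunct1, rule_format]
  bilinear_lact[unfolded bilinear_map_def scl_tensor, THEN conjunct2, THEN conjunct2, THEN conjunct2, rule_format]

lemmas ract_simps =
  bilinear_ract[unfolded bilinear_map_def scl_tensor, THEN conjunct1, rule_format]
  bilinear_ract[unfolded bilinear_map_def scl_tensor, THEN conjunct2, THEN conjunct1, rule_format]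
  bilinear_ract[unfolded bilinear_map_def scl_tensor, THEN conjunct2, THEN conjunct2, THEN conjunct1, rule_format]
  bilinear_ract[unfolded bilinear_map_def scl_tensor, THEN conjunct2, THEN conjunct2, THEN conjunct2, rule_format]

lemma homog_scalable_A: "homog_scalable A" and homog_scalable_B: "homog_scalable B"
  by (simp_all add: homog_scalable_graded A.graded B.graded)

text \<open>Makes degree arguments possible under a lift: the two integrands have to agree only on
  homogeneous legs of the correct total degree.\<close>

lemma L_homog_cong:
  assumes "bilinear_map A B s f" "bilinear_map A B s g" "vector_space s"
    "\<And>x y k l. x \<in> homog A k \<Longrightarrow> y \<in> homog B l \<Longrightarrow> k + l = m \<Longrightarrow> f x y = g x y"
    "z \<in> homog (tensor A B) m"
  shows "L f z = L g z"
  by (rule tensor_lift_homog_cong[OF homog_scalable_A homog_scalable_B assms(3,1,2,4,5)])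

section \<open>One-sided forms of the twisting identity\<close>

context
  fixes t :: "('k, 'b, 'a) tensor \<Rightarrow> ('k, 'a, 'b) tensor"
  assumes t: "graded_linear (tensor B A) (tensor A B) t"
begin

lemma graded_linear_linear_on: "linear_on (tensor B A) tensor_scl t"
  using t by (simp add: graded_linear_def linear_on_def scl_tensor)

lemma graded_linear_mem: "z \<in> elems (tensor B A) \<Longrightarrow> t z \<in> elems (tensor A B)"
  using t by (auto simp: graded_linear_def)

lemma graded_linear_homog: "b \<in> homog B k \<Longrightarrow> a \<in> homog A l \<Longrightarrow> k + l = m \<Longrightarrow> t (pure B A b a) \<in> homog (tensor A B) m"
  using t pure_in_homog[of b B k a A l m] unfolding graded_linear_def by blast

lemma graded_linear_simps:
  "z \<in> elems (tensor B A) \<Longrightarrow> z' \<in> elems (tensor B A) \<Longrightarrow> t (z + z') = t z + t z'"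
  "z \<in> elems (tensor B A) \<Longrightarrow> t (tensor_scl c z) = tensor_scl c (t z)"
  using graded_linear_linear_on by (simp_all add: linear_on_def scl_tensor)

lemma quadrilinear_twisting: "quadrilinear A B A B tensor_scl (\<lambda>u v w z. lact u (ract (t (pure B A v w)) z))"
  unfolding quadrilinear_def bilinear_map_def
  by (simp add: pure_simps graded_linear_simps ract_simps lact_simps graded_linear_mem)

lemma bilinear_twisting_rhs: "bilinear_map A B tensor_scl (\<lambda>x y. L (\<lambda>u v. L (\<lambda>w z. lact u (ract (t (pure B A v w)) z))
       (t (pure B A y a'))) (t (pure B A b x)))"
  using quadrilinear_lift(1)[OF A.is_subspace B.is_subspace A.is_subspace B.is_subspace vector_space_tensor_scl quadrilinear_twisting]
  unfolding bilinear_map_def by (simp add: pure_simps graded_linear_simps graded_linear_mem scl_tensor)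

lemma bilinear_ract_twist: "bilinear_map A B tensor_scl (\<lambda>x y. ract (t (pure B A b x)) y)"
  unfolding bilinear_map_def by (simp add: pure_simps graded_linear_simps ract_simps graded_linear_mem)

lemma bilinear_lact_twist: "bilinear_map A B tensor_scl (\<lambda>x y. lact x (t (pure B A y a)))"
  unfolding bilinear_map_def by (simp add: pure_simps graded_linear_simps lact_simps graded_linear_mem)

lemma twisting_to_degreeD:
  assumes "twisting_to_degree A B n t" "i \<le> n" "z \<in> homog (tensor (tensor B B) (tensor A A)) i"
  shows "twisting_identity A B t z"
  using assms unfolding twisting_to_degree_def by blast

text \<open>The twisting identity with \<open>1\<close> as second factor from \<open>A\<close>. The
  unit laws are known only up to degree \<open>n\<close>, so all legs are kept homogeneous to bound
  their degrees.\<close>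

lemma twisting_mult_left:
  assumes tw: "twisting_to_degree A B n t"
    and b: "b \<in> homog B k" "b' \<in> homog B l" and a: "a \<in> homog A m" and n: "k + l + m \<le> n"
  shows "t (pure B A (b * b') a) = L (\<lambda>x y. ract (t (pure B A b x)) y) (t (pure B A b' a))"
proof -
  note vs = vector_space_tensor_scl
  let ?h = "\<lambda>u v w z. lact u (ract (t (pure B A v w)) z)"
  note q = quadrilinear_twisting[unfolded quadrilinear_def]
  have unit: "t (pure B A y 1) = pure A B 1 y" if "y \<in> homog B i" "i \<le> n" for y i
    using tw that by (auto simp: twisting_to_degree_def)
  have "pure (tensor B B) (tensor A A) (pure B B b b') (pure A A a 1) \<in> homog (tensor (tensor B B) (tensor A A)) (k + l + m)"
    using pure_in_homog[OF pure_in_homog[OF b refl] pure_in_homog[OF a A.homog_one refl] refl] by simp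
  then have "t (pure B A (b * b') (a * 1)) = twisting_rhs t b b' a 1"
    by (intro iffD1[OF twisting_identity_pure[OF graded_linear_linear_on graded_linear_mem]] twisting_to_degreeD[OF tw n])
  also have "\<dots> = L (\<lambda>x y. ract (t (pure B A b x)) y) (t (pure B A b' a))"
    unfolding twisting_rhs_def
  proof (rule L_homog_cong[OF bilinear_twisting_rhs bilinear_ract_twist vs _ graded_linear_homog[OF b(2) a refl]])
    fix x y i j assume xy: "x \<in> homog A i" "y \<in> homog B j" "i + j = l + m"
    \<comment> \<open>The inner lift runs over \<open>t (y \<otimes> 1) = 1 \<otimes> y\<close>, a
      single pure tensor, which fixes \<open>w = 1\<close> and \<open>z = y\<close>.\<close>
    have "L (\<lambda>u v. L (?h u v) (t (pure B A y 1))) (t (pure B A b x)) =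
      L (\<lambda>u v. ?h u v 1 y) (t (pure B A b x))"
      using q unit[OF xy(2)] xy n by (simp add: L_pure[OF vs])
    also have "\<dots> = L (\<lambda>u v. pure A B u (v * y)) (t (pure B A b x))"
    proof (rule L_homog_cong[OF _ bilinear_ract_pure vs _ graded_linear_homog[OF b(1) xy(1) refl]])
      show "bilinear_map A B tensor_scl (\<lambda>u v. ?h u v 1 y)" using q by simp
      fix u v i' j' assume "u \<in> homog A i'" "v \<in> homog B j'" "i' + j' = k + i"
      then show "lact u (ract (t (pure B A v 1)) y) = pure A B u (v * y)"
        using unit[of v j'] xy n by simp
    qed
    finally show "L (\<lambda>u v. L (?h u v) (t (pure B A y 1))) (t (pure B A b x)) = ract (t (pure B A b x)) y"
      unfolding ract_def .
  qed
  finally show ?thesis by simp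
qed

lemma twisting_mult_right:
  assumes tw: "twisting_to_degree A B n t"
    and b: "b \<in> homog B k" and a: "a \<in> homog A l" "a' \<in> homog A m" and n: "k + l + m \<le> n"
  shows "t (pure B A b (a * a')) = L (\<lambda>x y. lact x (t (pure B A y a'))) (t (pure B A b a))"
proof -
  note vs = vector_space_tensor_scl
  let ?h = "\<lambda>u v w z. lact u (ract (t (pure B A v w)) z)"
  note q = quadrilinear_twisting[unfolded quadrilinear_def]
  have unit: "t (pure B A 1 y) = pure A B y 1" if "y \<in> homog A i" "i \<le> n" for y i
    using tw that by (auto simp: twisting_to_degree_def)
  have "pure (tensor B B) (tensor A A) (pure B B 1 b) (pure A A a a') \<in> homog (tensor (tensor B B) (tensor A A)) (k + l + m)"
    using pure_in_homog[OF pure_in_homog[OF B.homog_one b refl] pure_in_homog[OF a refl] refl] by (simp add: add.assoc)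
  then have "t (pure B A (1 * b) (a * a')) = twisting_rhs t 1 b a a'"
    by (intro iffD1[OF twisting_identity_pure[OF graded_linear_linear_on graded_linear_mem]] twisting_to_degreeD[OF tw n])
  also have "\<dots> = L (\<lambda>x y. lact x (t (pure B A y a'))) (t (pure B A b a))"
    unfolding twisting_rhs_def
  proof (rule L_homog_cong[OF bilinear_twisting_rhs bilinear_lact_twist vs _ graded_linear_homog[OF b a(1) refl]])
    fix x y i j assume xy: "x \<in> homog A i" "y \<in> homog B j" "i + j = k + l"
    have "L (\<lambda>u v. L (?h u v) (t (pure B A y a'))) (t (pure B A 1 x)) =
      L (?h x 1) (t (pure B A y a'))"
      using quadrilinear_lift(1)[OF A.is_subspace B.is_subspace A.is_subspace B.is_subspace vs quadrilinear_twisting] unit[OF xy(1)] xy n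
        bilinear_map_tensor_lift_param[OF A.is_subspace B.is_subspace A.is_subspace B.is_subspace vs, of ?h "t (pure B A y a')"] q
      by (simp add: L_pure[OF vs] graded_linear_mem)
    also have "\<dots> = L (\<lambda>u v. lact x (pure A B u v)) (t (pure B A y a'))"
    proof (rule L_homog_cong[OF _ _ vs _ graded_linear_homog[OF xy(2) a(2) refl]])
      show "bilinear_map A B tensor_scl (?h x 1)" using q by simp
      show "bilinear_map A B tensor_scl (\<lambda>u v. lact x (pure A B u v))" using bilinear_lact_pure by simp
      fix u v i' j' assume "u \<in> homog A i'" "v \<in> homog B j'" "i' + j' = j + m"
      then show "lact x (ract (t (pure B A 1 u)) v) = lact x (pure A B u v)"
        using unit[of u i'] xy n by simp
    qed
    also have "\<dots> = lact x (t (pure B A y a'))"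
      by (rule linear_on_eq_tensor_lift[OF A.is_subspace B.is_subspace vs lact_linear, symmetric]) (simp add: graded_linear_mem)
    finally show "L (\<lambda>u v. L (?h u v) (t (pure B A y a'))) (t (pure B A 1 x)) = lact x (t (pure B A y a'))" .
  qed
  finally show ?thesis by simp
qed

text \<open>The two one-sided identities compose to the twisting identity on fourfold tensor products.\<close>

lemma twisting_to_degreeI:
  assumes u1: "\<And>a i. a \<in> homog A i \<Longrightarrow> i \<le> n \<Longrightarrow> t (pure B A 1 a) = pure A B a 1"
    and u2: "\<And>b i. b \<in> homog B i \<Longrightarrow> i \<le> n \<Longrightarrow> t (pure B A b 1) = pure A B 1 b"
    and m1: "\<And>b b' a k l m. b \<in> homog B k \<Longrightarrow> b' \<in> homog B l \<Longrightarrow> a \<in> homog A m \<Longrightarrow> k + l + m \<le> n \<Longrightarrow>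
      t (pure B A (b * b') a) = L (\<lambda>x y. ract (t (pure B A b x)) y) (t (pure B A b' a))"
    and m2: "\<And>b a a' k l m. b \<in> homog B k \<Longrightarrow> a \<in> homog A l \<Longrightarrow> a' \<in> homog A m \<Longrightarrow> k + l + m \<le> n \<Longrightarrow>
      t (pure B A b (a * a')) = L (\<lambda>x y. lact x (t (pure B A y a'))) (t (pure B A b a))"
  shows "twisting_to_degree A B n t"
proof -
  note vs = vector_space_tensor_scl
  let ?h = "\<lambda>u v w z. lact u (ract (t (pure B A v w)) z)"
  have main: "t (pure B A (b * b') (a * a')) = twisting_rhs t b b' a a'"
    if b: "b \<in> homog B k" "b' \<in> homog B k'" and a: "a \<in> homog A l" "a' \<in> homog A l'"
      and n: "k + k' + (l + l') \<le> n" for b b' a a' k k' l l'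
  proof -
    \<comment> \<open>Right multiplication by \<open>a' \<otimes> 1\<close> for the product that
      \<open>t\<close> defines on \<open>A \<otimes> B\<close>.\<close>
    let ?H = "L (\<lambda>x y. lact x (t (pure B A y a')))"
    have H: "linear_on (tensor A B) tensor_scl ?H" by (rule L_linear[OF vs bilinear_lact_twist])
    have Hp: "?H (pure A B u v) = lact u (t (pure B A v a'))" for u v
      by (rule L_pure[OF vs bilinear_lact_twist])
    have "t (pure B A (b * b') (a * a')) = ?H (t (pure B A (b * b') a))"
      using m2[OF B.homog_mult[OF b] a] n by simp
    also have "\<dots> = ?H (L (\<lambda>x y. ract (t (pure B A b x)) y) (t (pure B A b' a)))"
      using m1[OF b a(1)] n by simp
    also have "\<dots> = L (\<lambda>x y. ?H (ract (t (pure B A b x)) y)) (t (pure B A b' a))"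
      by (rule L_comm[OF _ _ T vs H]) (simp_all add: scl_tensor bilinear_ract_twist graded_linear_mem)
    also have "\<dots> = twisting_rhs t b b' a a'"
      unfolding twisting_rhs_def
    proof (rule L_homog_cong[OF _ bilinear_twisting_rhs vs _ graded_linear_homog[OF b(2) a(1) refl]])
      show "bilinear_map A B tensor_scl (\<lambda>x y. ?H (ract (t (pure B A b x)) y))"
        using bilinear_ract_twist H unfolding bilinear_map_def linear_on_def by (simp add: scl_tensor graded_linear_mem)
      fix x y i j assume xy: "x \<in> homog A i" "y \<in> homog B j" "i + j = k' + l"
      have "?H (ract (t (pure B A b x)) y) = L (\<lambda>u v. ?H (pure A B u (v * y))) (t (pure B A b x))"
        unfolding ract_def by (rule L_comm[OF _ _ T vs H]) (simp_all add: scl_tensor bilinear_ract_pure graded_linear_mem)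
      also have "\<dots> = L (\<lambda>u v. lact u (t (pure B A (v * y) a'))) (t (pure B A b x))"
        by (simp add: Hp)
      also have "\<dots> = L (\<lambda>u v. L (?h u v) (t (pure B A y a'))) (t (pure B A b x))"
      proof (rule L_homog_cong[OF _ _ vs _ graded_linear_homog[OF b(1) xy(1) refl]])
        show "bilinear_map A B tensor_scl (\<lambda>u v. lact u (t (pure B A (v * y) a')))"
          unfolding bilinear_map_def
          by (simp add: distrib_right pure_simps graded_linear_simps lact_simps graded_linear_mem flip: B.scl_mult_left)
        show "bilinear_map A B tensor_scl (\<lambda>u v. L (?h u v) (t (pure B A y a')))"
          using quadrilinear_twisting by (intro bilinear_map_tensor_lift_param[OF A.is_subspace B.is_subspace A.is_subspace B.is_subspace vs])
            (simp_all add: graded_linear_mem quadrilinear_def)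
        fix u v i' j' assume uv: "u \<in> homog A i'" "v \<in> homog B j'" "i' + j' = k + i"
        have "lact u (t (pure B A (v * y) a')) = lact u (L (\<lambda>w z. ract (t (pure B A v w)) z) (t (pure B A y a')))"
          using m1[OF uv(2) xy(2) a(2)] uv xy n by simp
        also have "\<dots> = L (?h u v) (t (pure B A y a'))"
          by (rule L_comm[OF _ _ T vs lact_linear]) (simp_all add: scl_tensor bilinear_ract_twist graded_linear_mem)
        finally show "lact u (t (pure B A (v * y) a')) = L (?h u v) (t (pure B A y a'))" .
      qed
      finally show "?H (ract (t (pure B A b x)) y) = L (\<lambda>u v. L (?h u v) (t (pure B A y a'))) (t (pure B A b x))" .
    qed
    finally show ?thesis .
  qed
  show ?thesis
    unfolding twisting_to_degree_def
  proof (intro allI impI conjI ballI)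
    fix i z assume i: "i \<le> n" and z: "z \<in> homog (tensor (tensor B B) (tensor A A)) i"
    show "twisting_identity A B t z"
      by (rule twisting_identity_homog[OF graded_linear_linear_on graded_linear_mem _ z]) (use i in \<open>auto intro!: main\<close>)
  qed (use u1 u2 in auto)
qed

end
end

lemma bilinear_map_comp_linear:
  assumes "bilinear_map V W (scl Y) f" "\<And>v w. v \<in> elems V \<Longrightarrow> w \<in> elems W \<Longrightarrow> f v w \<in> elems Y" "linear_on Y s g"
  shows "bilinear_map V W s (\<lambda>v w. g (f v w))"
  using assms by (simp add: bilinear_map_def linear_on_def)

section \<open>Cocycles\<close>

context algebra_pair
begin

text \<open>The part of \<open>f\<close> of total degree \<open>n\<close>. The forms obtained from
  extensions and from ideals satisfy the cocycle identities in degree \<open>n\<close> only, whereas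
  a cocycle has to satisfy them on all elements.\<close>

definition bitrunc :: "nat \<Rightarrow> ('b \<Rightarrow> 'a \<Rightarrow> 'k) \<Rightarrow> 'b \<Rightarrow> 'a \<Rightarrow> 'k" where
  "bitrunc n f b a = (\<Sum>k\<le>n. f (B.hcomp b (n - k)) (A.hcomp a k))"

lemma bitrunc_bilinear:
  assumes "bilinear_map B A (*) f"
  shows "bilinear_map B A (*) (bitrunc n f)"
  using assms unfolding bilinear_map_def bitrunc_def
  by (simp add: A.hcomp_add A.hcomp_scl B.hcomp_add B.hcomp_scl sum.distrib sum_distrib_left)

lemma bitrunc_homog:
  assumes f: "bilinear_map B A (*) f" and b: "b \<in> homog B l" and a: "a \<in> homog A k"
  shows "bitrunc n f b a = (if l + k = n then f b a else 0)"
proof -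
  have z: "f 0 x = 0" "f y 0 = 0" for x y
    using f unfolding bilinear_map_def
    by (metis A.elems B.elems add_cancel_right_right add_0)+
  have "bitrunc n f b a = (\<Sum>i\<le>n. if i = k then (if l + k = n then f b a else 0) else 0)"
    unfolding bitrunc_def A.hcomp_homog[OF a] B.hcomp_homog[OF b] by (rule sum.cong) (auto simp: z)
  then show ?thesis by simp
qed

end

locale augmented_pair = A: augmented_algebra A + B: augmented_algebra B
  for A :: "('k::field, 'a::{ring, monoid_mult}) gspace"
    and B :: "('k, 'b::{ring, monoid_mult}) gspace"

sublocale augmented_pair \<subseteq> algebra_pair ..

context augmented_pair
begin

sublocale Avs: vector_space "scl A" by (rule A.is_vector_space)
sublocale Bvs: vector_space "scl B" by (rule B.is_vector_space)

text \<open>The maps \<open>1 \<otimes> \<epsilon>\<close> and \<open>\<epsilon> \<otimes> 1\<close>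
  from \<open>A \<otimes> B\<close> to \<open>A\<close> and to \<open>B\<close>.\<close>

definition projA :: "('k, 'a, 'b) tensor \<Rightarrow> 'a" where
  "projA = L (\<lambda>x y. scl A (B.eps y) x)"

definition projB :: "('k, 'a, 'b) tensor \<Rightarrow> 'b" where
  "projB = L (\<lambda>x y. scl B (A.eps x) y)"

lemma bilinear_projA: "bilinear_map A B (scl A) (\<lambda>x y. scl A (B.eps y) x)"
  by (simp add: bilinear_map_def Avs.scale_right_distrib Avs.scale_left_distrib mult.commute)

lemma bilinear_projB: "bilinear_map A B (scl B) (\<lambda>x y. scl B (A.eps x) y)"
  by (simp add: bilinear_map_def Bvs.scale_right_distrib Bvs.scale_left_distrib mult.commute)

lemma projA_linear: "linear_on (tensor A B) (scl A) projA"
  unfolding projA_def by (rule L_linear[OF A.is_vector_space bilinear_projA])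

lemma projB_linear: "linear_on (tensor A B) (scl B) projB"
  unfolding projB_def by (rule L_linear[OF B.is_vector_space bilinear_projB])

lemma proj_pure [simp]: "projA (pure A B x y) = scl A (B.eps y) x" "projB (pure A B x y) = scl B (A.eps x) y"
  unfolding projA_def projB_def by (rule L_pure[OF A.is_vector_space bilinear_projA], rule L_pure[OF B.is_vector_space bilinear_projB])

lemma proj_simps:
  "z \<in> elems (tensor A B) \<Longrightarrow> z' \<in> elems (tensor A B) \<Longrightarrow> projA (z + z') = projA z + projA z'"
  "z \<in> elems (tensor A B) \<Longrightarrow> projA (tensor_scl c z) = scl A c (projA z)"
  "z \<in> elems (tensor A B) \<Longrightarrow> z' \<in> elems (tensor A B) \<Longrightarrow> projB (z + z') = projB z + projB z'"
  "z \<in> elems (tensor A B) \<Longrightarrow> projB (tensor_scl c z) = scl B c (projB z)"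
  using projA_linear projB_linear by (simp_all add: linear_on_def scl_tensor)

lemma ract_degree_zero:
  assumes "y \<in> homog B 0" and z: "z \<in> elems (tensor A B)"
  shows "ract z y = tensor_scl (B.eps y) z"
proof -
  have y: "y = scl B (B.eps y) 1" using assms(1) by (rule B.homog_zero_eq)
  have "ract z 1 = z"
    using linear_on_eq_tensor_lift[OF A.is_subspace B.is_subspace vector_space_tensor_scl _ z, of "\<lambda>z. z"]
    by (simp add: ract_def linear_on_def scl_tensor)
  then show ?thesis using z by (subst y) (simp add: ract_simps)
qed

lemma lact_degree_zero:
  assumes "x \<in> homog A 0" and z: "z \<in> elems (tensor A B)"
  shows "lact x z = tensor_scl (A.eps x) z"
proof -
  have x: "x = scl A (A.eps x) 1" using assms(1) by (rule A.homog_zero_eq)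
  have "lact 1 z = z"
    using linear_on_eq_tensor_lift[OF A.is_subspace B.is_subspace vector_space_tensor_scl _ z, of "\<lambda>z. z"]
    by (simp add: lact_def linear_on_def scl_tensor)
  then show ?thesis using z by (subst x) (simp add: lact_simps)
qed

lemma projA_ract: "z \<in> elems (tensor A B) \<Longrightarrow> projA (ract z y) = scl A (B.eps y) (projA z)"
  by (rule linear_on_tensor_eq[OF A.is_subspace B.is_subspace, where s = "scl A" and g = "\<lambda>z. projA (ract z y)"])
    (simp_all add: linear_on_def ract_simps proj_simps scl_tensor Avs.scale_right_distrib mult.commute)

lemma projA_lact: "z \<in> elems (tensor A B) \<Longrightarrow> projA (lact x z) = x * projA z"
  by (rule linear_on_tensor_eq[OF A.is_subspace B.is_subspace, where s = "scl A" and g = "\<lambda>z. projA (lact x z)"])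
    (simp_all add: linear_on_def lact_simps proj_simps scl_tensor distrib_left flip: A.scl_mult_right)

text \<open>A summand survives \<open>\<epsilon>\<close> only if its leg in \<open>B\<close> has
  degree 0, and then its leg in \<open>A\<close> carries the whole degree \<open>m\<close>.\<close>

lemma projA_homog:
  assumes z: "z \<in> homog (tensor A B) m"
  shows "projA z \<in> homog A m"
proof -
  obtain ps where ps: "z = (\<Sum>(v, w)\<leftarrow>ps. pure A B v w)"
    "\<And>v w. (v, w) \<in> set ps \<Longrightarrow> \<exists>k l. k + l = m \<and> v \<in> homog A k \<and> w \<in> homog B l"
    by (rule homog_tensor_list[OF homog_scalable_A homog_scalable_B z]) blast
  have "projA z = (\<Sum>(x, y)\<leftarrow>ps. scl A (B.eps y) x)"
    unfolding projA_def ps(1) by (rule tensor_lift_sum_list[OF A.is_subspace B.is_subspace A.is_vector_space bilinear_projA]) auto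
  also have "\<dots> \<in> homog A m"
  proof (rule sum_list_in_homog[OF A.graded])
    fix p assume "p \<in> set ps"
    moreover obtain x y where "p = (x, y)" by fastforce
    ultimately obtain k l where p: "p = (x, y)" "k + l = m" "x \<in> homog A k" "y \<in> homog B l"
      using ps(2) by blast
    then show "(case p of (x, y) \<Rightarrow> scl A (B.eps y) x) \<in> homog A m"
      using A.homog_closed B.eps_pos by (cases "l = 0") auto
  qed
  finally show ?thesis .
qed

lemma projB_homog:
  assumes z: "z \<in> homog (tensor A B) m"
  shows "projB z \<in> homog B m"
proof -
  obtain ps where ps: "z = (\<Sum>(v, w)\<leftarrow>ps. pure A B v w)"
    "\<And>v w. (v, w) \<in> set ps \<Longrightarrow> \<exists>k l. k + l = m \<and> v \<in> homog A k \<and> w \<in> homog B l"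
    by (rule homog_tensor_list[OF homog_scalable_A homog_scalable_B z]) blast
  have "projB z = (\<Sum>(x, y)\<leftarrow>ps. scl B (A.eps x) y)"
    unfolding projB_def ps(1) by (rule tensor_lift_sum_list[OF A.is_subspace B.is_subspace B.is_vector_space bilinear_projB]) auto
  also have "\<dots> \<in> homog B m"
  proof (rule sum_list_in_homog[OF B.graded])
    fix p assume "p \<in> set ps"
    moreover obtain x y where "p = (x, y)" by fastforce
    ultimately obtain k l where p: "p = (x, y)" "k + l = m" "x \<in> homog A k" "y \<in> homog B l"
      using ps(2) by blast
    then show "(case p of (x, y) \<Rightarrow> scl B (A.eps x) y) \<in> homog B m"
      using B.homog_closed A.eps_pos by (cases "k = 0") auto
  qed
  finally show ?thesis .
qed

end

locale twisted_pair = augmented_pair A B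
  for A :: "('k::field, 'a::{ring, monoid_mult}) gspace"
    and B :: "('k, 'b::{ring, monoid_mult}) gspace" +
  fixes \<tau> :: "('k, 'b, 'a) tensor \<Rightarrow> ('k, 'a, 'b) tensor"
  assumes twisting: "graded_twisting_map A B \<tau>"
begin

abbreviation tw :: "'b \<Rightarrow> 'a \<Rightarrow> ('k, 'a, 'b) tensor" where
  "tw b a \<equiv> \<tau> (pure B A b a)"

lemma tau_graded_linear: "graded_linear (tensor B A) (tensor A B) \<tau>"
  using twisting by (simp add: graded_twisting_map_def)

lemma tw_unit [simp]: "tw 1 a = pure A B a 1" "tw b 1 = pure A B 1 b"
  using twisting by (simp_all add: graded_twisting_map_def)

lemma tw_degree: "twisting_to_degree A B n \<tau>"
proof -
  have "homog_scalable (tensor B B)" "homog_scalable (tensor A A)"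
    using homog_scalable_A homog_scalable_B by (simp_all add: homog_scalable_tensor)
  from homog_tensor_sub[OF this] show ?thesis
    using twisting unfolding twisting_to_degree_def graded_twisting_map_def by auto
qed

lemma tw_mem [simp]: "tw b a \<in> elems (tensor A B)"
  by (simp add: graded_linear_mem[OF tau_graded_linear])

lemmas tw_homog = graded_linear_homog[OF tau_graded_linear]

lemma tw_simps:
  "tw (b + b') a = tw b a + tw b' a" "tw b (a + a') = tw b a + tw b a'"
  "tw (scl B c b) a = tensor_scl c (tw b a)" "tw b (scl A c a) = tensor_scl c (tw b a)"
  by (simp_all add: pure_simps graded_linear_simps[OF tau_graded_linear])

lemmas tw_mult_left = twisting_mult_left[OF tau_graded_linear tw_degree _ _ _ order_refl]
lemmas tw_mult_right = twisting_mult_right[OF tau_graded_linear tw_degree _ _ _ order_refl]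

text \<open>The sums \<open>\<Sum> \<epsilon>(y\<^sub>i) x\<^sub>i\<close> and
  \<open>\<Sum> \<epsilon>(x\<^sub>i) y\<^sub>i\<close> for
  \<open>\<tau>(b \<otimes> a) = \<Sum> x\<^sub>i \<otimes> y\<^sub>i\<close>, through which the
  cocycle identities involve \<open>\<tau>\<close>. The first one is a left action of
  \<open>B\<close> on \<open>A\<close>, see \<open>actA_mult_left\<close>.\<close>

definition actA :: "'b \<Rightarrow> 'a \<Rightarrow> 'a" where "actA b a = projA (tw b a)"
definition actB :: "'b \<Rightarrow> 'a \<Rightarrow> 'b" where "actB b a = projB (tw b a)"

lemma act_simps [simp]:
  "actA (b + b') a = actA b a + actA b' a" "actA b (a + a') = actA b a + actA b a'"
  "actA (scl B c b) a = scl A c (actA b a)" "actA b (scl A c a) = scl A c (actA b a)"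
  "actB (b + b') a = actB b a + actB b' a" "actB b (a + a') = actB b a + actB b a'"
  "actB (scl B c b) a = scl B c (actB b a)" "actB b (scl A c a) = scl B c (actB b a)"
  "actA 1 a = a" "actA b 1 = scl A (B.eps b) 1" "actB 1 a = scl B (A.eps a) 1" "actB b 1 = b"
  by (simp_all add: actA_def actB_def tw_simps proj_simps)

lemma actA_homog: "b \<in> homog B k \<Longrightarrow> a \<in> homog A l \<Longrightarrow> actA b a \<in> homog A (k + l)"
  unfolding actA_def by (rule projA_homog[OF tw_homog]) simp_all

lemma actB_homog: "b \<in> homog B k \<Longrightarrow> a \<in> homog A l \<Longrightarrow> actB b a \<in> homog B (k + l)"
  unfolding actB_def by (rule projB_homog[OF tw_homog]) simp_all

text \<open>The identities range over arbitrary elements because they have to yield an action of the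
  whole free product. On homogeneous elements all nonzero terms have the same total degree, so only
  degree \<open>n\<close> carries content.\<close>

definition cocycle :: "nat \<Rightarrow> ('b \<Rightarrow> 'a \<Rightarrow> 'k) \<Rightarrow> bool" where
  "cocycle n \<beta> \<longleftrightarrow> bilinear_map B A (*) \<beta> \<and>
     (\<forall>k l. \<forall>b\<in>homog B k. \<forall>a\<in>homog A l. k + l \<noteq> n \<longrightarrow> \<beta> b a = 0) \<and>
     (\<forall>b b' a. \<beta> (b * b') a = B.eps b * \<beta> b' a + \<beta> b (actA b' a)) \<and>
     (\<forall>b a a'. \<beta> b (a * a') = \<beta> b a * A.eps a' + \<beta> (actB b a) a')"

lemma form_simps:
  assumes "bilinear_map B A (*) f"
  shows "f (b + b') a = f b a + f b' a" "f b (a + a') = f b a + f b a'"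
    "f (scl B c b) a = c * f b a" "f b (scl A c a) = c * f b a" "f 0 a = 0" "f b 0 = 0"
  using assms Bvs.scale_zero_left[of b] Avs.scale_zero_left[of a] unfolding bilinear_map_def
  by (simp_all, (metis Bvs.scale_zero_left Avs.scale_zero_left mult_zero_left A.elems B.elems)+)

text \<open>By linearity the arguments may be taken homogeneous. If the outer factor
  (\<open>b\<close> in the first identity, \<open>a'\<close> in the second) has degree 0, the
  identity reduces to the unit hypotheses; if its degree is positive, its augmentation is zero and
  the corresponding term disappears. This is why \<open>m1\<close> and \<open>m2\<close> come
  without that term and with a positivity condition.\<close>

lemma cocycle_bitrunc:
  assumes f: "bilinear_map B A (*) f" and unit: "\<And>a. a \<in> homog A n \<Longrightarrow> f 1 a = 0" "\<And>b. b \<in> homog B n \<Longrightarrow> f b 1 = 0"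
    and m1: "\<And>b b' a k l m. b \<in> homog B k \<Longrightarrow> b' \<in> homog B l \<Longrightarrow> a \<in> homog A m \<Longrightarrow> k + l + m = n \<Longrightarrow> k > 0 \<Longrightarrow>
      f (b * b') a = f b (actA b' a)"
    and m2: "\<And>b a a' k l m. b \<in> homog B k \<Longrightarrow> a \<in> homog A l \<Longrightarrow> a' \<in> homog A m \<Longrightarrow> k + l + m = n \<Longrightarrow> m > 0 \<Longrightarrow>
      f b (a * a') = f (actB b a) a'"
  shows "cocycle n (bitrunc n f)"
proof -
  let ?\<beta> = "bitrunc n f"
  note bh = bitrunc_homog[OF f]
  have \<beta>: "bilinear_map B A (*) ?\<beta>" by (rule bitrunc_bilinear[OF f])
  note s = form_simps[OF \<beta>] form_simps[OF f]
  have "?\<beta> (b * b') a = B.eps b * ?\<beta> b' a + ?\<beta> b (actA b' a)" for b b' a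
  proof (induction b rule: B.homog_induct)
    case (homog k b)
    then have b: "b \<in> homog B k" .
    show ?case
    proof (induction b' rule: B.homog_induct)
      case (homog l b')
      then have b': "b' \<in> homog B l" .
      show ?case
      proof (induction a rule: A.homog_induct)
        case (homog m a)
        note h = bh[OF B.homog_mult[OF b b'] homog] bh[OF b' homog] bh[OF b actA_homog[OF b' homog]]
        show ?case
        proof (cases "k = 0")
          case True
          then have b1: "b = scl B (B.eps b) 1" using b B.homog_zero_eq by blast
          have "b * b' = scl B (B.eps b) b'" by (subst b1) (simp flip: B.scl_mult_left)
          moreover have "f b (actA b' a) = 0" if "l + m = n"
            using unit(1)[OF actA_homog[OF b' homog, unfolded that]] by (subst b1) (simp add: s)
          ultimately show ?thesis unfolding h using True by (simp add: s)
        next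
          case False
          then show ?thesis unfolding h using B.eps_pos[OF b] m1[OF b b' homog] by (simp add: add.assoc)
        qed
      qed (simp add: s algebra_simps)
    qed (simp add: s algebra_simps)
  qed (simp add: s algebra_simps)
  moreover have "?\<beta> b (a * a') = ?\<beta> b a * A.eps a' + ?\<beta> (actB b a) a'" for b a a'
  proof (induction b rule: B.homog_induct)
    case (homog k b)
    then have b: "b \<in> homog B k" .
    show ?case
    proof (induction a rule: A.homog_induct)
      case (homog l a)
      then have a: "a \<in> homog A l" .
      show ?case
      proof (induction a' rule: A.homog_induct)
        case (homog m a')
        note h = bh[OF b A.homog_mult[OF a homog]] bh[OF b a] bh[OF actB_homog[OF b a] homog]
        show ?case
        proof (cases "m = 0")
          case True
          then have a1: "a' = scl A (A.eps a') 1" using homog A.homog_zero_eq by blast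
          have "a * a' = scl A (A.eps a') a" by (subst a1) (simp flip: A.scl_mult_right)
          moreover have "f (actB b a) a' = 0" if "k + l = n"
            using unit(2)[OF actB_homog[OF b a, unfolded that]] by (subst a1) (simp add: s)
          ultimately show ?thesis unfolding h using True by (simp add: s)
        next
          case False
          then show ?thesis unfolding h using A.eps_pos[OF homog] m2[OF b a homog] by (simp add: add.assoc)
        qed
      qed (simp add: s algebra_simps)
    qed (simp add: s algebra_simps)
  qed (simp add: s algebra_simps)
  ultimately show ?thesis
    unfolding cocycle_def using \<beta> by (auto simp: bh)
qed

section \<open>Deforming a twisting map by a cocycle\<close>

text \<open>The one-sided identities apply \<open>t\<close> twice. \<open>G1\<close> collects the
  contribution of \<open>\<beta>\<close> from the second application and \<open>G2\<close> that from
  the first; they are the two terms on the right of the cocycle identity.\<close>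

lemma cocycle_deformation:
  assumes co: "cocycle n \<beta>" and v: "v \<in> homog (tensor A B) n"
  obtains t where "graded_linear (tensor B A) (tensor A B) t" "twisting_to_degree A B n t"
    "\<And>b a. t (pure B A b a) = tw b a + tensor_scl (\<beta> b a) v"
proof -
  note vs = vector_space_tensor_scl
  have \<beta>: "bilinear_map B A (*) \<beta>" using co by (simp add: cocycle_def)
  note s = form_simps[OF \<beta>]
  have \<beta>deg: "\<beta> b a = 0" if "b \<in> homog B k" "a \<in> homog A l" "k + l \<noteq> n" for b a k l
    using co that by (auto simp: cocycle_def)
  have co1: "\<beta> (b * b') a = B.eps b * \<beta> b' a + \<beta> b (actA b' a)" for b b' a
    using co by (simp add: cocycle_def)
  have co2: "\<beta> b (a * a') = \<beta> b a * A.eps a' + \<beta> (actB b a) a'" for b a a'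
    using co by (simp add: cocycle_def)
  \<comment> \<open>With all possible arguments equal to 1, a cocycle identity reads
    \<open>x = x + x\<close>.\<close>
  have \<beta>1: "\<beta> 1 a = 0" "\<beta> b 1 = 0" for a b
    using co1[of 1 1 a] co2[of b 1 1]
    by (simp_all only: mult_1_left mult_1_right A.eps_one B.eps_one act_simps add_cancel_right_right)
  have vm [simp]: "v \<in> elems (tensor A B)"
    using v homog_tensor_sub[OF homog_scalable_A homog_scalable_B] by blast
  note sv = subspace_of_vector_spaceD[OF T[of A B], unfolded scl_tensor]
  define f where "f b a = tw b a + tensor_scl (\<beta> b a) v" for b a
  have f: "bilinear_map B A tensor_scl f"
    by (simp add: bilinear_map_def f_def tw_simps s tensor_vs.scale_left_distrib tensor_vs.scale_right_distrib)
  define t where "t = tensor_lift B A f"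
  have tp: "t (pure B A b a) = f b a" for b a
    unfolding t_def by (rule tensor_universal(1)[OF B.is_subspace A.is_subspace vs f]) simp_all
  have tlin: "linear_on (tensor B A) tensor_scl t"
    unfolding t_def by (rule linear_on_tensor_lift[OF B.is_subspace A.is_subspace vs f])
  have fm: "f b a \<in> elems (tensor A B)" for b a
    by (simp add: f_def sv)
  have tm: "t z \<in> elems (tensor A B)" if "z \<in> elems (tensor B A)" for z
    unfolding t_def by (rule tensor_lift_in_elems[OF B.is_subspace A.is_subspace T _ _ that]) (simp_all add: scl_tensor f fm)
  have th: "t z \<in> homog (tensor A B) m" if z: "z \<in> homog (tensor B A) m" for z m
  proof -
    note sub = homog_tensor_subspace[of A B m, unfolded tensor_vs.subspace_def]
    obtain ps where ps: "z = (\<Sum>(v, w)\<leftarrow>ps. pure B A v w)"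
      "\<And>v w. (v, w) \<in> set ps \<Longrightarrow> \<exists>k l. k + l = m \<and> v \<in> homog B k \<and> w \<in> homog A l"
      by (rule homog_tensor_list[OF homog_scalable_B homog_scalable_A z]) blast
    have "t z = (\<Sum>(x, y)\<leftarrow>ps. f x y)"
      unfolding t_def ps(1) by (rule tensor_lift_sum_list[OF B.is_subspace A.is_subspace vs f]) auto
    also have "\<dots> \<in> homog (tensor A B) m"
      using ps(2)
    proof (induction ps)
      case Nil
      show ?case using sub by (simp add: zero_fun_def)
    next
      case (Cons p ps)
      obtain b a where p: "p = (b, a)" by fastforce
      with Cons.prems obtain k l where kl: "k + l = m" "b \<in> homog B k" "a \<in> homog A l"
        by (metis list.set_intros(1))
      have "tensor_scl (\<beta> b a) v \<in> homog (tensor A B) m"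
        using \<beta>deg[OF kl(2,3)] kl(1) v sub by (cases "m = n") auto
      then have "f b a \<in> homog (tensor A B) m"
        unfolding f_def using tw_homog[OF kl(2,3,1)] sub by blast
      moreover have "(\<Sum>(x, y)\<leftarrow>ps. f x y) \<in> homog (tensor A B) m"
        using Cons by auto
      ultimately show ?case unfolding p using sub by (simp add: plus_fun_def)
    qed
    finally show ?thesis .
  qed
  have tg: "graded_linear (tensor B A) (tensor A B) t"
    using tlin tm th by (auto simp: graded_linear_def linear_on_def scl_tensor)
  note lin_beta = s tensor_vs.scale_left_distrib
  have m1: "t (pure B A (b * b') a) = L (\<lambda>x y. ract (t (pure B A b x)) y) (t (pure B A b' a))"
    if b: "b \<in> homog B k" "b' \<in> homog B l" and a: "a \<in> homog A m" and n: "k + l + m \<le> n"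
    for b b' a k l m
  proof -
    let ?G = "L (\<lambda>x y. ract (t (pure B A b x)) y)"
    let ?h = "\<lambda>x. tensor_scl (\<beta> b x) v"
    have hA: "linear_on A tensor_scl ?h"
      by (simp add: linear_on_def lin_beta)
    have hbil: "bilinear_map A B tensor_scl (\<lambda>x y. ?h (scl A (B.eps y) x))"
      by (rule bilinear_map_comp_linear[OF bilinear_projA _ hA]) simp
    have G: "linear_on (tensor A B) tensor_scl ?G" by (rule L_linear[OF vs bilinear_ract_twist[OF tg]])
    \<comment> \<open>\<open>\<beta> b x\<close> is nonzero only if \<open>k + i = n\<close>. Then
      nothing of the degree is left for \<open>y\<close>, so \<open>y\<close> is a scalar and acts
      on \<open>v\<close> by its augmentation.\<close>
    have "?G (tw b' a) = L (\<lambda>x y. ract (tw b x) y + ?h (scl A (B.eps y) x)) (tw b' a)"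
    proof (rule L_homog_cong[OF bilinear_ract_twist[OF tg] bilinear_map_add[OF vs bilinear_ract_twist[OF tau_graded_linear] hbil] vs _ tw_homog[OF b(2) a refl]])
      fix x y i j assume xy: "x \<in> homog A i" "y \<in> homog B j" "i + j = l + m"
      have "tensor_scl (\<beta> b x) (ract v y) = ?h (scl A (B.eps y) x)"
      proof (cases "k + i = n")
        case False
        then show ?thesis using \<beta>deg[OF b(1) xy(1)] by (simp add: s)
      next
        case True
        then have "j = 0" using xy n by linarith
        then have "ract v y = tensor_scl (B.eps y) v" using xy(2) by (simp add: ract_degree_zero)
        then show ?thesis by (simp add: s mult.commute)
      qed
      then show "ract (t (pure B A b x)) y = ract (tw b x) y + ?h (scl A (B.eps y) x)"
        by (simp add: tp f_def ract_simps sv)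
    qed
    also have "\<dots> = tw (b * b') a + L (\<lambda>x y. ?h (scl A (B.eps y) x)) (tw b' a)"
      unfolding tw_mult_left[OF b a]
      by (rule tensor_lift_add[OF A.is_subspace B.is_subspace vs bilinear_ract_twist[OF tau_graded_linear] hbil]) simp
    also have "L (\<lambda>x y. ?h (scl A (B.eps y) x)) (tw b' a) = ?h (actA b' a)"
      unfolding actA_def projA_def
      by (rule L_comm[OF bilinear_projA _ A.is_subspace vs hA, symmetric]) simp_all
    finally have G1: "?G (tw b' a) = tw (b * b') a + ?h (actA b' a)" .
    \<comment> \<open>\<open>\<beta> b' a\<close> is nonzero only if \<open>l + m = n\<close>. Then
      \<open>b\<close> is a scalar, and the second application of \<open>t\<close> contributes no
      further \<open>\<beta>\<close>, because \<open>\<beta>\<close> vanishes on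
      \<open>1\<close>.\<close>
    have G2: "tensor_scl (\<beta> b' a) (?G v) = tensor_scl (B.eps b * \<beta> b' a) v"
    proof (cases "l + m = n")
      case False
      then show ?thesis using \<beta>deg[OF b(2) a] by simp
    next
      case True
      then have "k = 0" using n by simp
      then have b1: "b = scl B (B.eps b) 1" using b(1) B.homog_zero_eq by blast
      have "ract (t (pure B A b x)) y = tensor_scl (B.eps b) (pure A B x y)" for x y
        by (subst b1) (simp add: tp f_def tw_simps s \<beta>1 ract_simps)
      then have "?G v = L (\<lambda>x y. tensor_scl (B.eps b) (pure A B x y)) v" by simp
      also have "\<dots> = tensor_scl (B.eps b) v"
        by (rule linear_on_eq_tensor_lift[OF A.is_subspace B.is_subspace vs _ vm, symmetric])
          (simp add: linear_on_def scl_tensor tensor_vs.scale_right_distrib mult.commute)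
      finally show ?thesis by (simp add: mult.commute)
    qed
    have "?G (t (pure B A b' a)) = ?G (tw b' a) + tensor_scl (\<beta> b' a) (?G v)"
      using G by (simp add: linear_on_def tp f_def scl_tensor sv)
    then show ?thesis
      unfolding G1 G2 by (simp add: tp f_def co1 tensor_vs.scale_left_distrib)
  qed
  have m2: "t (pure B A b (a * a')) = L (\<lambda>x y. lact x (t (pure B A y a'))) (t (pure B A b a))"
    if b: "b \<in> homog B k" and a: "a \<in> homog A l" "a' \<in> homog A m" and n: "k + l + m \<le> n"
    for b a a' k l m
  proof -
    let ?G = "L (\<lambda>x y. lact x (t (pure B A y a')))"
    let ?h = "\<lambda>y. tensor_scl (\<beta> y a') v"
    have hB: "linear_on B tensor_scl ?h"
      by (simp add: linear_on_def lin_beta)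
    have hbil: "bilinear_map A B tensor_scl (\<lambda>x y. ?h (scl B (A.eps x) y))"
      by (rule bilinear_map_comp_linear[OF bilinear_projB _ hB]) simp
    have G: "linear_on (tensor A B) tensor_scl ?G" by (rule L_linear[OF vs bilinear_lact_twist[OF tg]])
    have "?G (tw b a) = L (\<lambda>x y. lact x (tw y a') + ?h (scl B (A.eps x) y)) (tw b a)"
    proof (rule L_homog_cong[OF bilinear_lact_twist[OF tg] bilinear_map_add[OF vs bilinear_lact_twist[OF tau_graded_linear] hbil] vs _ tw_homog[OF b a(1) refl]])
      fix x y i j assume xy: "x \<in> homog A i" "y \<in> homog B j" "i + j = k + l"
      have "tensor_scl (\<beta> y a') (lact x v) = ?h (scl B (A.eps x) y)"
      proof (cases "j + m = n")
        case False
        then show ?thesis using \<beta>deg[OF xy(2) a(2)] by (simp add: s)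
      next
        case True
        then have "i = 0" using xy n by linarith
        then have "lact x v = tensor_scl (A.eps x) v" using xy(1) by (simp add: lact_degree_zero)
        then show ?thesis by (simp add: s mult.commute)
      qed
      then show "lact x (t (pure B A y a')) = lact x (tw y a') + ?h (scl B (A.eps x) y)"
        by (simp add: tp f_def lact_simps sv)
    qed
    also have "\<dots> = tw b (a * a') + L (\<lambda>x y. ?h (scl B (A.eps x) y)) (tw b a)"
      unfolding tw_mult_right[OF b a]
      by (rule tensor_lift_add[OF A.is_subspace B.is_subspace vs bilinear_lact_twist[OF tau_graded_linear] hbil]) simp
    also have "L (\<lambda>x y. ?h (scl B (A.eps x) y)) (tw b a) = ?h (actB b a)"
      unfolding actB_def projB_def
      by (rule L_comm[OF bilinear_projB _ B.is_subspace vs hB, symmetric]) simp_all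
    finally have G1: "?G (tw b a) = tw b (a * a') + ?h (actB b a)" .
    have G2: "tensor_scl (\<beta> b a) (?G v) = tensor_scl (\<beta> b a * A.eps a') v"
    proof (cases "k + l = n")
      case False
      then show ?thesis using \<beta>deg[OF b a(1)] by simp
    next
      case True
      then have "m = 0" using n by simp
      then have a1: "a' = scl A (A.eps a') 1" using a(2) A.homog_zero_eq by blast
      have "lact x (t (pure B A y a')) = tensor_scl (A.eps a') (pure A B x y)" for x y
        by (subst a1) (simp add: tp f_def tw_simps s \<beta>1 lact_simps)
      then have "?G v = L (\<lambda>x y. tensor_scl (A.eps a') (pure A B x y)) v" by simp
      also have "\<dots> = tensor_scl (A.eps a') v"
        by (rule linear_on_eq_tensor_lift[OF A.is_subspace B.is_subspace vs _ vm, symmetric])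
          (simp add: linear_on_def scl_tensor tensor_vs.scale_right_distrib mult.commute)
      finally show ?thesis by simp
    qed
    have "?G (t (pure B A b a)) = ?G (tw b a) + tensor_scl (\<beta> b a) (?G v)"
      using G by (simp add: linear_on_def tp f_def scl_tensor sv)
    then show ?thesis
      unfolding G1 G2 by (simp add: tp f_def co2 tensor_vs.scale_left_distrib)
  qed
  have "twisting_to_degree A B n t"
    by (rule twisting_to_degreeI[OF tg _ _ m1 m2]) (simp_all add: tp f_def \<beta>1)
  with tg tp that show thesis by (simp add: f_def)
qed

end

section \<open>Ideals of the free product\<close>

lemma free_ring_simps [simp]:
  "carrier free_ring = UNIV" "\<zero>\<^bsub>free_ring\<^esub> = 0" "x \<oplus>\<^bsub>free_ring\<^esub> y = x + y" "x \<otimes>\<^bsub>free_ring\<^esub> y = x * y"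
  by (simp_all add: free_ring_def)

lemma a_inv_free_ring [simp]: "\<ominus>\<^bsub>free_ring\<^esub> p = - p"
proof -
  interpret ring free_ring by (rule ring_free_ring)
  show ?thesis by (rule minus_equality) simp_all
qed

lemma ideal_free_ringI:
  assumes "0 \<in> J" "\<And>p q. p \<in> J \<Longrightarrow> q \<in> J \<Longrightarrow> p + q \<in> J" "\<And>p q. p \<in> J \<Longrightarrow> q * p \<in> J" "\<And>p q. p \<in> J \<Longrightarrow> p * q \<in> J"
  shows "ideal J free_ring"
proof (rule idealI[OF ring_free_ring])
  show "subgroup J (add_monoid free_ring)"
  proof
    fix p assume "p \<in> J"
    then have "- p \<in> J" using assms(3)[of p "-1"] by simp
    then show "inv\<^bsub>add_monoid free_ring\<^esub> p \<in> J"
      using a_inv_free_ring[of p] by (simp add: a_inv_def)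
  qed (use assms in simp_all)
qed (use assms in simp_all)

lemma ideal_free_ringD:
  assumes "ideal J free_ring"
  shows "0 \<in> J" "p \<in> J \<Longrightarrow> q \<in> J \<Longrightarrow> p + q \<in> J" "p \<in> J \<Longrightarrow> q * p \<in> J" "p \<in> J \<Longrightarrow> p * q \<in> J"
    "p \<in> J \<Longrightarrow> q \<in> J \<Longrightarrow> p - q \<in> J" "p \<in> J \<Longrightarrow> free_scl c p \<in> J"
proof -
  interpret ideal J free_ring by fact
  show *: "0 \<in> J" "p \<in> J \<Longrightarrow> q \<in> J \<Longrightarrow> p + q \<in> J" "p \<in> J \<Longrightarrow> q * p \<in> J" "p \<in> J \<Longrightarrow> p * q \<in> J" for p q
    using additive_subgroup.zero_closed[OF is_additive_subgroup] I_l_closed[of p q] I_r_closed[of p q]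
      additive_subgroup.a_closed[OF is_additive_subgroup, of p q] by simp_all
  show "p \<in> J \<Longrightarrow> q \<in> J \<Longrightarrow> p - q \<in> J"
    using *(2)[of p "- q"] *(3)[of q "- 1"] by simp
  show "p \<in> J \<Longrightarrow> free_scl c p \<in> J"
    using *(3) by (simp add: free_scl_def)
qed

lemma free_product_class_hom:
  "ring_hom_ring free_ring (free_product A B) (free_product_class A B)"
  unfolding free_product_def free_product_class_def[abs_def]
  by (rule ideal.rcos_ring_hom_ring[OF ideal_free_product_ideal])

lemma carrier_free_product: "carrier (free_product A B) = range (free_product_class A B)"
  by (auto simp: free_product_def free_product_class_def FactRing_def A_RCOSETS_def')

lemma free_product_class_image_ideal:
  assumes "ideal Q free_ring"
  shows "ideal (free_product_class A B ` Q) (free_product A B)"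
  unfolding free_product_def free_product_class_def[abs_def]
  by (rule ring.ring_ideal_imp_quot_ideal[OF ring_free_ring ideal_free_product_ideal assms])

lemma free_product_ideal_minimal:
  assumes "ideal Q free_ring" "free_product_relations A B \<subseteq> Q"
  shows "free_product_ideal A B \<subseteq> Q"
  unfolding free_product_ideal_def by (rule ring.genideal_minimal[OF ring_free_ring assms])

text \<open>\<open>Q\<close> contains the kernel of the quotient map and is therefore the full
  preimage of its image. Ideals of the free product can thus be tested upstairs, on ideals such as
  annihilators of modules over the free algebra.\<close>

lemma mem_ideal_of_class_mem_genideal:
  assumes Q: "ideal Q free_ring" "free_product_relations A B \<subseteq> Q"
    and S: "S \<subseteq> carrier (free_product A B)" "\<And>q. free_product_class A B q \<in> S \<Longrightarrow> q \<in> Q"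
    and p: "free_product_class A B p \<in> Idl\<^bsub>free_product A B\<^esub> S"
  shows "p \<in> Q"
proof -
  have "S \<subseteq> free_product_class A B ` Q"
    using S unfolding carrier_free_product by blast
  then have "Idl\<^bsub>free_product A B\<^esub> S \<subseteq> free_product_class A B ` Q"
    by (rule ring.genideal_minimal[OF ring_free_product free_product_class_image_ideal[OF Q(1)]])
  with p obtain q where "q \<in> Q" "p - q \<in> free_product_ideal A B"
    using free_product_class_eq_iff by blast
  then show ?thesis
    using free_product_ideal_minimal[OF Q] ideal_free_ringD(2)[OF Q(1), of "p - q" q] by auto
qed

lemma class_vimage_genideal:
  assumes "S \<subseteq> carrier (free_product A B)"
  shows "ideal {p. free_product_class A B p \<in> Idl\<^bsub>free_product A B\<^esub> S} free_ring"
    "free_product_ideal A B \<subseteq> {p. free_product_class A B p \<in> Idl\<^bsub>free_product A B\<^esub> S}"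
proof -
  interpret ring_hom_ring free_ring "free_product A B" "free_product_class A B"
    by (rule free_product_class_hom)
  have I: "ideal (Idl\<^bsub>free_product A B\<^esub> S) (free_product A B)"
    by (rule S.genideal_ideal[OF assms])
  show "ideal {p. free_product_class A B p \<in> Idl\<^bsub>free_product A B\<^esub> S} free_ring"
    using ideal_vimage[OF I] by simp
  show "free_product_ideal A B \<subseteq> {p. free_product_class A B p \<in> Idl\<^bsub>free_product A B\<^esub> S}"
  proof
    fix p assume "p \<in> free_product_ideal A B"
    then have "free_product_class A B p = free_product_class A B 0"
      by (simp add: free_product_class_eq_iff)
    also have "\<dots> = \<zero>\<^bsub>free_product A B\<^esub>" using hom_zero by simp
    finally show "p \<in> {p. free_product_class A B p \<in> Idl\<^bsub>free_product A B\<^esub> S}"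
      using additive_subgroup.zero_closed[OF ideal.axioms(1)[OF I]] by simp
  qed
qed

text \<open>Any presentation of the tensor by a list may be used, so a generator of the twisting
  ideal is the class of an explicit element of the free algebra.\<close>

lemma twisting_generator_class:
  assumes "subspace_of_vector_space A" "subspace_of_vector_space B" "set ps \<subseteq> elems A \<times> elems B"
  shows "free_product_class A B (genB b) \<otimes>\<^bsub>free_product A B\<^esub> free_product_class A B (genA a)
        \<ominus>\<^bsub>free_product A B\<^esub> tensor_to_free_product A B (\<Sum>(x, y)\<leftarrow>ps. pure A B x y) =
     free_product_class A B (genB b * genA a - (\<Sum>(x, y)\<leftarrow>ps. genA x * genB y))"
proof -
  interpret ring_hom_ring free_ring "free_product A B" "free_product_class A B"
    by (rule free_product_class_hom)
  let ?i = "\<Sum>(x, y)\<leftarrow>ps. genA x * genB y"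
  have "free_product_class A B (genB b * genA a - ?i) = free_product_class A B (genB b * genA a \<oplus>\<^bsub>free_ring\<^esub> \<ominus>\<^bsub>free_ring\<^esub> ?i)"
    by simp
  also have "\<dots> = free_product_class A B (genB b * genA a) \<ominus>\<^bsub>free_product A B\<^esub> free_product_class A B ?i"
    unfolding a_minus_def by (subst hom_add, simp, simp, subst hom_a_inv) simp_all
  also have "free_product_class A B (genB b * genA a) = free_product_class A B (genB b \<otimes>\<^bsub>free_ring\<^esub> genA a)"
    by simp
  also have "\<dots> = free_product_class A B (genB b) \<otimes>\<^bsub>free_product A B\<^esub> free_product_class A B (genA a)"
    by (rule hom_mult) simp_all
  finally show ?thesis unfolding tensor_to_free_product_sum_list[OF assms] ..
qed

section \<open>Representations of the free algebra\<close>

interpretation free_vs: vector_space free_scl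
  by (rule vector_space_free_scl)

lemma word_append: "word (xs @ ys) = word xs * word ys"
  by (simp add: word_def mult_single plus_list_def)

lemma word_Nil: "word [] = 1"
  by (simp add: word_def zero_list_def[symmetric])

lemma lookup_free_scl: "Poly_Mapping.lookup (free_scl c p) w = c * Poly_Mapping.lookup p w"
proof (induction p rule: update_induct)
  case (update f a b)
  have "Poly_Mapping.update a b f = Poly_Mapping.single a b + f"
    using update(1)
    by (intro poly_mapping_eqI) (auto simp: lookup_update lookup_add lookup_single in_keys_iff)
  moreover have "free_scl c (Poly_Mapping.single a b) = Poly_Mapping.single a (c * b)"
    by (simp add: free_scl_def mult_single)
  ultimately show ?case
    using update(3)
    by (simp add: free_vs.scale_right_distrib lookup_add distrib_left lookup_single when_def)
qed (simp add: free_scl_def)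

lemma span_words: "free_vs.span (range word) = UNIV"
proof -
  have "p \<in> free_vs.span (range word)" for p :: "('k::field, 'a, 'b) free_alg"
  proof (induction p rule: update_induct)
    case const
    show ?case by (rule free_vs.span_zero)
  next
    case (update f a b)
    have "Poly_Mapping.update a b f = free_scl b (word a) + f"
      using update(1)
      by (intro poly_mapping_eqI)
        (auto simp: lookup_update lookup_add lookup_single in_keys_iff lookup_free_scl word_def)
    then show ?case
      using update(3) by (simp add: free_vs.span_add free_vs.span_scale free_vs.span_base)
  qed
  then show ?thesis by blast
qed

lemma free_alg_induct [case_names zero step]:
  assumes "P 0" "\<And>c w p. P p \<Longrightarrow> P (free_scl c (word w) + p)"
  shows "P p"
proof -
  have "p \<in> free_vs.span (range word)" by (simp add: span_words)
  then show ?thesis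
    by (induction rule: free_vs.span_induct_alt) (auto intro: assms)
qed

text \<open>By freeness, arbitrary linear operators indexed by the letters extend to a module
  structure. Compatibility with the operations of \<open>A\<close> and \<open>B\<close> is a
  separate condition, namely that the relations of the free product act by zero.\<close>

locale free_rep = vector_space s for s :: "'k::field \<Rightarrow> 'm \<Rightarrow> 'm::ab_group_add" +
  fixes step :: "'a + 'b \<Rightarrow> 'm \<Rightarrow> 'm"
  assumes step_add: "step x (m + m') = step x m + step x m'"
    and step_scl: "step x (s c m) = s c (step x m)"
begin

definition act :: "('k, 'a, 'b) free_alg \<Rightarrow> 'm \<Rightarrow> 'm" where
  "act p m = (\<Sum>w\<in>Poly_Mapping.keys p. s (Poly_Mapping.lookup p w) (foldr step w m))"

lemma act_superset: "finite S \<Longrightarrow> Poly_Mapping.keys p \<subseteq> S \<Longrightarrow> act p m = (\<Sum>w\<in>S. s (Poly_Mapping.lookup p w) (foldr step w m))"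
  unfolding act_def by (rule sum.mono_neutral_left) (auto simp: in_keys_iff)

lemma act_add: "act (p + q) m = act p m + act q m"
proof -
  let ?S = "Poly_Mapping.keys p \<union> Poly_Mapping.keys q"
  have "Poly_Mapping.keys (p + q) \<subseteq> ?S" by (rule keys_add)
  then show ?thesis
    by (simp add: act_superset[of ?S] lookup_add scale_left_distrib sum.distrib)
qed

lemma act_free_scl: "act (free_scl c p) m = s c (act p m)"
proof -
  have "Poly_Mapping.keys (free_scl c p) \<subseteq> Poly_Mapping.keys p" by (auto simp: in_keys_iff lookup_free_scl)
  then show ?thesis
    by (simp add: act_superset[of "Poly_Mapping.keys p"] lookup_free_scl scale_sum_right)
qed

lemma act_zero: "act 0 m = 0"
  by (simp add: act_def)

lemma act_diff: "act (p - q) m = act p m - act q m"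
  using act_add[of "p - q" q m] by simp

lemma act_word: "act (word w) m = foldr step w m"
  by (simp add: act_def word_def)

lemma act_gen: "act (word [x]) m = step x m"
  by (simp add: act_word)

lemma foldr_add: "foldr step w (m + m') = foldr step w m + foldr step w m'"
  by (induction w) (simp_all add: step_add)

lemma foldr_scl: "foldr step w (s c m) = s c (foldr step w m)"
  by (induction w) (simp_all add: step_scl)

lemma act_add_right: "act p (m + m') = act p m + act p m'"
  by (simp add: act_def foldr_add scale_right_distrib sum.distrib)

lemma act_scl_right: "act p (s c m) = s c (act p m)"
  by (simp add: act_def foldr_scl scale_sum_right mult.commute)

lemma act_zero_right: "act p 0 = 0"
  using act_scl_right[of p 0 0] by simp

lemma act_mult: "act (p * q) m = act p (act q m)"
proof (induction p rule: free_alg_induct)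
  case zero
  show ?case by (simp add: act_zero)
next
  case (step c w p)
  have "act (word w * q) m = act (word w) (act q m)"
  proof (induction q rule: free_alg_induct)
    case zero
    show ?case by (simp add: act_zero act_zero_right)
  next
    case (step c u q)
    then show ?case
      by (simp add: distrib_left mult_free_scl act_add act_free_scl act_add_right act_scl_right
        act_word flip: word_append)
  qed
  with step show ?case
    by (simp add: distrib_right free_scl_mult act_add act_free_scl)
qed

lemma act_one: "act 1 m = m"
  using act_word[of "[]" m] by (simp add: word_Nil)

lemma act_sum_list: "act (\<Sum>p\<leftarrow>ps. h p) m = (\<Sum>p\<leftarrow>ps. act (h p) m)"
  by (induction ps) (simp_all add: act_zero act_add)

end

section \<open>Quadratic ideals force cocycles to vanish\<close>

context twisted_pair
begin

lemma eps_actA [simp]: "A.eps (actA b a) = B.eps b * A.eps a"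
proof (induction b rule: B.homog_induct)
  case (homog k b)
  then have b: "b \<in> homog B k" .
  show ?case
  proof (induction a rule: A.homog_induct)
    case (homog l a)
    show ?case
    proof (cases "k = 0")
      case True
      then have b1: "b = scl B (B.eps b) 1" using b B.homog_zero_eq by blast
      have "actA b a = scl A (B.eps b) a" by (subst b1) simp
      then show ?thesis by simp
    next
      case False
      then show ?thesis using A.eps_pos[OF actA_homog[OF b homog]] B.eps_pos[OF b] by simp
    qed
  qed (simp add: algebra_simps)
qed (simp add: algebra_simps)

lemma eps_actB [simp]: "B.eps (actB b a) = B.eps b * A.eps a"
proof (induction a rule: A.homog_induct)
  case (homog k a)
  then have a: "a \<in> homog A k" .
  show ?case
  proof (induction b rule: B.homog_induct)
    case (homog l b)
    show ?case
    proof (cases "k = 0")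
      case True
      then have a1: "a = scl A (A.eps a) 1" using a A.homog_zero_eq by blast
      have "actB b a = scl B (A.eps a) b" by (subst a1) simp
      then show ?thesis by simp
    next
      case False
      then show ?thesis using B.eps_pos[OF actB_homog[OF homog a]] A.eps_pos[OF a] by simp
    qed
  qed (simp add: algebra_simps)
qed (simp add: algebra_simps)

text \<open>Apply \<open>1 \<otimes> \<epsilon>\<close> to the one-sided twisting identity: by
  \<open>projA_ract\<close> the leg in \<open>B\<close> that is multiplied from the right
  contributes only its augmentation.\<close>

lemma actA_mult_left [simp]: "actA (b * b') a = actA b (actA b' a)"
proof (induction b rule: B.homog_induct)
  case (homog k b)
  then have b: "b \<in> homog B k" .
  show ?case
  proof (induction b' rule: B.homog_induct)
    case (homog l b')
    then have b': "b' \<in> homog B l" .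
    show ?case
    proof (induction a rule: A.homog_induct)
      case (homog m a)
      have lin: "linear_on A (scl A) (actA b)" by (simp add: linear_on_def)
      have "actA (b * b') a = L (\<lambda>x y. projA (ract (tw b x) y)) (tw b' a)"
        unfolding actA_def tw_mult_left[OF b b' homog]
        by (rule L_comm[OF _ _ T A.is_vector_space projA_linear]) (simp_all add: scl_tensor bilinear_ract_twist[OF tau_graded_linear])
      also have "\<dots> = L (\<lambda>x y. actA b (scl A (B.eps y) x)) (tw b' a)"
        by (simp add: projA_ract flip: actA_def)
      also have "\<dots> = actA b (actA b' a)"
        unfolding actA_def[of b' a] projA_def
        by (rule L_comm[OF bilinear_projA _ A.is_subspace A.is_vector_space lin, symmetric]) simp_all
      finally show ?case .
    qed simp
  qed (simp add: distrib_left)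
qed (simp add: distrib_right)

lemma bilinear_mult_actA: "bilinear_map A B (scl A) (\<lambda>x y. x * actA y a)"
  by (simp add: bilinear_map_def distrib_left distrib_right flip: A.scl_mult_left A.scl_mult_right)

text \<open>Acting by \<open>a'\<close> and then by \<open>b\<close> through \<open>b a\<close>
  agrees with acting through \<open>\<tau>(b \<otimes> a)\<close>. This is the reason why
  \<open>ba - \<tau>(b \<otimes> a)\<close> acts by zero on the quotient \<open>A\<close> of the
  module \<open>A \<times> K\<close>.\<close>

lemma actA_mult_right: "actA b (a * a') = L (\<lambda>x y. x * actA y a') (tw b a)"
proof (induction b rule: B.homog_induct)
  case (homog k b)
  then have b: "b \<in> homog B k" .
  show ?case
  proof (induction a rule: A.homog_induct)
    case (homog l a)
    then have a: "a \<in> homog A l" .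
    show ?case
    proof (induction a' rule: A.homog_induct)
      case (homog m a')
      have "actA b (a * a') = L (\<lambda>x y. projA (lact x (tw y a'))) (tw b a)"
        unfolding actA_def tw_mult_right[OF b a homog]
        by (rule L_comm[OF _ _ T A.is_vector_space projA_linear]) (simp_all add: scl_tensor bilinear_lact_twist[OF tau_graded_linear])
      then show ?case by (simp add: projA_lact actA_def)
    next
      case (add x y)
      then show ?case
        using tensor_lift_add[OF A.is_subspace B.is_subspace A.is_vector_space bilinear_mult_actA[of x] bilinear_mult_actA[of y] tw_mem]
        by (simp add: distrib_left)
    qed
  next
    case (add x y)
    then show ?case
      using L_linear[OF A.is_vector_space bilinear_mult_actA[of a']] by (simp add: distrib_right tw_simps linear_on_def plus_fun_def)
  qed
next
  case (add x y)
  then show ?case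
    using L_linear[OF A.is_vector_space bilinear_mult_actA[of a']] by (simp add: tw_simps linear_on_def plus_fun_def)
qed

lemma L_form:
  assumes "linear_on B (*) f"
  shows "L (\<lambda>x y. A.eps x * f y) (tw b a) = f (actB b a)"
proof -
  have "f (actB b a) = L (\<lambda>x y. f (scl B (A.eps x) y)) (tw b a)"
    unfolding actB_def projB_def
    by (rule L_comm[OF bilinear_projB _ B.is_subspace vector_space_times assms]) simp_all
  also have "(\<lambda>x y. f (scl B (A.eps x) y)) = (\<lambda>x y. A.eps x * f y)"
    using assms by (simp add: linear_on_def)
  finally show ?thesis ..
qed

text \<open>\<open>A\<close> is the quotient of \<open>A \<otimes>\<^sub>\<tau> B\<close> by the left ideal generated by the augmentation ideal of \<open>B\<close>,
  and a cocycle is the same as an extension of this module by the trivial module \<open>K\<close>.\<close>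

lemma cocycle_vanishes:
  assumes co: "cocycle n \<beta>" and n: "n \<ge> 3" and quad: "tau_quadratic A B \<tau>"
  shows "\<beta> b a = 0"
proof -
  note split_paired_All [simp del]
  have \<beta>: "bilinear_map B A (*) \<beta>" using co by (simp add: cocycle_def)
  note s = form_simps[OF \<beta>]
  have \<beta>deg: "\<beta> b a = 0" if "b \<in> homog B k" "a \<in> homog A l" "k + l \<noteq> n" for b a k l
    using co that by (auto simp: cocycle_def)
  have co1: "\<beta> (b * b') a = B.eps b * \<beta> b' a + \<beta> b (actA b' a)" for b b' a
    using co by (simp add: cocycle_def)
  have co2: "\<beta> b (a * a') = \<beta> b a * A.eps a' + \<beta> (actB b a) a'" for b a a'
    using co by (simp add: cocycle_def)
  have \<beta>1: "\<beta> 1 a = 0" for a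
    using co1[of 1 1 a] by (simp only: mult_1_left B.eps_one act_simps add_cancel_right_right)
  define sc where "sc c m = (scl A c (fst m), c * snd m)" for c and m :: "'a \<times> 'k"
  have sc_simps: "sc c (m, v) = (scl A c m, c * v)" "fst (sc c p) = scl A c (fst p)" "snd (sc c p) = c * snd p" for c m v p
    by (simp_all add: sc_def)
  define step :: "'a + 'b \<Rightarrow> 'a \<times> 'k \<Rightarrow> 'a \<times> 'k" where
    "step x m = (case x of Inl a \<Rightarrow> (a * fst m, A.eps a * snd m)
       | Inr b \<Rightarrow> (actA b (fst m), B.eps b * snd m + \<beta> b (fst m)))" for x m
  interpret rep: free_rep sc step
  proof
    fix x and m m' :: "'a \<times> 'k" and c :: 'k
    show "step x (m + m') = step x m + step x m'"
      by (cases x) (simp_all add: step_def distrib_left s)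
    show "step x (sc c m) = sc c (step x m)"
      by (cases x) (simp_all add: step_def sc_def distrib_left s flip: A.scl_mult_right)
  qed (simp_all add: sc_def Avs.scale_right_distrib Avs.scale_left_distrib algebra_simps)
  let ?act = "rep.act"
  have step_simps: "step (Inl a) (m, v) = (a * m, A.eps a * v)"
    "step (Inr b) (m, v) = (actA b m, B.eps b * v + \<beta> b m)"
    "fst (step (Inl a) p) = a * fst p" "fst (step (Inr b) p) = actA b (fst p)" for a b m v p
    by (simp_all add: step_def)
  \<comment> \<open>\<open>Q1\<close> is the annihilator of the module. \<open>Q0\<close> allows in
    addition multiples of the operator \<open>(m, v) \<mapsto> (0, \<epsilon>(m))\<close>, which is
    how the generators of the twisting ideal act.\<close>
  define Q1 where "Q1 = {p. \<forall>m. ?act p m = 0}"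
  define Q0 where "Q0 = {p. \<exists>c. \<forall>m. ?act p m = (0, c * A.eps (fst m))}"
  have Q1: "ideal Q1 free_ring"
    by (rule ideal_free_ringI)
      (simp_all add: Q1_def rep.act_zero rep.act_add rep.act_mult rep.act_zero_right)
  have "Q1 \<subseteq> Q0"
    unfolding Q1_def Q0_def by (auto simp: zero_prod_def intro!: exI[of _ 0])
  \<comment> \<open>Composing \<open>(m, v) \<mapsto> (0, \<epsilon>(m))\<close> with any operator
    of the algebra, on the left by this fact and on the right by \<open>right\<close>, gives a
    multiple of it again. Hence \<open>Q0\<close> is a two-sided ideal.\<close>
  have left: "\<exists>e. \<forall>v. ?act q (0, v) = (0, e * v)" for q
  proof (induction q rule: free_alg_induct)
    case zero
    show ?case by (auto simp: rep.act_zero zero_prod_def intro!: exI[of _ 0])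
  next
    case (step c w p)
    have "\<exists>e. \<forall>v. foldr step w (0, v) = (0, e * v)"
    proof (induction w)
      case Nil
      show ?case by (auto intro!: exI[of _ 1])
    next
      case (Cons x w)
      then obtain e where e: "\<And>v. foldr step w (0, v) = (0, e * v)" by blast
      show ?case
      proof (cases x)
        case (Inl a)
        then show ?thesis using e by (intro exI[of _ "A.eps a * e"]) (simp add: step_simps)
      next
        case (Inr b)
        then show ?thesis using e act_simps(4)[of b 0 0]
          by (intro exI[of _ "B.eps b * e"]) (simp add: step_simps s)
      qed
    qed
    then obtain e where e: "\<And>v. foldr step w (0, v) = (0, e * v)" by blast
    from step obtain d where d: "\<And>v. ?act p (0, v) = (0, d * v)" by blast
    show ?case
      by (rule exI[of _ "c * e + d"])
        (simp add: rep.act_add rep.act_free_scl rep.act_word e d sc_simps distrib_right mult.assoc)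
  qed
  have right: "\<exists>e. \<forall>m. A.eps (fst (?act q m)) = e * A.eps (fst m)" for q
  proof (induction q rule: free_alg_induct)
    case zero
    have "A.eps 0 = 0" using A.eps_scl[of 0 0] by simp
    then show ?case by (auto simp: rep.act_zero intro!: exI[of _ 0])
  next
    case (step c w p)
    have "\<exists>e. \<forall>m. A.eps (fst (foldr step w m)) = e * A.eps (fst m)"
    proof (induction w)
      case Nil
      show ?case by (auto intro!: exI[of _ 1])
    next
      case (Cons x w)
      then obtain e where e: "\<And>m. A.eps (fst (foldr step w m)) = e * A.eps (fst m)" by blast
      show ?case
      proof (cases x)
        case (Inl a)
        then show ?thesis using e by (intro exI[of _ "A.eps a * e"]) (simp add: step_simps)
      next
        case (Inr b)
        then show ?thesis using e by (intro exI[of _ "B.eps b * e"]) (simp add: step_simps)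
      qed
    qed
    then obtain e where e: "\<And>m. A.eps (fst (foldr step w m)) = e * A.eps (fst m)" by blast
    from step obtain d where d: "\<And>m. A.eps (fst (?act p m)) = d * A.eps (fst m)" by blast
    show ?case
      by (rule exI[of _ "c * e + d"])
        (simp add: rep.act_add rep.act_free_scl rep.act_word e d sc_simps distrib_right mult.assoc)
  qed
  have Q0: "ideal Q0 free_ring"
  proof (rule ideal_free_ringI)
    show "0 \<in> Q0"
      using ideal_free_ringD(1)[OF Q1] \<open>Q1 \<subseteq> Q0\<close> by blast
    fix p q
    assume "p \<in> Q0"
    then obtain c where c: "\<And>m. ?act p m = (0, c * A.eps (fst m))" by (auto simp: Q0_def)
    show "p + q \<in> Q0" if q: "q \<in> Q0"
    proof -
      from q obtain d where d: "\<And>m. ?act q m = (0, d * A.eps (fst m))" by (auto simp: Q0_def)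
      show ?thesis
        unfolding Q0_def using c d by (auto simp: rep.act_add distrib_right intro!: exI[of _ "c + d"])
    qed
    show "q * p \<in> Q0"
    proof -
      obtain e where "\<And>v. ?act q (0, v) = (0, e * v)" using left by blast
      then show ?thesis
        unfolding Q0_def using c by (auto simp: rep.act_mult intro!: exI[of _ "e * c"])
    qed
    show "p * q \<in> Q0"
    proof -
      obtain e where "\<And>m. A.eps (fst (?act q m)) = e * A.eps (fst m)" using right by blast
      then show ?thesis
        unfolding Q0_def using c by (auto simp: rep.act_mult intro!: exI[of _ "c * e"])
    qed
  qed
  \<comment> \<open>The relation for a product in \<open>B\<close> is the first cocycle identity
    combined with \<open>actA_mult_left\<close>; the relation for the unit of \<open>B\<close> needs
    that \<open>\<beta>\<close> vanishes on \<open>1\<close>.\<close>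
  have rel: "free_product_relations A B \<subseteq> Q1"
    unfolding free_product_relations_def Q1_def
    by (auto simp: rep.act_diff rep.act_add rep.act_free_scl rep.act_mult rep.act_gen rep.act_one
      step_simps sc_simps s \<beta>1 co1 distrib_right distrib_left mult.assoc zero_prod_def simp flip: A.scl_mult_left)
  \<comment> \<open>In the first coordinate \<open>actA_mult_right\<close> makes both terms cancel.
    In the second one \<open>\<beta>(b, am) - \<beta>(actB b a, m)\<close> remains, which is
    \<open>\<beta>(b, a) \<epsilon>(m)\<close> by the second cocycle identity.\<close>
  have gen: "?act (genB b * genA a - (\<Sum>(x, y)\<leftarrow>ps. genA x * genB y)) (m, v) = (0, \<beta> b a * A.eps m)"
    if ps: "tw b a = (\<Sum>(x, y)\<leftarrow>ps. pure A B x y)" for a b ps m v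
  proof -
    have sub: "set ps \<subseteq> elems A \<times> elems B" by auto
    note Ls = tensor_lift_sum_list[OF A.is_subspace B.is_subspace _ _ sub, folded ps]
    have bilk: "bilinear_map A B (*) (\<lambda>x y. A.eps x * f y)" if "linear_on B (*) f" for f
      using that by (simp add: bilinear_map_def linear_on_def algebra_simps)
    have l1: "linear_on B (*) B.eps" and l2: "linear_on B (*) (\<lambda>y. \<beta> y m)"
      by (simp_all add: linear_on_def s)
    have "?act (\<Sum>(x, y)\<leftarrow>ps. genA x * genB y) (m, v) =
      (\<Sum>(x, y)\<leftarrow>ps. (x * actA y m, A.eps x * (B.eps y * v + \<beta> y m)))"
      by (simp add: rep.act_sum_list case_prod_unfold rep.act_mult rep.act_gen step_simps)
    also have "\<dots> = (\<Sum>(x, y)\<leftarrow>ps. x * actA y m, (\<Sum>(x, y)\<leftarrow>ps. A.eps x * B.eps y) * v + (\<Sum>(x, y)\<leftarrow>ps. A.eps x * \<beta> y m))"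
      by (induction ps) (auto simp: zero_prod_def algebra_simps)
    also have "\<dots> = (actA b (a * m), B.eps b * A.eps a * v + \<beta> (actB b a) m)"
      unfolding Ls[OF A.is_vector_space bilinear_mult_actA, symmetric] Ls[OF vector_space_times bilk[OF l1], symmetric]
        Ls[OF vector_space_times bilk[OF l2], symmetric]
      by (simp add: actA_mult_right L_form[OF l1] L_form[OF l2])
    finally show ?thesis
      by (simp add: rep.act_diff rep.act_mult rep.act_gen step_simps co2)
  qed
  from quad obtain S where S: "S \<subseteq> free_product_homog A B 2" "twisting_ideal A B \<tau> = Idl\<^bsub>free_product A B\<^esub> S"
    by (auto simp: tau_quadratic_def)
  let ?c = "free_product_class A B"
  let ?G = "{?c (genB b) \<otimes>\<^bsub>free_product A B\<^esub> ?c (genA a)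
        \<ominus>\<^bsub>free_product A B\<^esub> tensor_to_free_product A B (tw b a) | a b.
      a \<in> elems A \<and> b \<in> elems B}"
  have list: "\<exists>ps. tw b a = (\<Sum>(x, y)\<leftarrow>ps. pure A B x y) \<and>
    ?c (genB b) \<otimes>\<^bsub>free_product A B\<^esub> ?c (genA a) \<ominus>\<^bsub>free_product A B\<^esub> tensor_to_free_product A B (tw b a)
     = ?c (genB b * genA a - (\<Sum>(x, y)\<leftarrow>ps. genA x * genB y))" for b a
  proof -
    obtain ps where ps: "set ps \<subseteq> elems A \<times> elems B" "tw b a = (\<Sum>(x, y)\<leftarrow>ps. pure A B x y)"
      by (rule tensor_list[OF A.is_subspace B.is_subspace tw_mem])
    then show ?thesis using twisting_generator_class[OF A.is_subspace B.is_subspace ps(1)] by metis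
  qed
  have Gcar: "?G \<subseteq> carrier (free_product A B)"
    unfolding carrier_free_product using list by blast
  have Scar: "S \<subseteq> carrier (free_product A B)"
    using S(1) unfolding free_product_homog_def carrier_free_product by blast
  have GQ0: "q \<in> Q0" if q: "?c q \<in> ?G" for q
  proof -
    from q list obtain b a ps where ps: "tw b a = (\<Sum>(x, y)\<leftarrow>ps. pure A B x y)"
      "?c q = ?c (genB b * genA a - (\<Sum>(x, y)\<leftarrow>ps. genA x * genB y))" by blast
    let ?r = "genB b * genA a - (\<Sum>(x, y)\<leftarrow>ps. genA x * genB y)"
    have "?r \<in> Q0"
      unfolding Q0_def using gen[OF ps(1)] by (auto intro!: exI[of _ "\<beta> b a"])
    moreover have "q - ?r \<in> Q1"
      using ps(2) free_product_ideal_minimal[OF Q1 rel] by (auto simp: free_product_class_eq_iff)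
    ultimately show ?thesis
      using \<open>Q1 \<subseteq> Q0\<close> ideal_free_ringD(2)[OF Q0, of "q - ?r" ?r] by auto
  qed
  \<comment> \<open>An element of \<open>S\<close> lies in the twisting ideal and thus in
    \<open>Q0\<close>, so it acts through a single scalar \<open>c\<close>, readable off its value
    at \<open>(1, 0)\<close>. Words of degree 2 applied to \<open>(1, 0)\<close> evaluate
    \<open>\<beta>\<close> only in degrees at most 2, below \<open>n\<close>, so the second
    coordinate stays 0 and \<open>c = 0\<close>.\<close>
  have SQ1: "q \<in> Q1" if q: "?c q \<in> S" for q
  proof -
    from q S(1) obtain p where p: "?c q = ?c p"
      "p \<in> free_vs.span {word xs | xs. \<exists>ds. list_all2 (letter_homog A B) xs ds \<and> sum_list ds = 2}"
      unfolding free_product_homog_def by blast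
    have "?c p \<in> Idl\<^bsub>free_product A B\<^esub> ?G"
      using q p(1) S(2) ring.genideal_self[OF ring_free_product Scar]
      unfolding twisting_ideal_def by auto
    then have "p \<in> Q0"
      using \<open>Q1 \<subseteq> Q0\<close> rel by (intro mem_ideal_of_class_mem_genideal[OF Q0 _ Gcar GQ0]) auto
    then obtain c where c: "\<And>m. ?act p m = (0, c * A.eps (fst m))" by (auto simp: Q0_def)
    have words: "\<exists>m\<in>homog A (sum_list ds). foldr step xs (1, 0) = (m, 0)"
      if "list_all2 (letter_homog A B) xs ds" "sum_list ds \<le> 2" for xs ds
      using that
    proof (induction rule: list_all2_induct)
      case Nil
      show ?case using A.homog_one by simp
    next
      case (Cons x xs d ds)
      then obtain m where m: "m \<in> homog A (sum_list ds)" "foldr step xs (1, 0) = (m, 0)" by auto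
      show ?case
      proof (cases x)
        case (Inl a)
        then show ?thesis using m Cons A.homog_mult[of a d m] by (simp add: step_simps)
      next
        case (Inr b)
        then show ?thesis using m Cons actA_homog[of b d m] \<beta>deg[of b d m "sum_list ds"] n
          by (simp add: step_simps)
      qed
    qed
    have "snd (?act p (1, 0)) = 0"
      using p(2)
    proof (induction rule: free_vs.span_induct_alt)
      case base
      show ?case by (simp add: rep.act_zero)
    next
      case (step c x y)
      then obtain xs ds where "x = word xs" "list_all2 (letter_homog A B) xs ds" "sum_list ds = 2" by blast
      with words[of xs ds] step show ?case
        by (auto simp: rep.act_add rep.act_free_scl rep.act_word sc_simps)
    qed
    then have "c = 0" using c[of "(1, 0)"] by simp
    then have "p \<in> Q1" using c by (simp add: Q1_def zero_prod_def)
    moreover have "q - p \<in> Q1"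
      using p(1) free_product_ideal_minimal[OF Q1 rel] by (auto simp: free_product_class_eq_iff)
    ultimately show ?thesis
      using ideal_free_ringD(2)[OF Q1, of "q - p" p] by simp
  qed
  obtain ps where ps: "tw b a = (\<Sum>(x, y)\<leftarrow>ps. pure A B x y)"
    "?c (genB b) \<otimes>\<^bsub>free_product A B\<^esub> ?c (genA a) \<ominus>\<^bsub>free_product A B\<^esub> tensor_to_free_product A B (tw b a)
     = ?c (genB b * genA a - (\<Sum>(x, y)\<leftarrow>ps. genA x * genB y))"
    using list by blast
  let ?r = "genB b * genA a - (\<Sum>(x, y)\<leftarrow>ps. genA x * genB y)"
    and ?g = "?c (genB b) \<otimes>\<^bsub>free_product A B\<^esub> ?c (genA a) \<ominus>\<^bsub>free_product A B\<^esub> tensor_to_free_product A B (tw b a)"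
  have "?g \<in> ?G" by auto
  then have "?g \<in> twisting_ideal A B \<tau>"
    unfolding twisting_ideal_def using ring.genideal_self[OF ring_free_product Gcar] by blast
  then have "?c ?r \<in> Idl\<^bsub>free_product A B\<^esub> S"
    unfolding S(2) ps(2) .
  then have "?r \<in> Q1"
    by (intro mem_ideal_of_class_mem_genideal[OF Q1 rel Scar SQ1])
  then show ?thesis
    using gen[OF ps(1), of 1 0] by (auto simp: Q1_def zero_prod_def)
qed

end

section \<open>Cocycles from extensions and from ideals\<close>

lemma linear_on_of_linear:
  assumes "Vector_Spaces.linear (scl V) s g"
  shows "linear_on V s g"
proof -
  interpret Vector_Spaces.linear "scl V" s g by fact
  show ?thesis by (simp add: linear_on_def add scale)
qed

text \<open>A basis of \<open>J\<close> stays independent when \<open>x\<close> is added, so the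
  values 0 on the basis and 1 at \<open>x\<close> may be prescribed.\<close>

lemma separating_functional:
  fixes s :: "'k::field \<Rightarrow> 'v::ab_group_add \<Rightarrow> 'v"
  assumes "vector_space s" "module.subspace s J" "x \<notin> J"
  obtains \<phi> where "Vector_Spaces.linear s (*) \<phi>" "\<And>y. y \<in> J \<Longrightarrow> \<phi> y = 0" "\<phi> x = 1"
proof -
  interpret vector_space_pair s "(*) :: 'k \<Rightarrow> 'k \<Rightarrow> 'k"
    using assms(1) vector_space_times by (rule vector_space_pair.intro)
  obtain C where C: "C \<subseteq> J" "vs1.independent C" "J \<subseteq> vs1.span C"
    by (rule vs1.basis_exists[of J])
  then have span: "vs1.span C = J"
    using vs1.span_minimal[OF C(1) assms(2)] by (intro subset_antisym)
  with assms(3) have "vs1.independent (insert x C)"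
    using C(2) by (intro vs1.independent_insertI) simp_all
  from linear_independent_extend[OF this, of "\<lambda>y. if y = x then 1 else 0"]
  obtain \<phi> where \<phi>: "Vector_Spaces.linear s (*) \<phi>"
    and \<phi>_eq: "\<And>y. y \<in> insert x C \<Longrightarrow> \<phi> y = (if y = x then 1 else 0)"
    by blast
  have "\<phi> y = 0" if "y \<in> C" for y
    using \<phi>_eq[of y] that C(1) assms(3) by auto
  then have "\<phi> y = 0" if "y \<in> J" for y
    using linear_eq_0_on_span[OF \<phi>, of C] span that by blast
  then show thesis
    using that[OF \<phi>] \<phi>_eq[of x] by simp
qed

context twisted_pair
begin

text \<open>The part of the integrand that depends on the leg in \<open>B\<close> only through its
  augmentation can be evaluated outside the lift, at \<open>projA z\<close>. This produces the term
  with \<open>actA\<close> in both constructions of cocycles below.\<close>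

lemma L_add_projA:
  assumes g: "linear_on A (*) g" and P: "bilinear_map A B (*) P" and R: "bilinear_map A B (*) R"
    and eq: "\<And>x y i j. x \<in> homog A i \<Longrightarrow> y \<in> homog B j \<Longrightarrow> i + j = m \<Longrightarrow> P x y = R x y + B.eps y * g x"
    and z: "z \<in> homog (tensor A B) m"
  shows "L P z = L R z + g (projA z)"
proof -
  note vs = vector_space_times
  have ze: "z \<in> elems (tensor A B)" using z homog_tensor_sub[OF homog_scalable_A homog_scalable_B] by blast
  have bil: "bilinear_map A B (*) (\<lambda>x y. g (scl A (B.eps y) x))"
    by (rule bilinear_map_comp_linear[OF bilinear_projA _ g]) simp
  have "L P z = L (\<lambda>x y. R x y + g (scl A (B.eps y) x)) z"
    using g by (intro L_homog_cong[OF P bilinear_map_add[OF vs R bil] vs _ z]) (simp add: eq linear_on_def)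
  also have "\<dots> = L R z + L (\<lambda>x y. g (scl A (B.eps y) x)) z"
    by (rule tensor_lift_add[OF A.is_subspace B.is_subspace vs R bil ze])
  also have "L (\<lambda>x y. g (scl A (B.eps y) x)) z = g (projA z)"
    unfolding projA_def by (rule L_comm[OF bilinear_projA _ A.is_subspace vs g ze, symmetric]) simp
  finally show ?thesis .
qed

lemma L_add_projB:
  assumes g: "linear_on B (*) g" and P: "bilinear_map A B (*) P" and R: "bilinear_map A B (*) R"
    and eq: "\<And>x y i j. x \<in> homog A i \<Longrightarrow> y \<in> homog B j \<Longrightarrow> i + j = m \<Longrightarrow> P x y = R x y + A.eps x * g y"
    and z: "z \<in> homog (tensor A B) m"
  shows "L P z = L R z + g (projB z)"
proof -
  note vs = vector_space_times
  have ze: "z \<in> elems (tensor A B)" using z homog_tensor_sub[OF homog_scalable_A homog_scalable_B] by blast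
  have bil: "bilinear_map A B (*) (\<lambda>x y. g (scl B (A.eps x) y))"
    by (rule bilinear_map_comp_linear[OF bilinear_projB _ g]) simp
  have "L P z = L (\<lambda>x y. R x y + g (scl B (A.eps x) y)) z"
    using g by (intro L_homog_cong[OF P bilinear_map_add[OF vs R bil] vs _ z]) (simp add: eq linear_on_def)
  also have "\<dots> = L R z + L (\<lambda>x y. g (scl B (A.eps x) y)) z"
    by (rule tensor_lift_add[OF A.is_subspace B.is_subspace vs R bil ze])
  also have "L (\<lambda>x y. g (scl B (A.eps x) y)) z = g (projB z)"
    unfolding projB_def by (rule L_comm[OF bilinear_projB _ B.is_subspace vs g ze, symmetric]) simp
  finally show ?thesis .
qed

lemma linear_on_form:
  assumes "bilinear_map B A (*) f"
  shows "linear_on A (*) (f b)" "linear_on B (*) (\<lambda>b. f b a)"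
  using assms by (simp_all add: bilinear_map_def linear_on_def)

lemma bilinear_functional_twist:
  assumes "graded_linear (tensor B A) (tensor A B) t" "linear_on (tensor A B) (*) \<phi>"
  shows "bilinear_map B A (*) (\<lambda>b a. \<phi> (t (pure B A b a)))"
    "bilinear_map A B (*) (\<lambda>x y. \<phi> (ract (t (pure B A b x)) y))"
    "bilinear_map A B (*) (\<lambda>x y. \<phi> (lact x (t (pure B A y a))))"
  using assms(2) bilinear_ract_twist[OF assms(1)] bilinear_lact_twist[OF assms(1)] graded_linear_simps[OF assms(1)] graded_linear_mem[OF assms(1)]
  by (simp_all add: bilinear_map_def linear_on_def scl_tensor pure_simps)

text \<open>Compare the one-sided identities of \<open>t\<close> and \<open>\<tau>\<close>.
  Positivity of the outer degree puts the first twist below degree \<open>n\<close>, where both maps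
  agree; the second twist differs only when it uses the full degree \<open>n\<close>, which leaves
  degree 0 for the remaining leg.\<close>

lemma cocycle_of_extension:
  assumes t: "graded_linear (tensor B A) (tensor A B) t" and tt: "twisting_to_degree A B n t"
    and agree: "\<And>i z. i < n \<Longrightarrow> z \<in> homog (tensor B A) i \<Longrightarrow> t z = \<tau> z"
    and \<phi>: "linear_on (tensor A B) (*) \<phi>"
  shows "cocycle n (bitrunc n (\<lambda>b a. \<phi> (t (pure B A b a)) - \<phi> (tw b a)))" (is "cocycle n (bitrunc n ?f)")
proof -
  note vs = vector_space_times
  have f: "bilinear_map B A (*) ?f"
    by (rule bilinear_map_diff[OF bilinear_functional_twist(1)[OF t \<phi>] bilinear_functional_twist(1)[OF tau_graded_linear \<phi>]])
  note s = form_simps[OF f]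
  have agree': "t (pure B A b a) = tw b a" if "b \<in> homog B k" "a \<in> homog A l" "k + l < n" for b a k l
    using agree[OF that(3) pure_in_homog[OF that(1,2) refl]] .
  have \<phi>s: "\<phi> (tensor_scl c z) = c * \<phi> z" if "z \<in> elems (tensor A B)" for c z
    using \<phi> that by (simp add: linear_on_def scl_tensor)
  show ?thesis
  proof (rule cocycle_bitrunc[OF f])
    show "?f 1 a = 0" if "a \<in> homog A n" for a
      using tt that by (auto simp: twisting_to_degree_def)
    show "?f b 1 = 0" if "b \<in> homog B n" for b
      using tt that by (auto simp: twisting_to_degree_def)
  next
    fix b b' a k l m
    assume b: "b \<in> homog B k" and b': "b' \<in> homog B l" and a: "a \<in> homog A m" and n: "k + l + m = n" "k > 0"
    have t1: "\<phi> (L (\<lambda>x y. ract (t' (pure B A b x)) y) (tw b' a)) = L (\<lambda>x y. \<phi> (ract (t' (pure B A b x)) y)) (tw b' a)"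
      if "graded_linear (tensor B A) (tensor A B) t'" for t'
      using bilinear_ract_twist[OF that] by (intro L_comm[OF _ _ T vs \<phi>]) (simp_all add: scl_tensor graded_linear_mem[OF that])
    have "\<phi> (t (pure B A (b * b') a)) = L (\<lambda>x y. \<phi> (ract (t (pure B A b x)) y)) (tw b' a)"
      using twisting_mult_left[OF t tt b b' a] t1[OF t] agree'[OF b' a] n by simp
    also have "\<dots> = L (\<lambda>x y. \<phi> (ract (tw b x) y)) (tw b' a) + ?f b (projA (tw b' a))"
    proof (rule L_add_projA[OF linear_on_form(1)[OF f] bilinear_functional_twist(2)[OF t \<phi>] bilinear_functional_twist(2)[OF tau_graded_linear \<phi>] _ tw_homog[OF b' a refl]])
      fix x y i j assume xy: "x \<in> homog A i" "y \<in> homog B j" "i + j = l + m"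
      show "\<phi> (ract (t (pure B A b x)) y) = \<phi> (ract (tw b x) y) + B.eps y * ?f b x"
      proof (cases "j = 0")
        case True
        then have "y \<in> homog B 0" using xy by simp
        then show ?thesis by (simp add: ract_degree_zero graded_linear_mem[OF t] \<phi>s right_diff_distrib)
      next
        case False
        then show ?thesis using B.eps_pos[OF xy(2)] agree'[OF b xy(1)] xy n by simp
      qed
    qed
    also have "L (\<lambda>x y. \<phi> (ract (tw b x) y)) (tw b' a) = \<phi> (tw (b * b') a)"
      unfolding tw_mult_left[OF b b' a] by (rule t1[OF tau_graded_linear, symmetric])
    finally show "?f (b * b') a = ?f b (actA b' a)" by (simp add: actA_def)
  next
    fix b a a' k l m
    assume b: "b \<in> homog B k" and a: "a \<in> homog A l" and a': "a' \<in> homog A m" and n: "k + l + m = n" "m > 0"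
    have t1: "\<phi> (L (\<lambda>x y. lact x (t' (pure B A y a'))) (tw b a)) = L (\<lambda>x y. \<phi> (lact x (t' (pure B A y a')))) (tw b a)"
      if "graded_linear (tensor B A) (tensor A B) t'" for t'
      using bilinear_lact_twist[OF that] by (intro L_comm[OF _ _ T vs \<phi>]) (simp_all add: scl_tensor graded_linear_mem[OF that])
    have "\<phi> (t (pure B A b (a * a'))) = L (\<lambda>x y. \<phi> (lact x (t (pure B A y a')))) (tw b a)"
      using twisting_mult_right[OF t tt b a a'] t1[OF t] agree'[OF b a] n by simp
    also have "\<dots> = L (\<lambda>x y. \<phi> (lact x (tw y a'))) (tw b a) + ?f (projB (tw b a)) a'"
    proof (rule L_add_projB[OF linear_on_form(2)[OF f] bilinear_functional_twist(3)[OF t \<phi>] bilinear_functional_twist(3)[OF tau_graded_linear \<phi>] _ tw_homog[OF b a refl]])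
      fix x y i j assume xy: "x \<in> homog A i" "y \<in> homog B j" "i + j = k + l"
      show "\<phi> (lact x (t (pure B A y a'))) = \<phi> (lact x (tw y a')) + A.eps x * ?f y a'"
      proof (cases "i = 0")
        case True
        then have "x \<in> homog A 0" using xy by simp
        then show ?thesis by (simp add: lact_degree_zero graded_linear_mem[OF t] \<phi>s right_diff_distrib)
      next
        case False
        then show ?thesis using A.eps_pos[OF xy(1)] agree'[OF xy(2) a'] xy n by simp
      qed
    qed
    also have "L (\<lambda>x y. \<phi> (lact x (tw y a'))) (tw b a) = \<phi> (tw b (a * a'))"
      unfolding tw_mult_right[OF b a a'] by (rule t1[OF tau_graded_linear, symmetric])
    finally show "?f b (a * a') = ?f (actB b a) a'" by (simp add: actB_def)
  qed
qed

section \<open>Linear forms that vanish on an ideal containing the relations\<close>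

definition annihilates :: "(('k, 'a, 'b) free_alg \<Rightarrow> 'k) \<Rightarrow> ('k, 'a, 'b) free_alg set \<Rightarrow> bool" where
  "annihilates h J \<longleftrightarrow> Vector_Spaces.linear free_scl (*) h \<and> (\<forall>p\<in>J. h p = 0)"

text \<open>The value of \<open>h\<close> at the image of a tensor under \<open>a \<otimes> b \<mapsto> ab\<close>.\<close>

abbreviation normal_value :: "(('k, 'a, 'b) free_alg \<Rightarrow> 'k) \<Rightarrow> ('k, 'a, 'b) tensor \<Rightarrow> 'k" where
  "normal_value h \<equiv> L (\<lambda>x y. h (genA x * genB y))"

text \<open>The value of \<open>h\<close> at \<open>ba - \<tau>(b \<otimes> a)\<close>, written
  without a choice of presentation of the tensor, so that it is bilinear in \<open>b\<close> and
  \<open>a\<close> as soon as \<open>h\<close> respects the relations.\<close>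

definition defect :: "(('k, 'a, 'b) free_alg \<Rightarrow> 'k) \<Rightarrow> 'b \<Rightarrow> 'a \<Rightarrow> 'k" where
  "defect h b a = h (genB b * genA a) - normal_value h (tw b a)"

context
  fixes J :: "('k, 'a, 'b) free_alg set"
  assumes J: "ideal J free_ring" and relJ: "free_product_relations A B \<subseteq> J"
begin

text \<open>Allows a relation of lower degree to be applied inside a longer product: its defect is
  taken with respect to the form with the outer factors built in.\<close>

lemma annihilates_mult:
  assumes "annihilates h J"
  shows "annihilates (\<lambda>p. h (u * p * w)) J"
proof -
  interpret h: Vector_Spaces.linear free_scl "(*)" h using assms by (simp add: annihilates_def)
  have "Vector_Spaces.linear free_scl (*) (\<lambda>p. h (u * p * w))"
    by unfold_locales (simp_all add: distrib_left distrib_right mult_free_scl free_scl_mult h.add h.scale)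
  then show ?thesis
    using assms ideal_free_ringD(3,4)[OF J] by (simp add: annihilates_def)
qed

lemma annihilates_eq:
  assumes "annihilates h J" "p - q \<in> J"
  shows "h p = h q"
proof -
  interpret h: Vector_Spaces.linear free_scl "(*)" h using assms by (simp add: annihilates_def)
  show ?thesis using assms h.diff[of p q] by (simp add: annihilates_def)
qed

lemma annihilates_simps:
  assumes "annihilates h J"
  shows "h (u * genA (x + x') * w) = h (u * genA x * w) + h (u * genA x' * w)"
    "h (u * genA (scl A c x) * w) = c * h (u * genA x * w)"
    "h (u * genA (x * x') * w) = h (u * (genA x * genA x') * w)"
    "h (u * genA 1 * w) = h (u * w)"
    "h (u * genB (y + y') * w) = h (u * genB y * w) + h (u * genB y' * w)"
    "h (u * genB (scl B c y) * w) = c * h (u * genB y * w)"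
    "h (u * genB (y * y') * w) = h (u * (genB y * genB y') * w)"
    "h (u * genB 1 * w) = h (u * w)"
proof -
  interpret h: Vector_Spaces.linear free_scl "(*)" h using assms by (simp add: annihilates_def)
  note e = annihilates_eq[OF annihilates_mult[OF assms, of u w] subsetD[OF relJ]]
  have "h (u * genA (x + x') * w) = h (u * (genA x + genA x') * w)"
    "h (u * genB (y + y') * w) = h (u * (genB y + genB y') * w)"
    "h (u * genA (scl A c x) * w) = h (u * free_scl c (genA x) * w)"
    "h (u * genB (scl B c y) * w) = h (u * free_scl c (genB y) * w)"
    "h (u * genA 1 * w) = h (u * 1 * w)" "h (u * genB 1 * w) = h (u * 1 * w)"
    by (rule e, unfold free_product_relations_def, blast)+
  then show "h (u * genA (x + x') * w) = h (u * genA x * w) + h (u * genA x' * w)"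
    "h (u * genA (scl A c x) * w) = c * h (u * genA x * w)"
    "h (u * genA 1 * w) = h (u * w)"
    "h (u * genB (y + y') * w) = h (u * genB y * w) + h (u * genB y' * w)"
    "h (u * genB (scl B c y) * w) = c * h (u * genB y * w)"
    "h (u * genB 1 * w) = h (u * w)"
    by (simp_all add: distrib_left distrib_right mult_free_scl free_scl_mult h.add h.scale)
  show "h (u * genA (x * x') * w) = h (u * (genA x * genA x') * w)"
    "h (u * genB (y * y') * w) = h (u * (genB y * genB y') * w)"
    by (rule e, unfold free_product_relations_def, blast)+
qed

lemma bilinear_annihilates:
  assumes "annihilates h J"
  shows "bilinear_map A B (*) (\<lambda>x y. h (genA x * genB y))" "bilinear_map B A (*) (\<lambda>y x. h (genB y * genA x))"
  using annihilates_simps(1,2,5,6)[OF assms, where u = 1] annihilates_simps(1,2,5,6)[OF assms, where w = 1]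
  by (simp_all add: bilinear_map_def)

lemma normal_value_linear: "annihilates h J \<Longrightarrow> linear_on (tensor A B) (*) (normal_value h)"
  by (rule L_linear[OF vector_space_times bilinear_annihilates(1)])

lemma normal_value_pure: "annihilates h J \<Longrightarrow> normal_value h (pure A B x y) = h (genA x * genB y)"
  by (rule L_pure[OF vector_space_times bilinear_annihilates(1)])

lemma bilinear_defect: "annihilates h J \<Longrightarrow> bilinear_map B A (*) (defect h)"
  unfolding defect_def[abs_def]
  by (intro bilinear_map_diff bilinear_annihilates(2) bilinear_functional_twist(1)[OF tau_graded_linear] normal_value_linear)

lemma defect_unit:
  assumes "annihilates h J"
  shows "defect h 1 a = 0" "defect h b 1 = 0"
  unfolding defect_def
  using annihilates_simps(4,8)[OF assms, where u = 1] annihilates_simps(4,8)[OF assms, where w = 1]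
  by (simp_all add: normal_value_pure[OF assms])

text \<open>Reorder \<open>b b' a\<close> under \<open>h\<close> in two stages. Moving
  \<open>b'\<close> past \<open>a\<close> costs the defect of \<open>p \<mapsto> h (b p)\<close> in
  a degree below \<open>n\<close>, hence nothing. Moving \<open>b\<close> past the resulting
  \<open>x\<close> costs nothing either unless \<open>y\<close> has degree 0, where the defect of
  \<open>h\<close> in degree \<open>n\<close> remains. The result is compared with the direct
  reordering of \<open>bb'\<close> and \<open>a\<close>; the other identity is the mirror
  image.\<close>

lemma cocycle_of_ideal:
  assumes low: "\<And>h b a k l. annihilates h J \<Longrightarrow> b \<in> homog B k \<Longrightarrow> a \<in> homog A l \<Longrightarrow> k + l < n \<Longrightarrow> defect h b a = 0"
    and h: "annihilates h J"
  shows "cocycle n (bitrunc n (defect h))"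
proof -
  note vs = vector_space_times
  note f = bilinear_defect[OF h] and K = normal_value_linear[OF h]
  have Ks: "normal_value h (tensor_scl c z) = c * normal_value h z" if "z \<in> elems (tensor A B)" for c z
    using K that by (simp add: linear_on_def scl_tensor)
  show ?thesis
  proof (rule cocycle_bitrunc[OF f])
    show "defect h 1 a = 0" "defect h b 1 = 0" for a b by (rule defect_unit[OF h])+
  next
    fix b b' a k l m
    assume b: "b \<in> homog B k" and b': "b' \<in> homog B l" and a: "a \<in> homog A m" and n: "k + l + m = n" "k > 0"
    note h1 = annihilates_mult[OF h, of "genB b" 1, simplified]
    have "h (genB (b * b') * genA a) = h (genB b * (genB b' * genA a))"
      using annihilates_simps(7)[OF h, of 1] by (simp add: mult.assoc)
    also have "\<dots> = normal_value (\<lambda>p. h (genB b * p)) (tw b' a)"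
      using low[OF h1 b' a] n by (simp add: defect_def)
    also have "\<dots> = L (\<lambda>x y. normal_value h (ract (tw b x) y)) (tw b' a) + defect h b (projA (tw b' a))"
    proof (rule L_add_projA[OF linear_on_form(1)[OF f] bilinear_annihilates(1)[OF h1] bilinear_functional_twist(2)[OF tau_graded_linear K] _ tw_homog[OF b' a refl]])
      fix x y i j assume xy: "x \<in> homog A i" "y \<in> homog B j" "i + j = l + m"
      show "h (genB b * (genA x * genB y)) = normal_value h (ract (tw b x) y) + B.eps y * defect h b x"
      proof (cases "j = 0")
        case True
        then have y: "y \<in> homog B 0" using xy by simp
        have "h (genB b * (genA x * genB y)) = B.eps y * h (genB b * genA x)"
          using annihilates_simps(6)[OF h, of "genB b * genA x" _ _ 1] annihilates_simps(8)[OF h, of "genB b * genA x" 1]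
          by (subst B.homog_zero_eq[OF y]) (simp add: mult.assoc)
        then show ?thesis by (simp add: ract_degree_zero[OF y] Ks defect_def right_diff_distrib)
      next
        case False
        \<comment> \<open>As \<open>y\<close> has positive degree, \<open>b\<close> and
          \<open>x\<close> have total degree below \<open>n\<close>, so the defect of
          \<open>p \<mapsto> h (p y)\<close> at this pair is zero.\<close>
        note h2 = annihilates_mult[OF h, of 1 "genB y", simplified]
        have "h (genB b * (genA x * genB y)) = normal_value (\<lambda>p. h (p * genB y)) (tw b x)"
          using low[OF h2 b xy(1)] False xy n by (simp add: defect_def mult.assoc)
        also have "\<dots> = L (\<lambda>u v. normal_value h (pure A B u (v * y))) (tw b x)"
          using annihilates_simps(7)[OF h, of _ _ _ 1] by (simp add: normal_value_pure[OF h] mult.assoc)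
        also have "\<dots> = normal_value h (ract (tw b x) y)"
          unfolding ract_def
          by (rule L_comm[OF _ _ T vs K, symmetric]) (simp_all add: scl_tensor bilinear_ract_pure)
        finally show ?thesis using B.eps_pos[OF xy(2)] False by simp
      qed
    qed
    also have "L (\<lambda>x y. normal_value h (ract (tw b x) y)) (tw b' a) = normal_value h (tw (b * b') a)"
      unfolding tw_mult_left[OF b b' a]
      by (rule L_comm[OF _ _ T vs K, symmetric]) (simp_all add: scl_tensor bilinear_ract_twist[OF tau_graded_linear])
    finally show "defect h (b * b') a = defect h b (actA b' a)" by (simp add: actA_def defect_def)
  next
    fix b a a' k l m
    assume b: "b \<in> homog B k" and a: "a \<in> homog A l" and a': "a' \<in> homog A m" and n: "k + l + m = n" "m > 0"
    note h1 = annihilates_mult[OF h, of 1 "genA a'", simplified]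
    have "h (genB b * genA (a * a')) = h (genB b * genA a * genA a')"
      using annihilates_simps(3)[OF h, of _ _ _ 1] by (simp add: mult.assoc)
    also have "\<dots> = normal_value (\<lambda>p. h (p * genA a')) (tw b a)"
      using low[OF h1 b a] n by (simp add: defect_def)
    also have "\<dots> = L (\<lambda>x y. normal_value h (lact x (tw y a'))) (tw b a) + defect h (projB (tw b a)) a'"
    proof (rule L_add_projB[OF linear_on_form(2)[OF f] bilinear_annihilates(1)[OF h1] bilinear_functional_twist(3)[OF tau_graded_linear K] _ tw_homog[OF b a refl]])
      fix x y i j assume xy: "x \<in> homog A i" "y \<in> homog B j" "i + j = k + l"
      show "h (genA x * genB y * genA a') = normal_value h (lact x (tw y a')) + A.eps x * defect h y a'"
      proof (cases "i = 0")
        case True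
        then have x: "x \<in> homog A 0" using xy by simp
        have "h (genA x * genB y * genA a') = A.eps x * h (genB y * genA a')"
          using annihilates_simps(2)[OF h, of 1] annihilates_simps(4)[OF h, of 1]
          by (subst A.homog_zero_eq[OF x]) (simp add: mult.assoc)
        then show ?thesis by (simp add: lact_degree_zero[OF x] Ks defect_def right_diff_distrib)
      next
        case False
        note h2 = annihilates_mult[OF h, of "genA x" 1, simplified]
        have "h (genA x * genB y * genA a') = normal_value (\<lambda>p. h (genA x * p)) (tw y a')"
          using low[OF h2 xy(2) a'] False xy n by (simp add: defect_def mult.assoc)
        also have "\<dots> = L (\<lambda>u v. normal_value h (pure A B (x * u) v)) (tw y a')"
          using annihilates_simps(3)[OF h, of 1] by (simp add: normal_value_pure[OF h] mult.assoc)
        also have "\<dots> = normal_value h (lact x (tw y a'))"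
          unfolding lact_def
          by (rule L_comm[OF _ _ T vs K, symmetric]) (simp_all add: scl_tensor bilinear_lact_pure)
        finally show ?thesis using A.eps_pos[OF xy(1)] False by simp
      qed
    qed
    also have "L (\<lambda>x y. normal_value h (lact x (tw y a'))) (tw b a) = normal_value h (tw b (a * a'))"
      unfolding tw_mult_right[OF b a a']
      by (rule L_comm[OF _ _ T vs K, symmetric]) (simp_all add: scl_tensor bilinear_lact_twist[OF tau_graded_linear])
    finally show "defect h b (a * a') = defect h (actB b a) a'" by (simp add: actB_def defect_def)
  qed
qed

text \<open>An element outside \<open>J\<close> is detected by a form that vanishes on
  \<open>J\<close>. This translates the statement on forms, where the induction takes place, back
  into ideal membership.\<close>

lemma defect_zero_iff:
  assumes ps: "tw b a = (\<Sum>(x, y)\<leftarrow>ps. pure A B x y)"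
  shows "(\<forall>h. annihilates h J \<longrightarrow> defect h b a = 0) \<longleftrightarrow> genB b * genA a - (\<Sum>(x, y)\<leftarrow>ps. genA x * genB y) \<in> J"
proof -
  let ?r = "genB b * genA a - (\<Sum>(x, y)\<leftarrow>ps. genA x * genB y)"
  have eq: "defect h b a = h ?r" if h: "annihilates h J" for h
  proof -
    interpret h: Vector_Spaces.linear free_scl "(*)" h using h by (simp add: annihilates_def)
    have "normal_value h (tw b a) = (\<Sum>(x, y)\<leftarrow>ps. h (genA x * genB y))"
      unfolding ps by (rule tensor_lift_sum_list[OF A.is_subspace B.is_subspace vector_space_times bilinear_annihilates(1)[OF h]]) auto
    also have "\<dots> = h (\<Sum>(x, y)\<leftarrow>ps. genA x * genB y)"
      by (induction ps) (auto simp: h.add h.zero)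
    finally show ?thesis by (simp add: defect_def h.diff)
  qed
  have sub: "module.subspace free_scl J"
    using ideal_free_ringD[OF J] by (simp add: free_vs.subspace_def)
  have "\<exists>h. annihilates h J \<and> h ?r = 1" if "?r \<notin> J"
    by (rule separating_functional[OF vector_space_free_scl sub that]) (auto simp: annihilates_def)
  moreover have "h ?r = 0" if "annihilates h J" "?r \<in> J" for h
    using that by (simp add: annihilates_def)
  ultimately show ?thesis
    using eq by (intro iffI allI impI) (fastforce, simp)
qed

end

section \<open>The unique extension property\<close>

text \<open>If an extension differs from \<open>\<tau>\<close> at one homogeneous pair, a linear
  form with value 1 on the difference yields a cocycle that is nonzero there, contradicting
  \<open>cocycle_vanishes\<close>.\<close>

lemma unique_extension_if_tau_quadratic:
  assumes "tau_quadratic A B \<tau>"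
  shows "unique_extension_property A B \<tau>"
  unfolding unique_extension_property_def
proof (intro allI impI ballI)
  fix n t z
  assume n: "3 \<le> n" and t: "graded_linear (tensor B A) (tensor A B) t" and tt: "twisting_to_degree A B n t"
    and agree: "\<forall>i<n. \<forall>z\<in>homog (tensor B A) i. t z = \<tau> z" and z: "z \<in> homog (tensor B A) n"
  show "t z = \<tau> z"
  proof (rule linear_on_homog_tensor_eq[OF homog_scalable_B homog_scalable_A graded_linear_linear_on[OF t] graded_linear_linear_on[OF tau_graded_linear] _ z], rule ccontr)
    fix b a k l
    assume ba: "b \<in> homog B k" "a \<in> homog A l" "k + l = n"
      and neq: "t (pure B A b a) \<noteq> tw b a"
    obtain \<phi> where \<phi>: "Vector_Spaces.linear tensor_scl (*) \<phi>" "\<phi> (t (pure B A b a) - tw b a) = 1"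
      using separating_functional[OF vector_space_tensor_scl tensor_vs.subspace_single_0, of "t (pure B A b a) - tw b a"]
        neq by auto
    interpret \<phi>: Vector_Spaces.linear tensor_scl "(*)" \<phi> by fact
    have lin: "linear_on (tensor A B) (*) \<phi>" using \<phi>(1) by (intro linear_on_of_linear) (simp add: scl_tensor)
    let ?f = "\<lambda>b a. \<phi> (t (pure B A b a)) - \<phi> (tw b a)"
    have "cocycle n (bitrunc n ?f)"
      by (rule cocycle_of_extension[OF t tt _ lin]) (use agree in blast)
    then have "bitrunc n ?f b a = 0" by (rule cocycle_vanishes[OF _ n assms])
    moreover have "bilinear_map B A (*) ?f"
      by (rule bilinear_map_diff[OF bilinear_functional_twist(1)[OF t lin] bilinear_functional_twist(1)[OF tau_graded_linear lin]])
    ultimately show False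
      using bitrunc_homog[OF _ ba(1,2), of ?f n] ba(3) \<phi>(2) by (simp add: \<phi>.diff)
  qed
qed

lemma pure_nonzero:
  assumes "a \<noteq> 0" "b \<noteq> 0"
  shows "pure A B a b \<noteq> 0"
proof -
  obtain \<phi> where \<phi>: "Vector_Spaces.linear (scl A) (*) \<phi>" "\<phi> a = 1"
    using separating_functional[OF A.is_vector_space Avs.subspace_single_0, of a] assms by auto
  obtain \<psi> where \<psi>: "Vector_Spaces.linear (scl B) (*) \<psi>" "\<psi> b = 1"
    using separating_functional[OF B.is_vector_space Bvs.subspace_single_0, of b] assms by auto
  have "bilinear_map A B (*) (\<lambda>x y. \<phi> x * \<psi> y)"
    using linear_on_of_linear[OF \<phi>(1)] linear_on_of_linear[OF \<psi>(1)]
    by (simp add: bilinear_map_def linear_on_def algebra_simps)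
  then have "pure A B a b (\<lambda>x y. \<phi> x * \<psi> y) = 1"
    using \<phi> \<psi> by (simp add: pure_def)
  then show ?thesis by (metis zero_fun_def zero_neq_one)
qed

lemma tau_quadratic_if_unique_extension:
  assumes uep: "unique_extension_property A B \<tau>"
  shows "tau_quadratic A B \<tau>"
proof -
  let ?c = "free_product_class A B"
  let ?g = "\<lambda>b a. ?c (genB b) \<otimes>\<^bsub>free_product A B\<^esub> ?c (genA a)
        \<ominus>\<^bsub>free_product A B\<^esub> tensor_to_free_product A B (tw b a)"
  define G where "G = {?g b a | a b. a \<in> elems A \<and> b \<in> elems B}"
  \<comment> \<open>Pairs of degree (1, 1) suffice in degree 2, since a generator with one factor of
    degree 0 is already zero in the free product.\<close>
  define S where "S = {?g b a | a b. a \<in> homog A 1 \<and> b \<in> homog B 1}"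
  have SG: "S \<subseteq> G" unfolding S_def G_def by auto
  have gc: "?g b a = ?c (genB b * genA a - (\<Sum>(x, y)\<leftarrow>ps. genA x * genB y))"
    if "tw b a = (\<Sum>(x, y)\<leftarrow>ps. pure A B x y)" for b a ps
    unfolding that by (rule twisting_generator_class[OF A.is_subspace B.is_subspace]) auto
  have list: "\<exists>ps. tw b a = (\<Sum>(x, y)\<leftarrow>ps. pure A B x y)" for b a
    by (rule tensor_list[OF A.is_subspace B.is_subspace tw_mem]) blast
  have Gcar: "G \<subseteq> carrier (free_product A B)"
    unfolding carrier_free_product G_def using list gc by blast
  then have Scar: "S \<subseteq> carrier (free_product A B)" using SG by blast
  define J where "J = {p. ?c p \<in> Idl\<^bsub>free_product A B\<^esub> S}"
  have J: "ideal J free_ring" unfolding J_def by (rule class_vimage_genideal(1)[OF Scar])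
  have relJ: "free_product_relations A B \<subseteq> J"
    using class_vimage_genideal(2)[OF Scar] free_product_ideal_closed(5)[of A B] unfolding J_def by blast
  note dz = defect_zero_iff[OF J relJ]
  have main: "defect h b a = 0" if "b \<in> homog B k" "a \<in> homog A l" "k + l = n" "annihilates h J" for h b a k l n
    using that
  proof (induction n arbitrary: h b a k l rule: less_induct)
    case (less n)
    note h = less.prems(4) and b = less.prems(1) and a = less.prems(2)
    note f = bilinear_defect[OF J relJ h]
    note s = form_simps[OF f]
    \<comment> \<open>Two positive degrees with sum at most 2 are both 1, and such a pair belongs to
      the generators of \<open>J\<close>.\<close>
    consider "k = 0" | "l = 0" | "k = 1" "l = 1" | "n \<ge> 3" using less.prems(3) by linarith
    then show ?case
    proof cases
      case 1
      then have "b = scl B (B.eps b) 1" using b B.homog_zero_eq by blast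
      then show ?thesis using s(3) defect_unit(1)[OF J relJ h] by (metis mult_zero_right)
    next
      case 2
      then have "a = scl A (A.eps a) 1" using a A.homog_zero_eq by blast
      then show ?thesis using s(4) defect_unit(2)[OF J relJ h] by (metis mult_zero_right)
    next
      case 3
      obtain ps where ps: "tw b a = (\<Sum>(x, y)\<leftarrow>ps. pure A B x y)" using list by blast
      have "?g b a \<in> S" using a b 3 unfolding S_def by blast
      then have "?g b a \<in> Idl\<^bsub>free_product A B\<^esub> S"
        using ring.genideal_self[OF ring_free_product Scar] by blast
      then show ?thesis using dz[OF ps] h unfolding gc[OF ps] J_def by blast
    next
      case 4
      show ?thesis
      proof (rule ccontr)
        assume d: "defect h b a \<noteq> 0"
        have co: "cocycle n (bitrunc n (defect h))"
          using less.IH by (intro cocycle_of_ideal[OF J relJ _ h]) blast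
        \<comment> \<open>Any nonzero tensor of degree \<open>n\<close> would serve as direction of
          the deformation. \<open>a \<otimes> b\<close> is nonzero because a bilinear form does not
          vanish at \<open>(b, a)\<close>.\<close>
        let ?\<beta> = "bitrunc n (defect h)" and ?v = "pure A B a b"
        have v: "?v \<in> homog (tensor A B) n"
          by (rule pure_in_homog[OF a b]) (use less.prems(3) in simp)
        obtain t where t: "graded_linear (tensor B A) (tensor A B) t" "twisting_to_degree A B n t"
          and tp: "\<And>b a. t (pure B A b a) = tw b a + tensor_scl (?\<beta> b a) ?v"
          by (rule cocycle_deformation[OF co v]) blast
        have agree: "t z = \<tau> z" if "i < n" "z \<in> homog (tensor B A) i" for i z
          by (rule linear_on_homog_tensor_eq[OF homog_scalable_B homog_scalable_A graded_linear_linear_on[OF t(1)] graded_linear_linear_on[OF tau_graded_linear] _ that(2)])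
            (use that(1) in \<open>auto simp: tp bitrunc_homog[OF f]\<close>)
        have "t (pure B A b a) = tw b a"
          using uep 4 t agree pure_in_homog[OF b a less.prems(3)] unfolding unique_extension_property_def by blast
        then have "tensor_scl (defect h b a) ?v = 0"
          using less.prems(3) by (simp add: tp bitrunc_homog[OF f b a])
        moreover have "?v \<noteq> 0"
          using d s(5,6) by (intro pure_nonzero) auto
        ultimately show False using d by simp
      qed
    qed
  qed
  have all: "defect h b a = 0" if h: "annihilates h J" for h b a
  proof (induction b rule: B.homog_induct)
    case (homog k b)
    then have b: "b \<in> homog B k" .
    show ?case
      by (induction a rule: A.homog_induct) (simp_all add: main[OF b _ refl h] form_simps[OF bilinear_defect[OF J relJ h]])
  qed (simp add: form_simps[OF bilinear_defect[OF J relJ h]])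
  have "G \<subseteq> Idl\<^bsub>free_product A B\<^esub> S"
  proof
    fix X assume "X \<in> G"
    then obtain b a where X: "X = ?g b a" unfolding G_def by blast
    obtain ps where ps: "tw b a = (\<Sum>(x, y)\<leftarrow>ps. pure A B x y)" using list by blast
    show "X \<in> Idl\<^bsub>free_product A B\<^esub> S"
      using dz[OF ps] all unfolding X gc[OF ps] J_def by blast
  qed
  then have "Idl\<^bsub>free_product A B\<^esub> G \<subseteq> Idl\<^bsub>free_product A B\<^esub> S"
    by (rule ring.genideal_minimal[OF ring_free_product ring.genideal_ideal[OF ring_free_product Scar]])
  moreover have "Idl\<^bsub>free_product A B\<^esub> S \<subseteq> Idl\<^bsub>free_product A B\<^esub> G"
    using SG ring.genideal_self[OF ring_free_product Gcar]
    by (intro ring.genideal_minimal[OF ring_free_product ring.genideal_ideal[OF ring_free_product Gcar]]) blast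
  ultimately have "twisting_ideal A B \<tau> = Idl\<^bsub>free_product A B\<^esub> S"
    unfolding twisting_ideal_def G_def by simp
  moreover have "S \<subseteq> free_product_homog A B 2"
  proof
    fix X assume "X \<in> S"
    then obtain b a where X: "X = ?g b a" and ba: "a \<in> homog A 1" "b \<in> homog B 1" unfolding S_def by blast
    \<comment> \<open>As \<open>\<tau>\<close> preserves degree, the normally ordered part of the
      relation also consists of words of degree 2.\<close>
    have "tw b a \<in> homog (tensor A B) 2" using tw_homog[OF ba(2,1) refl] by (simp add: numeral_2_eq_2)
    then obtain ps where ps: "tw b a = (\<Sum>(x, y)\<leftarrow>ps. pure A B x y)"
      "\<And>v w. (v, w) \<in> set ps \<Longrightarrow> \<exists>k l. k + l = 2 \<and> v \<in> homog A k \<and> w \<in> homog B l"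
      using homog_tensor_list[OF homog_scalable_A homog_scalable_B] by blast
    let ?W = "{word xs | xs. \<exists>ds. list_all2 (letter_homog A B) xs ds \<and> sum_list ds = 2} :: ('k, 'a, 'b) free_alg set"
    have w: "word [x, y] \<in> free_vs.span ?W" if "letter_homog A B x k" "letter_homog A B y l" "k + l = 2" for x y k l
      by (rule free_vs.span_base) (use that in \<open>auto intro!: exI[of _ "[x, y]"] exI[of _ "[k, l]"]\<close>)
    have w2: "word [x] * word [y] = word [x, y]" for x y :: "'a + 'b"
      by (simp flip: word_append)
    have "genB b * genA a \<in> free_vs.span ?W"
      unfolding w2 using ba by (intro w[of _ 1 _ 1]) simp_all
    moreover have "(\<Sum>(x, y)\<leftarrow>ps. genA x * genB y) \<in> free_vs.span ?W"
      using ps(2)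
    proof (induction ps)
      case Nil
      show ?case by (simp add: free_vs.span_zero)
    next
      case (Cons p ps)
      obtain x y where p: "p = (x, y)" by fastforce
      with Cons.prems obtain k l where kl: "k + l = 2" "x \<in> homog A k" "y \<in> homog B l"
        by (metis list.set_intros(1))
      have "genA x * genB y \<in> free_vs.span ?W"
        unfolding w2 using kl by (intro w[of _ k _ l]) simp_all
      moreover have "(\<Sum>(x, y)\<leftarrow>ps. genA x * genB y) \<in> free_vs.span ?W"
        using Cons by auto
      ultimately show ?case by (simp add: p free_vs.span_add)
    qed
    ultimately show "X \<in> free_product_homog A B 2"
      unfolding X gc[OF ps(1)] free_product_homog_def by (intro imageI free_vs.span_diff)
  qed
  ultimately show ?thesis unfolding tau_quadratic_def by blast
qed

end

section \<open>The case of a zero algebra\<close>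

lemma tensor_trivial:
  assumes V: "subspace_of_vector_space V" and W: "subspace_of_vector_space W"
    and triv: "(\<forall>v\<in>elems V. v = 0) \<or> (\<forall>w\<in>elems W. w = 0)" and z: "z \<in> elems (tensor V W)"
  shows "z = 0"
proof -
  obtain ps where ps: "set ps \<subseteq> elems V \<times> elems W" "z = (\<Sum>(v, w)\<leftarrow>ps. pure V W v w)"
    by (rule tensor_list[OF V W z])
  have "pure V W v w = 0" if vw: "v \<in> elems V" "w \<in> elems W" for v w
  proof -
    have "pure V W (v + v) w = pure V W v w + pure V W v w" "pure V W v (w + w) = pure V W v w + pure V W v w"
      using bilinear_map_pure[OF V W] vw unfolding bilinear_map_def by blast+
    then show ?thesis using triv vw by (metis add_0 add_cancel_right_right)
  qed
  then show ?thesis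
    using ps(1) unfolding ps(2) by (induction ps) (auto simp: zero_fun_def)
qed

lemma unique_extension_trivial:
  fixes A :: "('k::field, 'a::{ring, monoid_mult}) gspace" and B :: "('k, 'b::{ring, monoid_mult}) gspace"
  assumes A: "graded_algebra A" and B: "graded_algebra B" and \<tau>: "graded_twisting_map A B \<tau>"
    and triv: "(1 :: 'a) = 0 \<or> (1 :: 'b) = 0"
  shows "unique_extension_property A B \<tau>"
proof -
  interpret algebra_pair A B using A B by (rule algebra_pair.intro)
  have "a = 0" if "(1 :: 'a) = 0" for a :: 'a
    using mult_1_right[of a] that by simp
  moreover have "b = 0" if "(1 :: 'b) = 0" for b :: 'b
    using mult_1_right[of b] that by simp
  ultimately have "(\<forall>a::'a. a = 0) \<or> (\<forall>b::'b. b = 0)"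
    using triv by blast
  then have *: "z = 0" if "z \<in> elems (tensor A B)" for z
    by (intro tensor_trivial[OF A.is_subspace B.is_subspace _ that]) auto
  show ?thesis
    unfolding unique_extension_property_def
  proof (intro allI impI ballI)
    fix n t z
    assume t: "graded_linear (tensor B A) (tensor A B) t" and z: "z \<in> homog (tensor B A) n"
    have "z \<in> elems (tensor B A)" using z homog_tensor_sub[OF homog_scalable_B homog_scalable_A] by blast
    then show "t z = \<tau> z"
      using *[OF graded_linear_mem[OF t]] *[OF graded_linear_mem[of \<tau>]] \<tau> by (simp add: graded_twisting_map_def)
  qed
qed

text \<open>If \<open>1 = 0\<close> in one of the algebras, the letters of its \<open>0\<close> and
  its \<open>1\<close> coincide; the first is zero in the free product by additivity and the second
  is its unit. The free product is then the zero ring, whose only ideal is generated by the empty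
  set.\<close>

lemma tau_quadratic_trivial:
  fixes A :: "('k::field, 'a::{ring, monoid_mult}) gspace" and B :: "('k, 'b::{ring, monoid_mult}) gspace"
  assumes A: "graded_algebra A" and B: "graded_algebra B" and \<tau>: "graded_twisting_map A B \<tau>"
    and triv: "(1 :: 'a) = 0 \<or> (1 :: 'b) = 0"
  shows "tau_quadratic A B \<tau>"
proof -
  interpret algebra_pair A B using A B by (rule algebra_pair.intro)
  let ?I = "free_product_ideal A B"
  note I = ideal_free_ringD[OF ideal_free_product_ideal[of A B]]
  have "genA (0 + 0) - (genA 0 + genA 0) \<in> ?I" "genA 1 - 1 \<in> ?I"
    "genB (0 + 0) - (genB 0 + genB 0) \<in> ?I" "genB 1 - 1 \<in> ?I"
    by (rule subsetD[OF free_product_ideal_closed(5)], unfold free_product_relations_def, blast)+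
  then have "genA 0 \<in> ?I" "genA 1 - 1 \<in> ?I" "genB 0 \<in> ?I" "genB 1 - 1 \<in> ?I"
    using I(3)[of "genA (0 + 0) - (genA 0 + genA 0)" "- 1"] I(3)[of "genB (0 + 0) - (genB 0 + genB 0)" "- 1"]
    by simp_all
  then have "1 \<in> ?I"
    using triv I(5)[of "genA 0" "genA 0 - 1"] I(5)[of "genB 0" "genB 0 - 1"] by auto
  then have "p \<in> ?I" for p
    using I(3)[of 1 p] by simp
  then have one: "free_product_class A B p = free_product_class A B 0" for p
    by (simp add: free_product_class_eq_iff)
  have eq: "K = {free_product_class A B 0}" if K: "ideal K (free_product A B)" for K
  proof -
    have "K \<subseteq> {free_product_class A B 0}"
      using additive_subgroup.a_subset[OF ideal.axioms(1)[OF K]] one unfolding carrier_free_product by fastforce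
    moreover have "K \<noteq> {}"
      using additive_subgroup.zero_closed[OF ideal.axioms(1)[OF K]] by blast
    ultimately show ?thesis by blast
  qed
  let ?G = "{free_product_class A B (genB b) \<otimes>\<^bsub>free_product A B\<^esub> free_product_class A B (genA a)
        \<ominus>\<^bsub>free_product A B\<^esub> tensor_to_free_product A B (\<tau> (pure B A b a)) | a b.
      a \<in> elems A \<and> b \<in> elems B}"
  have "?G \<subseteq> carrier (free_product A B)"
  proof clarify
    fix a b
    have "\<tau> (pure B A b a) \<in> elems (tensor A B)"
      by (rule graded_linear_mem[of \<tau>]) (use \<tau> in \<open>simp_all add: graded_twisting_map_def\<close>)
    then obtain ps where ps: "set ps \<subseteq> elems A \<times> elems B" "\<tau> (pure B A b a) = (\<Sum>(x, y)\<leftarrow>ps. pure A B x y)"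
      by (rule tensor_list[OF A.is_subspace B.is_subspace])
    show "free_product_class A B (genB b) \<otimes>\<^bsub>free_product A B\<^esub> free_product_class A B (genA a)
        \<ominus>\<^bsub>free_product A B\<^esub> tensor_to_free_product A B (\<tau> (pure B A b a)) \<in> carrier (free_product A B)"
      unfolding ps(2) twisting_generator_class[OF A.is_subspace B.is_subspace ps(1)] carrier_free_product by blast
  qed
  then have "twisting_ideal A B \<tau> = {free_product_class A B 0}"
    unfolding twisting_ideal_def by (rule eq[OF ring.genideal_ideal[OF ring_free_product]])
  moreover have "Idl\<^bsub>free_product A B\<^esub> {} = {free_product_class A B 0}"
    by (rule eq[OF ring.genideal_ideal[OF ring_free_product empty_subsetI]])
  ultimately have "twisting_ideal A B \<tau> = Idl\<^bsub>free_product A B\<^esub> {}" by (rule trans[OF _ sym])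
  then show ?thesis unfolding tau_quadratic_def by (intro exI[of _ "{}"] conjI empty_subsetI)
qed

theorem theorem4p3:
  fixes A :: "('k::field, 'a::{ring, monoid_mult}) gspace"
    and B :: "('k, 'b::{ring, monoid_mult}) gspace"
    and \<tau> :: "('k, 'b, 'a) tensor \<Rightarrow> ('k, 'a, 'b) tensor"
  assumes "connected_graded_algebra A"
    and "connected_graded_algebra B"
    and "graded_twisting_map A B \<tau>"
  shows "unique_extension_property A B \<tau> \<longleftrightarrow> tau_quadratic A B \<tau>"
proof (cases "(1 :: 'a) = 0 \<or> (1 :: 'b) = 0")
  case True
  then show ?thesis
    using unique_extension_trivial[OF _ _ assms(3)] tau_quadratic_trivial[OF _ _ assms(3)]
      assms(1,2)[THEN connected_graded_algebra.axioms(1)] by blast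
next
  case False
  then interpret twisted_pair A B \<tau>
    using assms
    by (simp add: twisted_pair_def twisted_pair_axioms_def augmented_pair_def augmented_algebra_def
      augmented_algebra_axioms_def)
  show ?thesis
    using unique_extension_if_tau_quadratic tau_quadratic_if_unique_extension by blast
qed

end
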